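(* Let $G$ be a compact group with normalized Haar measure $m_G$, let $X$ be a complex Banach space, let $\Phi$ be a Young function, and let $\nu$ be a nonzero $X$-valued vector measure on $G$ which is absolutely continuous with respect to $m_G$ and norm integral translation invariant. If $f\in L^1_w(\nu)$ and $g\in L^\Phi_w(\nu)$, then $f*_\nu g\in\mathcal{B}(X',L^\Phi_w(\nu))$ and $$\|f*_\nu g\|_{\mathcal{B}(X',L^\Phi_w(\nu))}\le\|f\|_\nu\,\|g\|_{\nu,\Phi}.$$ In particular, if $f\in L^1(\nu)$ and $g\in L^\Phi(\nu)$, then $f*_\nu g\in\mathcal{B}(X',L^\Phi(\nu))$.
   Context: $\mathcal{B}(G)$ is the Borel $\sigma$-algebra of $G$; $L^1(G)$ is taken with respect to $m_G$. $\mathcal{B}(Y,Z)$ denotes the space of bounded linear operators from $Y$ to $Z$ with the operator norm. A vector measure $\nu$ is a $\sigma$-additive map $\mathcal{B}(G)\to X$. $X'$ is the topological dual of $X$, $B_{X'}$ its closed unit ball; for $x'\in X'$, $\langle\nu,x'\rangle(A)=\langle\nu(A),x'\rangle$ is a complex measure with total variation $|\langle\nu,x'\rangle|$. $\nu$ is absolutely continuous w.r.t. $m_G$ if $\nu(A)\to0$ as $m_G(A)\to 0$. A set $A$ is $\nu$-null if $\nu(B)=0$ for all Borel $B\subset A$; functions equal off a $\nu$-null set are identified. $\tau_s f(t)=f(s^{-1}t)$. For a simple function $\phi=\sum_i\alpha_i\chi_{A_i}$, $I_\nu(\phi)=\int_G\phi\,d\nu=\sum_i\alpha_i\nu(A_i)$.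 $\nu$ is norm integral translation invariant if $\|I_\nu(\tau_s\phi)\|=\|I_\nu(\phi)\|$ for every simple function $\phi$ on $G$ and every $s\in G$. A Young function is a strictly increasing, convex, continuous $\Phi:[0,\infty)\to[0,\infty)$ with $\Phi(t)=0$ iff $t=0$ and $\lim_{t\to\infty}\Phi(t)=\infty$. For a finite positive measure $\mu$, $\|f\|_{L^\Phi(\mu)}=\inf\{k>0:\int_G\Phi(|f|/k)\,d\mu\le 1\}$. $L^\Phi_w(\nu)$ is the space of complex measurable $f$ with $\|f\|_{\nu,\Phi}=\sup_{x'\in B_{X'}}\|f\|_{L^\Phi(|\langle\nu,x'\rangle|)}<\infty$, and $L^\Phi(\nu)$ is the closure of the simple functions in it under $\|\cdot\|_{\nu,\Phi}$. For $\Phi(t)=t$ these are $L^1_w(\nu)$ and $L^1(\nu)$, with norm $\|f\|_\nu=\sup_{x'\in B_{X'}}\int_G|f|\,d|\langle\nu,x'\rangle|$. Since $\nu\ll m_G$, for each $x'\in X'$ there is $h_{x'}\in L^1(G)$ with $d\langle\nu,x'\rangle=h_{x'}\,dm_G$, and $fh_{x'}\in L^1(G)$ for $f\in L^1_w(\nu)$. For such $\nu$, $\nu$-null and $m_G$-null sets coincide and $L^\Phi_w(\nu)\subset L^1(G)$. For $f\in L^1_w(\nu)$ and $g\in L^\Phi_w(\nu)$ define, for $x'\in X'$, $f*_\nu g(x')=(fh_{x'})*g$, where $*$ is the usual convolution $u*v(t)=\int_G u(s)v(s^{-1}t)\,dm_G(s)$; i.e. $f*_\nu g(x')(t)=\int_G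 f(s)\,\tau_s g(t)\,d\langle\nu,x'\rangle(s)$. *)

theory Defs
  imports "HOL-Analysis.Analysis"
begin

section \<open>Complex Banach spaces and their duals\<close>

class complex_banach = banach +
  fixes scaleC :: "complex \<Rightarrow> 'a \<Rightarrow> 'a"  (infixr "*\<^sub>C" 75)
  assumes scaleC_add_right: "a *\<^sub>C (x + y) = a *\<^sub>C x + a *\<^sub>C y"
    and scaleC_add_left: "(a + b) *\<^sub>C x = a *\<^sub>C x + b *\<^sub>C x"
    and scaleC_scaleC: "a *\<^sub>C (b *\<^sub>C x) = (a * b) *\<^sub>C x"
    and scaleR_scaleC: "r *\<^sub>R x = complex_of_real r *\<^sub>C x"
    and norm_scaleC: "norm (a *\<^sub>C x) = cmod a * norm x"

instantiation complex :: complex_banach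
begin

definition scaleC_complex :: "complex \<Rightarrow> complex \<Rightarrow> complex"
  where "scaleC_complex a x = a * x"

instance
  by standard (auto simp: scaleC_complex_def algebra_simps norm_mult scaleR_conv_of_real)

end

lemma bounded_linear_scaleC: "bounded_linear (\<lambda>x :: 'a::complex_banach. a *\<^sub>C x)"
  by (rule bounded_linear_intro[where K = "cmod a"])
     (auto simp: scaleC_add_right scaleR_scaleC scaleC_scaleC norm_scaleC mult.commute)

instantiation blinfun :: (real_normed_vector, complex_banach) complex_banach
begin

lift_definition scaleC_blinfun :: "complex \<Rightarrow> ('a \<Rightarrow>\<^sub>L 'b) \<Rightarrow> ('a \<Rightarrow>\<^sub>L 'b)"
  is "\<lambda>a F x. a *\<^sub>C F x"
  by (rule bounded_linear_compose[OF bounded_linear_scaleC])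

instance
proof
  fix a b :: complex and r :: real and F H :: "'a \<Rightarrow>\<^sub>L 'b"
  show "a *\<^sub>C (F + H) = a *\<^sub>C F + a *\<^sub>C H"
    by transfer (simp add: scaleC_add_right)
  show "(a + b) *\<^sub>C F = a *\<^sub>C F + b *\<^sub>C F"
    by transfer (simp add: scaleC_add_left)
  show "a *\<^sub>C (b *\<^sub>C F) = (a * b) *\<^sub>C F"
    by transfer (simp add: scaleC_scaleC)
  show "r *\<^sub>R F = complex_of_real r *\<^sub>C F"
    by transfer (simp add: scaleR_scaleC)
  have le: "norm (c *\<^sub>C L) \<le> cmod c * norm L" for c and L :: "'a \<Rightarrow>\<^sub>L 'b"
  proof (rule norm_blinfun_bound)
    show "norm (blinfun_apply (c *\<^sub>C L) x) \<le> cmod c * norm L * norm x" for x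
      using mult_left_mono[OF norm_blinfun[of L x], of "cmod c"]
      by (simp add: scaleC_blinfun.rep_eq norm_scaleC mult.assoc)
  qed simp
  show "norm (a *\<^sub>C F) = cmod a * norm F"
  proof (cases "a = 0")
    case True
    then show ?thesis using le[of a F] by simp
  next
    case False
    have "x = 1 *\<^sub>C x" for x :: 'b
      using scaleR_scaleC[of 1 x] by simp
    then have "inverse a *\<^sub>C a *\<^sub>C F = F"
      using False by (intro blinfun_eqI) (simp add: scaleC_blinfun.rep_eq scaleC_scaleC)
    then have "norm F \<le> cmod (inverse a) * norm (a *\<^sub>C F)"
      using le[of "inverse a" "a *\<^sub>C F"] by simp
    then have "cmod a * norm F \<le> norm (a *\<^sub>C F)"
      using False mult_left_mono[of "norm F" "inverse (cmod a) * norm (a *\<^sub>C F)" "cmod a"]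
      by (simp add: norm_inverse flip: mult.assoc)
    then show ?thesis using le[of a F] by simp
  qed
qed

end

text \<open>
  Elements of \<^typ>\<open>'x \<Rightarrow>\<^sub>L complex\<close> are the bounded real-linear maps; the topological dual
  consists of the complex-linear ones, with the operator norm.
\<close>

definition dual :: "('x::complex_banach \<Rightarrow>\<^sub>L complex) set"
  where "dual = {x'. \<forall>a x. blinfun_apply x' (a *\<^sub>C x) = a * blinfun_apply x' x}"

definition dual_ball :: "('x::complex_banach \<Rightarrow>\<^sub>L complex) set"
  where "dual_ball = {x' \<in> dual. norm x' \<le> 1}"


section \<open>Haar measure\<close>

text \<open>
  Groups are written additively, following the library class \<^class>\<open>topological_group_add\<close>,
  which does not assume commutativity: \<open>s + t\<close> is the product and \<open>- s + t\<close> is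
  \<open>s\<close> inverse times \<open>t\<close>.
\<close>

definition normalized_haar :: "'g::{topological_group_add, t2_space} measure \<Rightarrow> bool"
  where "normalized_haar m \<longleftrightarrow>
    sets m = sets borel \<and>
    emeasure m UNIV = 1 \<and>
    (\<forall>s. \<forall>A\<in>sets borel. emeasure m ((\<lambda>t. s + t) ` A) = emeasure m A) \<and>
    (\<forall>A\<in>sets borel. emeasure m A = (INF U\<in>{U. open U \<and> A \<subseteq> U}. emeasure m U)) \<and>
    (\<forall>A\<in>sets borel. emeasure m A = (SUP K\<in>{K. compact K \<and> K \<subseteq> A}. emeasure m K))"

definition translate :: "'g::group_add \<Rightarrow> ('g \<Rightarrow> 'b) \<Rightarrow> 'g \<Rightarrow> 'b"
  where "translate s f = (\<lambda>t. f (- s + t))"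

definition convolution ::
    "'g::{topological_group_add, t2_space} measure \<Rightarrow> ('g \<Rightarrow> complex) \<Rightarrow> ('g \<Rightarrow> complex) \<Rightarrow> 'g \<Rightarrow> complex"
  where "convolution m u v = (\<lambda>t. LINT s|m. u s * v (- s + t))"


section \<open>Vector measures\<close>

text \<open>Only the values of \<open>\<nu>\<close> on Borel sets are relevant in what follows.\<close>

definition vector_measure :: "('g::topological_space set \<Rightarrow> 'x::complex_banach) \<Rightarrow> bool"
  where "vector_measure \<nu> \<longleftrightarrow>
    (\<forall>A :: nat \<Rightarrow> 'g set. range A \<subseteq> sets borel \<longrightarrow> disjoint_family A \<longrightarrow>
      (\<lambda>i. \<nu> (A i)) sums \<nu> (\<Union>i. A i))"

definition nonzero_measure :: "('g::topological_space set \<Rightarrow> 'x::complex_banach) \<Rightarrow> bool"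
  where "nonzero_measure \<nu> \<longleftrightarrow> (\<exists>A\<in>sets borel. \<nu> A \<noteq> 0)"

definition abs_cont :: "('g::topological_space set \<Rightarrow> 'x::complex_banach) \<Rightarrow> 'g measure \<Rightarrow> bool"
  where "abs_cont \<nu> m \<longleftrightarrow>
    (\<forall>e>0. \<exists>d>0. \<forall>A\<in>sets borel. measure m A < d \<longrightarrow> norm (\<nu> A) < e)"

definition nu_null :: "('g::topological_space set \<Rightarrow> 'x::complex_banach) \<Rightarrow> 'g set \<Rightarrow> bool"
  where "nu_null \<nu> A \<longleftrightarrow> A \<in> sets borel \<and> (\<forall>B\<in>sets borel. B \<subseteq> A \<longrightarrow> \<nu> B = 0)"

definition nu_eq ::
    "('g::topological_space set \<Rightarrow> 'x::complex_banach) \<Rightarrow> ('g \<Rightarrow> complex) \<Rightarrow> ('g \<Rightarrow> complex) \<Rightarrow> bool"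
  where "nu_eq \<nu> f g \<longleftrightarrow> (\<exists>N. nu_null \<nu> N \<and> (\<forall>t. t \<notin> N \<longrightarrow> f t = g t))"

definition simple_integral_nu ::
    "('g::topological_space set \<Rightarrow> 'x::complex_banach) \<Rightarrow> ('g \<Rightarrow> complex) \<Rightarrow> 'x"
  where "simple_integral_nu \<nu> \<phi> = (\<Sum>a\<in>range \<phi>. a *\<^sub>C \<nu> (\<phi> -` {a}))"

definition norm_integral_translation_invariant ::
    "('g::{topological_group_add, t2_space} set \<Rightarrow> 'x::complex_banach) \<Rightarrow> bool"
  where "norm_integral_translation_invariant \<nu> \<longleftrightarrow>
    (\<forall>\<phi> s. simple_function borel \<phi> \<longrightarrow>
      norm (simple_integral_nu \<nu> (translate s \<phi>)) = norm (simple_integral_nu \<nu> \<phi>))"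

definition scalar_measure ::
    "('g set \<Rightarrow> 'x::complex_banach) \<Rightarrow> ('x \<Rightarrow>\<^sub>L complex) \<Rightarrow> 'g set \<Rightarrow> complex"
  where "scalar_measure \<nu> x' A = blinfun_apply x' (\<nu> A)"

definition total_variation :: "('g::topological_space set \<Rightarrow> complex) \<Rightarrow> 'g measure"
  where "total_variation \<mu> = measure_of UNIV (sets borel)
    (\<lambda>A. SUP P\<in>{P. finite P \<and> P \<subseteq> sets borel \<and> disjoint P \<and> \<Union>P = A}.
       \<Sum>B\<in>P. ennreal (cmod (\<mu> B)))"

text \<open>The function \<open>h\<close> with \<open>d\<langle>\<nu>,x'\<rangle> = h dm\<close>; it is determined up to \<open>m\<close>-null sets.\<close>

definition dual_density ::
    "('g::topological_space set \<Rightarrow> 'x::complex_banach) \<Rightarrow> 'g measure \<Rightarrow> ('x \<Rightarrow>\<^sub>L complex) \<Rightarrow> 'g \<Rightarrow> complex"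
  where "dual_density \<nu> m x' = (SOME h. integrable m h \<and>
    (\<forall>A\<in>sets borel. scalar_measure \<nu> x' A = (LINT t:A|m. h t)))"


section \<open>Orlicz spaces\<close>

text \<open>Only the values on \<open>[0,\<infinity>)\<close> of a Young function are relevant.\<close>

definition young_function :: "(real \<Rightarrow> real) \<Rightarrow> bool"
  where "young_function \<Phi> \<longleftrightarrow>
    (\<forall>t\<ge>0. 0 \<le> \<Phi> t) \<and>
    strict_mono_on {0..} \<Phi> \<and> convex_on {0..} \<Phi> \<and> continuous_on {0..} \<Phi> \<and>
    (\<forall>t\<ge>0. \<Phi> t = 0 \<longleftrightarrow> t = 0) \<and> filterlim \<Phi> at_top at_top"

text \<open>The infimum of the empty set is \<open>\<infinity>\<close>.\<close>

definition luxemburg_norm :: "(real \<Rightarrow> real) \<Rightarrow> 'g measure \<Rightarrow> ('g \<Rightarrow> complex) \<Rightarrow> ennreal"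
  where "luxemburg_norm \<Phi> \<mu> f =
    (INF k\<in>{k::real. 0 < k \<and> (\<integral>\<^sup>+t. ennreal (\<Phi> (cmod (f t) / k)) \<partial>\<mu>) \<le> 1}. ennreal k)"

definition orlicz_norm ::
    "('g::topological_space set \<Rightarrow> 'x::complex_banach) \<Rightarrow> (real \<Rightarrow> real) \<Rightarrow> ('g \<Rightarrow> complex) \<Rightarrow> ennreal"
  where "orlicz_norm \<nu> \<Phi> f =
    (SUP x'\<in>dual_ball. luxemburg_norm \<Phi> (total_variation (scalar_measure \<nu> x')) f)"

text \<open>
  The function spaces below are sets of representatives; their elements are identified by
  \<^const>\<open>nu_eq\<close>.
\<close>

definition weak_orlicz ::
    "('g::topological_space set \<Rightarrow> 'x::complex_banach) \<Rightarrow> (real \<Rightarrow> real) \<Rightarrow> ('g \<Rightarrow> complex) set"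
  where "weak_orlicz \<nu> \<Phi> = {f \<in> borel_measurable borel. orlicz_norm \<nu> \<Phi> f < \<infinity>}"

definition orlicz ::
    "('g::topological_space set \<Rightarrow> 'x::complex_banach) \<Rightarrow> (real \<Rightarrow> real) \<Rightarrow> ('g \<Rightarrow> complex) set"
  where "orlicz \<nu> \<Phi> = {f \<in> weak_orlicz \<nu> \<Phi>.
    \<forall>e>0. \<exists>\<phi>. simple_function borel \<phi> \<and> orlicz_norm \<nu> \<Phi> (\<lambda>t. f t - \<phi> t) < e}"

abbreviation weak_L1 :: "('g::topological_space set \<Rightarrow> 'x::complex_banach) \<Rightarrow> ('g \<Rightarrow> complex) set"
  where "weak_L1 \<nu> \<equiv> weak_orlicz \<nu> (\<lambda>t. t)"

abbreviation L1 :: "('g::topological_space set \<Rightarrow> 'x::complex_banach) \<Rightarrow> ('g \<Rightarrow> complex) set"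
  where "L1 \<nu> \<equiv> orlicz \<nu> (\<lambda>t. t)"

definition L1_norm ::
    "('g::topological_space set \<Rightarrow> 'x::complex_banach) \<Rightarrow> ('g \<Rightarrow> complex) \<Rightarrow> ennreal"
  where "L1_norm \<nu> f =
    (SUP x'\<in>dual_ball. \<integral>\<^sup>+t. ennreal (cmod (f t)) \<partial>total_variation (scalar_measure \<nu> x'))"

lemma luxemburg_norm_id:
  assumes f: "f \<in> borel_measurable \<mu>"
  shows "luxemburg_norm (\<lambda>t. t) \<mu> f = (\<integral>\<^sup>+t. ennreal (cmod (f t)) \<partial>\<mu>)"
proof -
  let ?I = "\<integral>\<^sup>+t. ennreal (cmod (f t)) \<partial>\<mu>"
  have iff: "(\<integral>\<^sup>+t. ennreal (cmod (f t) / k) \<partial>\<mu>) \<le> 1 \<longleftrightarrow> ?I \<le> ennreal k" if k: "0 < k" for k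
  proof -
    have "(\<integral>\<^sup>+t. ennreal (cmod (f t) / k) \<partial>\<mu>) = (\<integral>\<^sup>+t. ennreal (cmod (f t)) / ennreal k \<partial>\<mu>)"
      using k by (intro nn_integral_cong) (simp add: divide_ennreal)
    also have "\<dots> = ?I / ennreal k"
      using f by (intro nn_integral_divide) auto
    finally show ?thesis
      using k by (cases ?I) (auto simp: divide_ennreal ennreal_top_divide top_unique)
  qed
  have "luxemburg_norm (\<lambda>t. t) \<mu> f = (INF k\<in>{k. 0 < k \<and> ?I \<le> ennreal k}. ennreal k)"
    unfolding luxemburg_norm_def using iff by (intro INF_cong) auto
  also have "\<dots> = ?I"
  proof (rule antisym)
    show "(INF k\<in>{k. 0 < k \<and> ?I \<le> ennreal k}. ennreal k) \<le> ?I"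
    proof (rule ennreal_le_epsilon)
      fix e :: real assume "?I < top" "0 < e"
      then obtain r where r: "?I = ennreal r" "0 \<le> r" by (cases ?I) auto
      have "(INF k\<in>{k. 0 < k \<and> ?I \<le> ennreal k}. ennreal k) \<le> ennreal (r + e)"
        using r \<open>0 < e\<close> by (intro INF_lower) (auto intro: ennreal_leI)
      then show "(INF k\<in>{k. 0 < k \<and> ?I \<le> ennreal k}. ennreal k) \<le> ?I + ennreal e"
        using r \<open>0 < e\<close> by simp
    qed
  qed (auto intro: INF_greatest)
  finally show ?thesis .
qed

lemma orlicz_norm_id:
  assumes "f \<in> borel_measurable borel"
  shows "orlicz_norm \<nu> (\<lambda>t. t) f = L1_norm \<nu> f"
proof -
  have "f \<in> borel_measurable (total_variation \<mu>)" for \<mu>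
  proof -
    have "sets (total_variation \<mu>) = sets (borel :: 'a measure)"
      unfolding total_variation_def using sets.sigma_sets_eq[of "borel :: 'a measure"]
      by (subst sets_measure_of) auto
    then show ?thesis using assms measurable_cong_sets by blast
  qed
  then show ?thesis by (simp add: orlicz_norm_def L1_norm_def luxemburg_norm_id)
qed


section \<open>Operators from the dual and the convolution associated to a vector measure\<close>

text \<open>
  \<open>operators \<nu> \<Phi> Z\<close> is the space of bounded complex-linear operators from the dual into \<open>Z\<close>,
  a subspace of \<^term>\<open>weak_orlicz \<nu> \<Phi>\<close> with its norm; linearity is that of the induced map
  into classes modulo \<^const>\<open>nu_eq\<close>.
\<close>

definition operators ::
    "('g::topological_space set \<Rightarrow> 'x::complex_banach) \<Rightarrow> (real \<Rightarrow> real) \<Rightarrow> ('g \<Rightarrow> complex) set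
      \<Rightarrow> (('x \<Rightarrow>\<^sub>L complex) \<Rightarrow> 'g \<Rightarrow> complex) set"
  where "operators \<nu> \<Phi> Z = {T.
    (\<forall>x'\<in>dual. T x' \<in> Z) \<and>
    (\<forall>x'\<in>dual. \<forall>y'\<in>dual. nu_eq \<nu> (T (x' + y')) (\<lambda>t. T x' t + T y' t)) \<and>
    (\<forall>a. \<forall>x'\<in>dual. nu_eq \<nu> (T (a *\<^sub>C x')) (\<lambda>t. a * T x' t)) \<and>
    (\<exists>C::real. \<forall>x'\<in>dual. orlicz_norm \<nu> \<Phi> (T x') \<le> ennreal (C * norm x'))}"

definition operator_norm ::
    "('g::topological_space set \<Rightarrow> 'x::complex_banach) \<Rightarrow> (real \<Rightarrow> real)
      \<Rightarrow> (('x \<Rightarrow>\<^sub>L complex) \<Rightarrow> 'g \<Rightarrow> complex) \<Rightarrow> ennreal"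
  where "operator_norm \<nu> \<Phi> T = (SUP x'\<in>dual_ball. orlicz_norm \<nu> \<Phi> (T x'))"

definition nu_convolution ::
    "'g::{topological_group_add, t2_space} measure \<Rightarrow> ('g set \<Rightarrow> 'x::complex_banach)
      \<Rightarrow> ('g \<Rightarrow> complex) \<Rightarrow> ('g \<Rightarrow> complex) \<Rightarrow> ('x \<Rightarrow>\<^sub>L complex) \<Rightarrow> 'g \<Rightarrow> complex"
  where "nu_convolution m \<nu> f g x' = convolution m (\<lambda>s. f s * dual_density \<nu> m x' s) g"

end

theory Submission
  imports Defs
begin

text \<open>
Write $h_{x'}$ for the density of $\langle\nu,x'\rangle$ with respect to Haar measure and $u = f h_{x'}$,
so that $f *_\nu g(x') = u * g$ and $\int |u| \le \|x'\| \|f\|_\nu$. Morally, $u * g = \int u(s)\, \tau_s g\, ds$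
is an average of translates of $g$, so Minkowski's inequality bounds its norm by
$\int |u(s)| \, \|\tau_s g\|_{\nu,\Phi}\, ds$, and everything follows once translations do not increase
$\|\cdot\|_{\nu,\Phi}$.

\<^bold>\<open>Translations.\<close> The hypothesis on $\nu$ concerns $\|I_\nu(\phi)\|$ for simple $\phi$. For a nonnegative
simple $\psi$, the integral of $\psi$ against $|\langle\nu,x'\rangle|$ is a supremum of
$|x'(I_\nu(\theta\psi))|$ over simple phases $\theta$ (\<open>simple_phase\<close>), and the norm of a vector is attained on
the dual ball by the Hahn-Banach theorem (\<open>norming_functional\<close>). Hence the supremum over the dual ball of
$\int F\, d|\langle\nu,x'\rangle|$ is unchanged by translation of $F \ge 0$ (\<open>tv_translation_le_SUP\<close>). The
condition $\|g\|_{\nu,\Phi} \le k$ says that this supremum is at most 1 for $F = \Phi(|g|/k)$, so it is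
inherited by all translates of $g$.

\<^bold>\<open>The inequality.\<close> Minkowski's inequality takes the form of Jensen's inequality with the probability weight
$|u|/\int|u|$, followed by Fubini's theorem (\<open>orlicz_norm_convolution_le_of_bound\<close>). The same interchange of
integrals, applied to the translates of $\Phi(|g|/k)$ and a nonzero $h_{x'}$, shows that $L^\Phi_w(\nu) \subseteq L^1(G)$
(\<open>integrable_weak_orlicz\<close>); so the convolution integrals converge almost everywhere and linearity in
$x'$ holds off a null set.

\<^bold>\<open>Fubini's theorem.\<close> The group need not be second countable, and then $(s,t) \mapsto g(s^{-1}t)$ is Borel
on $G \times G$ but possibly not measurable for the product of the Borel $\sigma$-algebras. Regularity of Haar measure
replaces product measurability: for Radon probabilities, iterated integrals of nonnegative Borel functions
on the product space make sense and agree (\<open>fubini_radon\<close>). It also gives invariance of Haar measure under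
inversion.

\<^bold>\<open>The closure of the simple functions.\<close> If $\phi$ is simple then $u * \phi$ is bounded and Borel, hence a
uniform limit of simple functions; uniform convergence implies convergence in $\|\cdot\|_{\nu,\Phi}$ because
$\nu$ has bounded semivariation. The inequality for $g - \phi$ transfers this to every $g \in L^\Phi(\nu)$.
\<close>

section \<open>Fubini's theorem for Borel functions and Radon probabilities\<close>

definition radon_prob :: "'a::t2_space measure \<Rightarrow> bool"
  where "radon_prob M \<longleftrightarrow> sets M = sets borel \<and> emeasure M UNIV = 1 \<and>
    (\<forall>A\<in>sets borel. emeasure M A = (SUP K\<in>{K. compact K \<and> K \<subseteq> A}. emeasure M K))"

lemma radon_probD:
  assumes "radon_prob M"
  shows radon_prob_sets: "sets M = sets borel"
    and radon_prob_space: "space M = UNIV"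
    and radon_prob_UNIV: "emeasure M UNIV = 1"
    and radon_prob_le_1: "emeasure M A \<le> 1"
    and radon_prob_finite: "finite_measure M"
    and radon_prob_inner: "A \<in> sets borel \<Longrightarrow>
      emeasure M A = (SUP K\<in>{K. compact K \<and> K \<subseteq> A}. emeasure M K)"
proof -
  show s: "sets M = sets borel" and e: "emeasure M UNIV = 1"
    using assms unfolding radon_prob_def by auto
  show sp: "space M = UNIV" using sets_eq_imp_space_eq[OF s] by simp
  show "emeasure M A \<le> 1" using emeasure_space[of M A] e sp by simp
  show "finite_measure M" by (rule finite_measureI) (simp add: e sp)
  show "A \<in> sets borel \<Longrightarrow> emeasure M A = (SUP K\<in>{K. compact K \<and> K \<subseteq> A}. emeasure M K)"
    using assms unfolding radon_prob_def by auto
qed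

lemma borel_measurable_Pair_left: "Pair x \<in> borel_measurable borel"
  by (intro borel_measurable_continuous_onI continuous_intros)

lemma borel_measurable_Pair_right: "(\<lambda>x. (x, y)) \<in> borel_measurable borel"
  by (intro borel_measurable_continuous_onI continuous_intros)

lemma borel_measurable_fst: "fst \<in> borel_measurable (borel :: ('a::topological_space \<times> 'b::topological_space) measure)"
  by (intro borel_measurable_continuous_onI continuous_intros)

lemma borel_measurable_snd: "snd \<in> borel_measurable (borel :: ('a::topological_space \<times> 'b::topological_space) measure)"
  by (intro borel_measurable_continuous_onI continuous_intros)

lemma borel_measurable_swap:
  "prod.swap \<in> borel_measurable (borel :: ('a::topological_space \<times> 'b::topological_space) measure)"
  unfolding prod.swap_def by (intro borel_measurable_continuous_onI continuous_intros)

lemma borel_vimage: "f \<in> borel_measurable borel \<Longrightarrow> A \<in> sets borel \<Longrightarrow> f -` A \<in> sets borel"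
  using measurable_sets[of f borel borel A] by simp

lemma borel_Times:
  fixes A :: "'a::topological_space set" and B :: "'b::topological_space set"
  assumes "A \<in> sets borel" "B \<in> sets borel"
  shows "A \<times> B \<in> sets borel"
proof -
  have "A \<times> B = fst -` A \<inter> snd -` B" by auto
  with assms show ?thesis by (simp add: borel_vimage borel_measurable_fst borel_measurable_snd sets.Int)
qed

lemma sets_borel_sigma_sets: "sets (borel :: 'a::topological_space measure) = sigma_sets UNIV {S. open S}"
  by (simp add: borel_def)

text \<open>
The sections of an open set vary lower semicontinuously in measure: a compact subset of one section is, by
the tube lemma, a subset of all nearby sections, and inner regularity makes these compact sets exhaust the
measure. Borel sets are reached from the intersection-stable family of open sets by Dynkin's argument.
\<close>

lemma borel_measurable_section_measure:
  fixes M :: "'b::t2_space measure" and E :: "('a::topological_space \<times> 'b) set"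
  assumes M: "radon_prob M" and E: "E \<in> sets borel"
  shows "(\<lambda>x. emeasure M (Pair x -` E)) \<in> borel_measurable borel"
proof -
  note s[simp] = radon_prob_sets[OF M] and sp[simp] = radon_prob_space[OF M]
  interpret finite_measure M by (rule radon_prob_finite[OF M])
  have "Int_stable {S :: ('a \<times> 'b) set. open S}" by (auto simp: Int_stable_def)
  moreover have "{S :: ('a \<times> 'b) set. open S} \<subseteq> Pow UNIV" by auto
  moreover have "E \<in> sigma_sets UNIV {S. open S}" using E by (simp add: sets_borel_sigma_sets)
  ultimately show ?thesis
  proof (induction rule: sigma_sets_induct_disjoint)
    case (basic U)
    then have U: "open U" by simp
    show ?case
    proof (rule borel_measurableI_greater)
      fix c
      have "\<exists>V. open V \<and> x \<in> V \<and> V \<subseteq> {x. c < emeasure M (Pair x -` U)}"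
        if x: "c < emeasure M (Pair x -` U)" for x
      proof -
        have "Pair x -` U \<in> sets borel"
          using U by (intro borel_vimage borel_measurable_Pair_left) auto
        from x[unfolded radon_prob_inner[OF M this] less_SUP_iff]
        obtain K where K: "compact K" "K \<subseteq> Pair x -` U" "c < emeasure M K" by auto
        then have "{x} \<times> K \<subseteq> U" by auto
        from Elementary_Topology.tube_lemma[OF K(1) U this]
        obtain V where V: "x \<in> V" "open V" "V \<times> K \<subseteq> U" by auto
        have "c < emeasure M (Pair y -` U)" if "y \<in> V" for y
        proof -
          have "Pair y -` U \<in> sets M"
            using U by (auto intro!: borel_vimage borel_measurable_Pair_left)
          then have "emeasure M K \<le> emeasure M (Pair y -` U)"
            using V(3) that by (intro emeasure_mono) auto
          with K(3) show ?thesis by (rule less_le_trans)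
        qed
        with V show ?thesis by auto
      qed
      then have "open {x. c < emeasure M (Pair x -` U)}"
        by (subst open_subopen) auto
      then show "{x \<in> space borel. c < emeasure M (Pair x -` U)} \<in> sets borel" by auto
    qed
  next
    case empty
    then show ?case by simp
  next
    case (compl A)
    then have "Pair x -` A \<in> sets borel" for x
      by (intro borel_vimage borel_measurable_Pair_left) (simp add: sets_borel_sigma_sets)
    then have "emeasure M (Pair x -` (UNIV - A)) = emeasure M UNIV - emeasure M (Pair x -` A)" for x
      using emeasure_compl[of "Pair x -` A" M] by (simp add: vimage_Diff)
    with compl show ?case by simp
  next
    case (union A)
    then have s': "Pair x -` A i \<in> sets borel" for x i
      by (intro borel_vimage borel_measurable_Pair_left) (auto simp: sets_borel_sigma_sets)
    have "emeasure M (Pair x -` (\<Union>i. A i)) = (\<Sum>i. emeasure M (Pair x -` A i))" for x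
    proof -
      have "disjoint_family (\<lambda>i. Pair x -` A i)"
        using union(1) by (auto simp: disjoint_family_on_def)
      then show ?thesis using s' by (subst suminf_emeasure) (auto simp: vimage_UN)
    qed
    with union show ?case by simp
  qed
qed

text \<open>
The product measure, but defined on all Borel sets of the product space, which may form a strictly
larger \<open>\<sigma>\<close>-algebra than the product of the Borel \<open>\<sigma>\<close>-algebras.
\<close>

definition iterated :: "'a::t2_space measure \<Rightarrow> 'b::t2_space measure \<Rightarrow> ('a \<times> 'b) measure"
  where "iterated M N = measure_of UNIV (sets borel) (\<lambda>E. \<integral>\<^sup>+x. emeasure N (Pair x -` E) \<partial>M)"

lemma sets_iterated: "sets (iterated M N) = sets borel"
  unfolding iterated_def using sets.sigma_sets_eq[of "borel :: ('a \<times> 'b) measure"]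
  by (subst sets_measure_of) auto

lemma space_iterated: "space (iterated M N) = UNIV"
  by (simp add: iterated_def space_measure_of_conv)

lemma emeasure_iterated:
  fixes M :: "'a::t2_space measure" and N :: "'b::t2_space measure"
  assumes M: "radon_prob M" and N: "radon_prob N" and E: "E \<in> sets borel"
  shows "emeasure (iterated M N) E = (\<integral>\<^sup>+x. emeasure N (Pair x -` E) \<partial>M)"
proof (rule emeasure_measure_of[OF iterated_def])
  show "sets borel \<subseteq> Pow UNIV" by simp
  show "E \<in> sets (iterated M N)" using E by (simp add: sets_iterated)
  show "positive (sets (iterated M N)) (\<lambda>E. \<integral>\<^sup>+ x. emeasure N (Pair x -` E) \<partial>M)"
    by (simp add: positive_def)
  show "countably_additive (sets (iterated M N)) (\<lambda>E. \<integral>\<^sup>+ x. emeasure N (Pair x -` E) \<partial>M)"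
  proof (rule countably_additiveI)
    fix A :: "nat \<Rightarrow> ('a \<times> 'b) set"
    assume A: "range A \<subseteq> sets (iterated M N)" "disjoint_family A"
    then have A': "A i \<in> sets borel" for i by (auto simp: sets_iterated)
    then have s': "Pair x -` A i \<in> sets N" for x i
      by (auto intro!: borel_vimage borel_measurable_Pair_left simp: radon_prob_sets[OF N])
    have "emeasure N (Pair x -` (\<Union>i. A i)) = (\<Sum>i. emeasure N (Pair x -` A i))" for x
    proof -
      have "disjoint_family (\<lambda>i. Pair x -` A i)"
        using A(2) by (auto simp: disjoint_family_on_def)
      then show ?thesis using s' by (subst suminf_emeasure) (auto simp: vimage_UN)
    qed
    moreover have "(\<lambda>x. emeasure N (Pair x -` A i)) \<in> borel_measurable M" for i
      using borel_measurable_section_measure[OF N A'[of i]] measurable_cong_sets[OF radon_prob_sets[OF M] refl] by blast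
    ultimately show "(\<Sum>i. \<integral>\<^sup>+ x. emeasure N (Pair x -` A i) \<partial>M) = (\<integral>\<^sup>+ x. emeasure N (Pair x -` (\<Union>i. A i)) \<partial>M)"
      by (simp add: nn_integral_suminf)
  qed
qed

lemma emeasure_iterated_Times:
  fixes M :: "'a::t2_space measure" and N :: "'b::t2_space measure"
  assumes M: "radon_prob M" and N: "radon_prob N" and "A \<in> sets borel" "B \<in> sets borel"
  shows "emeasure (iterated M N) (A \<times> B) = emeasure M A * emeasure N B"
proof -
  have "emeasure (iterated M N) (A \<times> B) = (\<integral>\<^sup>+x. emeasure N B * indicator A x \<partial>M)"
    using assms by (subst emeasure_iterated) (auto intro!: nn_integral_cong borel_Times split: split_indicator)
  then show ?thesis
    using assms by (subst (asm) nn_integral_cmult_indicator) (auto simp: radon_prob_sets[OF M] mult.commute)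
qed

text \<open>
The two orders of integration agree on rectangles, so it suffices to exhaust an open set by finite unions of
rectangles inside it, up to a small error in the first iterated integral. On a set of points whose sections
all have measure between \<open>c\<close> and \<open>c + e\<close>, compactness provides such a union: each section contains a
compact set of measure above \<open>c\<close>, whose product with a neighbourhood still lies in the open set. Slicing
the first factor into countably many such layers costs \<open>e\<close> in total.
\<close>

lemma iterated_le_swapped_on_open:
  fixes M :: "'a::t2_space measure" and N :: "'b::t2_space measure"
  assumes M: "radon_prob M" and N: "radon_prob N" and U: "open U"
  shows "emeasure (iterated M N) U \<le> emeasure (iterated N M) (prod.swap -` U)"
proof -
  note [simp] = radon_prob_sets[OF M] radon_prob_sets[OF N] sets_iterated
    radon_prob_space[OF M] radon_prob_space[OF N]
  interpret M: finite_measure M by (rule radon_prob_finite[OF M])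
  interpret N: finite_measure N by (rule radon_prob_finite[OF N])
  define P where "P = iterated M N"
  define Q where "Q = distr (iterated N M) borel prod.swap"
  have [simp]: "sets P = sets borel" "sets Q = sets borel" by (simp_all add: P_def Q_def)
  have swm: "prod.swap \<in> measurable (iterated N M) borel"
    using borel_measurable_swap measurable_cong_sets[OF sets_iterated refl] by blast
  have QE: "emeasure Q E = emeasure (iterated N M) (prod.swap -` E)" if "E \<in> sets borel" for E
    unfolding Q_def using that by (simp add: emeasure_distr[OF swm] space_iterated)
  have QT: "emeasure Q (A \<times> B) = emeasure M A * emeasure N B"
    if "A \<in> sets borel" "B \<in> sets borel" for A B
  proof -
    have "prod.swap -` (A \<times> B) = B \<times> A" by auto
    then show ?thesis using that
      by (simp add: QE borel_Times emeasure_iterated_Times[OF N M] mult.commute)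
  qed
  have Ub: "U \<in> sets borel" using U by auto
  have Usec: "Pair x -` U \<in> sets borel" for x
    by (intro borel_vimage borel_measurable_Pair_left Ub)
  define \<phi> where "\<phi> x = emeasure N (Pair x -` U)" for x
  have \<phi>m[measurable]: "\<phi> \<in> borel_measurable borel"
    unfolding \<phi>_def by (rule borel_measurable_section_measure[OF N Ub])
  have slab: "U \<inter> A \<times> UNIV \<in> sets borel" if "A \<in> sets borel" for A
    using Ub that by (intro sets.Int borel_Times) auto
  have PA: "emeasure P (U \<inter> A \<times> UNIV) = (\<integral>\<^sup>+x. \<phi> x * indicator A x \<partial>M)" if "A \<in> sets borel" for A
    unfolding P_def \<phi>_def
    by (subst emeasure_iterated[OF M N slab[OF that]])
       (auto intro!: nn_integral_cong arg_cong[where f="emeasure N"] split: split_indicator)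
  \<comment> \<open>The inequality, with error \<open>e\<close>, for the part of \<open>U\<close> above \<open>A\<close>; it is additive in \<open>A\<close>.\<close>
  define good where "good e A \<longleftrightarrow>
    emeasure P (U \<inter> A \<times> UNIV) \<le> emeasure Q (U \<inter> A \<times> UNIV) + e * emeasure M A" for e A
  have good_rect: "good e A" if A: "A \<in> sets borel" "A \<subseteq> V" "V \<times> K \<subseteq> U" and K: "K \<in> sets borel"
    and le: "\<And>x. x \<in> A \<Longrightarrow> \<phi> x \<le> emeasure N K + e" for e A V K
  proof -
    have "emeasure P (U \<inter> A \<times> UNIV) \<le> (\<integral>\<^sup>+x. (emeasure N K + e) * indicator A x \<partial>M)"
      unfolding PA[OF A(1)] using le by (intro nn_integral_mono) (auto split: split_indicator)
    also have "\<dots> = emeasure Q (A \<times> K) + e * emeasure M A"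
      using A K by (subst nn_integral_cmult_indicator) (auto simp: QT algebra_simps)
    also have "emeasure Q (A \<times> K) \<le> emeasure Q (U \<inter> A \<times> UNIV)"
      using A slab by (intro emeasure_mono) auto
    finally show ?thesis unfolding good_def by (simp add: add_right_mono)
  qed
  have good_Un: "good e (A \<union> B)"
    if "good e A" "good e B" "A \<inter> B = {}" "A \<in> sets borel" "B \<in> sets borel" for e A B
  proof -
    have eq: "U \<inter> (A \<union> B) \<times> UNIV = (U \<inter> A \<times> UNIV) \<union> (U \<inter> B \<times> UNIV)" by auto
    have dis: "(U \<inter> A \<times> UNIV) \<inter> (U \<inter> B \<times> UNIV) = {}" using that(3) by auto
    have "emeasure P (U \<inter> (A \<union> B) \<times> UNIV) = emeasure P (U \<inter> A \<times> UNIV) + emeasure P (U \<inter> B \<times> UNIV)"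
      using that slab dis unfolding eq by (intro plus_emeasure[symmetric]) auto
    moreover have "emeasure Q (U \<inter> (A \<union> B) \<times> UNIV) = emeasure Q (U \<inter> A \<times> UNIV) + emeasure Q (U \<inter> B \<times> UNIV)"
      using that slab dis unfolding eq by (intro plus_emeasure[symmetric]) auto
    moreover have "emeasure M (A \<union> B) = emeasure M A + emeasure M B"
      using that by (intro plus_emeasure[symmetric]) auto
    ultimately show ?thesis
      using add_mono[OF that(1)[unfolded good_def] that(2)[unfolded good_def]]
      unfolding good_def by (simp add: algebra_simps)
  qed
  have good_compact: "good e A" if A: "compact A" and c: "\<And>x. x \<in> A \<Longrightarrow> c < \<phi> x \<and> \<phi> x \<le> c + e" for A c e
  proof -
    have "\<exists>V K. open V \<and> x \<in> V \<and> V \<times> K \<subseteq> U \<and> K \<in> sets borel \<and> c < emeasure N K" if "x \<in> A" for x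
    proof -
      from c[OF that] have "c < \<phi> x" ..
      from this[unfolded \<phi>_def radon_prob_inner[OF N Usec] less_SUP_iff]
      obtain K where K: "compact K" "K \<subseteq> Pair x -` U" "c < emeasure N K" by auto
      then have "{x} \<times> K \<subseteq> U" by auto
      from Elementary_Topology.tube_lemma[OF K(1) U this] K borel_compact[OF K(1)] show ?thesis by blast
    qed
    then obtain V K where V: "\<And>x. x \<in> A \<Longrightarrow> open (V x) \<and> x \<in> V x \<and> V x \<times> K x \<subseteq> U \<and> K x \<in> sets borel \<and> c < emeasure N (K x)"
      by metis
    then obtain F where F: "F \<subseteq> A" "finite F" "A \<subseteq> (\<Union>x\<in>F. V x)"
      using compactE_image[OF A, of A V] by (metis UN_iff subsetI)
    have "\<forall>B\<in>sets borel. B \<subseteq> A \<inter> (\<Union>x\<in>F. V x) \<longrightarrow> good e B"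
      using F(2,1)
    proof (induction F)
      case empty
      then show ?case by (auto simp: good_def)
    next
      case (insert x F)
      show ?case
      proof safe
        fix B assume B: "B \<in> sets borel" "B \<subseteq> A \<inter> (\<Union>x\<in>insert x F. V x)"
        have x: "open (V x)" "V x \<times> K x \<subseteq> U" "K x \<in> sets borel" "c < emeasure N (K x)"
          using V[of x] insert by auto
        have s: "B \<inter> V x \<in> sets borel" "B - V x \<in> sets borel" using B x by auto
        have "good e (B \<inter> V x)"
        proof (rule good_rect)
          show "B \<inter> V x \<subseteq> V x" by auto
          show "\<phi> y \<le> emeasure N (K x) + e" if "y \<in> B \<inter> V x" for y
          proof -
            have "\<phi> y \<le> c + e" using c[of y] that B by auto
            also have "\<dots> \<le> emeasure N (K x) + e" using x by (intro add_right_mono) auto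
            finally show ?thesis .
          qed
        qed (use x s in auto)
        moreover have "good e (B - V x)" using insert s(2) B(2) by auto
        ultimately have "good e ((B \<inter> V x) \<union> (B - V x))" using s by (intro good_Un) auto
        then show "good e B" by (simp add: Int_Diff_Un)
      qed
    qed
    with F A show ?thesis by (auto simp: borel_compact)
  qed
  have good_layer: "good e A" if A: "A \<in> sets borel" and c: "\<And>x. x \<in> A \<Longrightarrow> c < \<phi> x \<and> \<phi> x \<le> c + e" for A c e
    unfolding good_def
  proof (rule ennreal_le_epsilon)
    fix d :: real assume d: "0 < d"
    have "\<exists>K. compact K \<and> K \<subseteq> A \<and> emeasure M A \<le> emeasure M K + ennreal d"
    proof (cases "emeasure M A = 0")
      case True then show ?thesis by (intro exI[of _ "{}"]) auto
    next
      case False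
      then have "emeasure M A - ennreal d < emeasure M A"
        using d by (auto simp: M.emeasure_eq_measure ennreal_minus zero_less_measure_iff intro!: ennreal_lessI)
      also have "\<dots> = (SUP K\<in>{K. compact K \<and> K \<subseteq> A}. emeasure M K)"
        by (rule radon_prob_inner[OF M A])
      finally obtain K where "compact K" "K \<subseteq> A" "emeasure M A - ennreal d < emeasure M K"
        unfolding less_SUP_iff by auto
      moreover from this have "emeasure M A \<le> emeasure M K + ennreal d"
        using ennreal_minus_le_iff[of "emeasure M A" "ennreal d" "emeasure M K"] by (auto simp: add.commute)
      ultimately show ?thesis by blast
    qed
    then obtain K where K: "compact K" "K \<subseteq> A" "emeasure M A \<le> emeasure M K + ennreal d" by auto
    have Kb: "K \<in> sets borel" using K by (auto intro: borel_compact)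
    have "emeasure M A = emeasure M K + emeasure M (A - K)"
      using plus_emeasure[of K M "A - K"] Kb A K(2) by (auto simp: Un_absorb1)
    with K(3) have small: "emeasure M (A - K) \<le> ennreal d"
      using M.emeasure_finite[of K] by (simp add: ennreal_add_left_cancel_le)
    have "emeasure P (U \<inter> A \<times> UNIV) \<le> emeasure P (U \<inter> K \<times> UNIV \<union> (A - K) \<times> UNIV)"
      using A Kb by (intro emeasure_mono) (auto intro!: sets.Un slab borel_Times)
    also have "\<dots> \<le> emeasure P (U \<inter> K \<times> UNIV) + emeasure P ((A - K) \<times> UNIV)"
      using A Kb by (intro emeasure_subadditive) (auto intro!: slab borel_Times)
    also have "emeasure P (U \<inter> K \<times> UNIV) \<le> emeasure Q (U \<inter> K \<times> UNIV) + e * emeasure M K"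
      using good_compact[OF K(1), of c e] c K(2) by (auto simp: good_def)
    also have "emeasure P ((A - K) \<times> UNIV) \<le> ennreal d"
      using small A Kb by (simp add: P_def emeasure_iterated_Times[OF M N] radon_prob_UNIV[OF N])
    also have "emeasure Q (U \<inter> K \<times> UNIV) \<le> emeasure Q (U \<inter> A \<times> UNIV)"
      using K A by (intro emeasure_mono) (auto intro!: slab)
    also have "emeasure M K \<le> emeasure M A" using K A by (intro emeasure_mono) auto
    finally show "emeasure P (U \<inter> A \<times> UNIV) \<le> emeasure Q (U \<inter> A \<times> UNIV) + e * emeasure M A + ennreal d"
      by (simp add: add_right_mono mult_left_mono add_left_mono)
  qed
  have "emeasure P U \<le> emeasure Q U"
  proof (rule ennreal_le_epsilon)
    fix e :: real assume e: "0 < e"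
    define r where "r x = enn2real (\<phi> x)" for x
    have r: "\<phi> x = ennreal (r x)" "0 \<le> r x" for x
      using radon_prob_le_1[OF N, of "Pair x -` U"] by (auto simp: r_def \<phi>_def N.emeasure_eq_measure)
    have rm[measurable]: "r \<in> borel_measurable borel" unfolding r_def by measurable
    \<comment> \<open>The layer \<open>k = 0\<close> consists of the points with null section; the others are half-open strips of height \<open>e\<close>.\<close>
    define A where "A k = {x. (real k - 1) * e < r x \<and> r x \<le> real k * e}" for k
    have Ab[measurable]: "A k \<in> sets borel" for k
    proof -
      have "A k = {x \<in> space borel. (real k - 1) * e < r x \<and> r x \<le> real k * e}" by (simp add: A_def)
      also have "\<dots> \<in> sets borel" by measurable
      finally show ?thesis .
    qed
    have dis: "disjoint_family A"
    unfolding disjoint_family_on_def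
    proof (intro ballI impI)
      fix j k :: nat assume "j \<noteq> k"
      have "\<not> (x \<in> A i \<and> x \<in> A l)" if "i < l" for x i l
      proof
        assume "x \<in> A i \<and> x \<in> A l"
        then have "(real l - 1) * e < real i * e" by (auto simp: A_def)
        with e that show False by auto
      qed
      from this[of j k] this[of k j] \<open>j \<noteq> k\<close> show "A j \<inter> A k = {}" by (meson disjoint_iff nat_neq_iff)
    qed
    have cov: "(\<Union>k. A k) = UNIV"
    proof (intro set_eqI iffI UNIV_I)
      fix x
      have "x \<in> A (nat \<lceil>r x / e\<rceil>)"
      proof -
        have "real (nat \<lceil>r x / e\<rceil>) = of_int \<lceil>r x / e\<rceil>"
          using r(2)[of x] e by (simp add: order.trans[of _ 0])
        then have "real (nat \<lceil>r x / e\<rceil>) - 1 < r x / e" "r x / e \<le> real (nat \<lceil>r x / e\<rceil>)"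
          by linarith+
        with e show ?thesis unfolding A_def by (simp add: field_simps)
      qed
      then show "x \<in> (\<Union>k. A k)" by blast
    qed
    have good: "good (ennreal e) (A k)" for k
    proof (cases k)
      case 0
      have "\<phi> x = 0" if "x \<in> A k" for x using that r[of x] by (auto simp: A_def 0)
      then have "emeasure P (U \<inter> A k \<times> UNIV) = (\<integral>\<^sup>+x. 0 \<partial>M)"
        unfolding PA[OF Ab] by (intro nn_integral_cong) (auto split: split_indicator)
      then show ?thesis by (simp add: good_def)
    next
      case (Suc j)
      show ?thesis
      proof (rule good_layer[where c="ennreal (real j * e)"])
        fix x assume "x \<in> A k"
        then have "real j * e < r x" "r x \<le> real j * e + e" by (auto simp: A_def Suc algebra_simps)
        then show "ennreal (real j * e) < \<phi> x \<and> \<phi> x \<le> ennreal (real j * e) + ennreal e"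
          using e r(2)[of x] by (simp add: r(1) ennreal_less_iff flip: ennreal_plus)
      qed simp
    qed
    have Ueq: "U = (\<Union>k. U \<inter> A k \<times> UNIV)" using cov by auto
    have disU: "disjoint_family (\<lambda>k. U \<inter> A k \<times> UNIV)"
      using dis by (fastforce simp: disjoint_family_on_def)
    have "emeasure P U = (\<Sum>k. emeasure P (U \<inter> A k \<times> UNIV))"
      using disU Ab slab by (subst (1) Ueq, subst suminf_emeasure[symmetric]) auto
    also have "\<dots> \<le> (\<Sum>k. emeasure Q (U \<inter> A k \<times> UNIV) + ennreal e * emeasure M (A k))"
      using good by (intro suminf_le) (auto simp: good_def)
    also have "\<dots> = (\<Sum>k. emeasure Q (U \<inter> A k \<times> UNIV)) + ennreal e * (\<Sum>k. emeasure M (A k))"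
      by (subst suminf_add[symmetric]) auto
    also have "(\<Sum>k. emeasure Q (U \<inter> A k \<times> UNIV)) = emeasure Q U"
      using disU Ab slab by (subst (2) Ueq, subst suminf_emeasure) auto
    also have "(\<Sum>k. emeasure M (A k)) = 1"
      using dis Ab cov radon_prob_UNIV[OF M] by (subst suminf_emeasure) auto
    finally show "emeasure P U \<le> emeasure Q U + ennreal e" by simp
  qed
  then show ?thesis using QE[OF Ub] by (simp add: P_def)
qed

text \<open>
Two finite measures that agree on the open sets agree on all Borel sets; the inequality on open sets can be
applied in both orders.
\<close>

lemma iterated_swap:
  fixes M :: "'a::t2_space measure" and N :: "'b::t2_space measure"
  assumes M: "radon_prob M" and N: "radon_prob N"
  shows "iterated M N = distr (iterated N M) borel prod.swap"
proof -
  have swm: "prod.swap \<in> measurable (iterated N M) borel"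
    using borel_measurable_swap measurable_cong_sets[OF sets_iterated refl] by blast
  have "emeasure (iterated M N) U = emeasure (distr (iterated N M) borel prod.swap) U"
    if U: "open U" for U
  proof -
    have U': "open (prod.swap -` U)"
      unfolding prod.swap_def by (intro open_vimage U continuous_intros)
    have "emeasure (iterated N M) (prod.swap -` U) \<le> emeasure (iterated M N) U"
      using iterated_le_swapped_on_open[OF N M U'] by (simp add: vimage_comp)
    with iterated_le_swapped_on_open[OF M N U] U show ?thesis
      by (simp add: emeasure_distr[OF swm] space_iterated)
  qed
  then show ?thesis
    using emeasure_iterated_Times[OF M N, of UNIV UNIV] radon_prob_UNIV[OF M] radon_prob_UNIV[OF N]
    by (intro measure_eqI_generator_eq[where E = "{S. open S}" and \<Omega> = UNIV and A = "\<lambda>_. UNIV"])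
       (auto simp: Int_stable_def sets_iterated sets_borel_sigma_sets)
qed

lemma nn_integral_iterated:
  fixes M :: "'a::t2_space measure" and N :: "'b::t2_space measure"
  assumes M: "radon_prob M" and N: "radon_prob N" and F: "F \<in> borel_measurable borel"
  shows "(\<lambda>x. \<integral>\<^sup>+y. F (x, y) \<partial>N) \<in> borel_measurable borel \<and>
    (\<integral>\<^sup>+z. F z \<partial>iterated M N) = (\<integral>\<^sup>+x. \<integral>\<^sup>+y. F (x, y) \<partial>N \<partial>M)"
  using F
proof (induction rule: borel_measurable_induct)
  case (cong f g)
  then have "f = g" by auto
  with cong show ?case by simp
next
  case (set A)
  have "(\<integral>\<^sup>+y. indicator A (x, y) \<partial>N) = emeasure N (Pair x -` A)" for x
  proof -
    have "(\<integral>\<^sup>+y. indicator A (x, y) \<partial>N) = (\<integral>\<^sup>+y. indicator (Pair x -` A) y \<partial>N)"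
      by (intro nn_integral_cong) (auto split: split_indicator)
    also have "\<dots> = emeasure N (Pair x -` A)"
      using set by (intro nn_integral_indicator) (auto simp: radon_prob_sets[OF N] borel_vimage borel_measurable_Pair_left)
    finally show ?thesis .
  qed
  with set show ?case
    by (simp add: borel_measurable_section_measure[OF N] sets_iterated emeasure_iterated[OF M N])
next
  case (mult u c)
  have "(\<lambda>y. u (x, y)) \<in> borel_measurable N" for x
    using measurable_compose[OF borel_measurable_Pair_left mult(2)] measurable_cong_sets[OF radon_prob_sets[OF N] refl] by blast
  moreover have "(\<lambda>x. \<integral>\<^sup>+y. u (x, y) \<partial>N) \<in> borel_measurable M"
    using mult measurable_cong_sets[OF radon_prob_sets[OF M] refl] by blast
  moreover have "u \<in> borel_measurable (iterated M N)"
    using mult measurable_cong_sets[OF sets_iterated refl] by blast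
  ultimately show ?case using mult by (auto simp: nn_integral_cmult intro!: borel_measurable_times)
next
  case (add u v)
  have "(\<lambda>y. u (x, y)) \<in> borel_measurable N" "(\<lambda>y. v (x, y)) \<in> borel_measurable N" for x
    using measurable_compose[OF borel_measurable_Pair_left \<open>u \<in> borel_measurable borel\<close>]
      measurable_compose[OF borel_measurable_Pair_left \<open>v \<in> borel_measurable borel\<close>]
      measurable_cong_sets[OF radon_prob_sets[OF N] refl] by blast+
  moreover have "(\<lambda>x. \<integral>\<^sup>+y. u (x, y) \<partial>N) \<in> borel_measurable M" "(\<lambda>x. \<integral>\<^sup>+y. v (x, y) \<partial>N) \<in> borel_measurable M"
    using add measurable_cong_sets[OF radon_prob_sets[OF M] refl] by blast+
  moreover have "u \<in> borel_measurable (iterated M N)" "v \<in> borel_measurable (iterated M N)"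
    using add measurable_cong_sets[OF sets_iterated refl] by blast+
  ultimately show ?case using add by (auto simp: nn_integral_add intro!: borel_measurable_add)
next
  case (seq U)
  have 1: "(\<lambda>y. U i (x, y)) \<in> borel_measurable N" for i x
    using measurable_compose[OF borel_measurable_Pair_left seq(1)]
      measurable_cong_sets[OF radon_prob_sets[OF N] refl] by blast
  have 2: "(\<lambda>x. \<integral>\<^sup>+y. U i (x, y) \<partial>N) \<in> borel_measurable M" for i
    using seq measurable_cong_sets[OF radon_prob_sets[OF M] refl] by blast
  have 3: "U i \<in> borel_measurable (iterated M N)" for i
    using seq measurable_cong_sets[OF sets_iterated refl] by blast
  have 4: "(\<integral>\<^sup>+y. (SUP i. U i) (x, y) \<partial>N) = (SUP i. \<integral>\<^sup>+y. U i (x, y) \<partial>N)" for x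
    using 1 seq(3) by (subst nn_integral_monotone_convergence_SUP[symmetric])
      (auto simp: incseq_def le_fun_def image_comp intro!: nn_integral_cong)
  have inc: "incseq (\<lambda>i x. \<integral>\<^sup>+y. U i (x, y) \<partial>N)"
    using seq(3) by (auto simp: incseq_def le_fun_def intro!: nn_integral_mono)
  have "(\<integral>\<^sup>+z. (SUP i. U i) z \<partial>iterated M N) = (SUP i. \<integral>\<^sup>+z. U i z \<partial>iterated M N)"
    using 3 seq(3) by (subst nn_integral_monotone_convergence_SUP[symmetric]) (auto simp: image_comp intro!: nn_integral_cong)
  also have "\<dots> = (SUP i. \<integral>\<^sup>+x. \<integral>\<^sup>+y. U i (x, y) \<partial>N \<partial>M)" using seq by simp
  also have "\<dots> = (\<integral>\<^sup>+x. (SUP i. \<integral>\<^sup>+y. U i (x, y) \<partial>N) \<partial>M)"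
    using 2 inc by (subst nn_integral_monotone_convergence_SUP) auto
  finally show ?case using seq unfolding 4 by (auto intro!: borel_measurable_SUP)
qed

theorem fubini_radon:
  fixes M :: "'a::t2_space measure" and N :: "'b::t2_space measure"
  assumes M: "radon_prob M" and N: "radon_prob N" and F: "F \<in> borel_measurable borel"
  shows "(\<integral>\<^sup>+x. \<integral>\<^sup>+y. F (x, y) \<partial>N \<partial>M) = (\<integral>\<^sup>+y. \<integral>\<^sup>+x. F (x, y) \<partial>M \<partial>N)"
proof -
  have swm: "prod.swap \<in> measurable (iterated N M) borel"
    using borel_measurable_swap measurable_cong_sets[OF sets_iterated refl] by blast
  have "(\<integral>\<^sup>+x. \<integral>\<^sup>+y. F (x, y) \<partial>N \<partial>M) = (\<integral>\<^sup>+z. F z \<partial>iterated M N)"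
    using nn_integral_iterated[OF M N F] by simp
  also have "\<dots> = (\<integral>\<^sup>+z. F (prod.swap z) \<partial>iterated N M)"
    unfolding iterated_swap[OF M N] using F by (simp add: nn_integral_distr[OF swm])
  also have "\<dots> = (\<integral>\<^sup>+y. \<integral>\<^sup>+x. F (x, y) \<partial>M \<partial>N)"
    using nn_integral_iterated[OF N M measurable_compose[OF borel_measurable_swap F]] by simp
  finally show ?thesis .
qed

section \<open>Densities of complex measures\<close>

definition sigma_additive :: "'a measure \<Rightarrow> ('a set \<Rightarrow> 'b::real_normed_vector) \<Rightarrow> bool"
  where "sigma_additive M \<mu> \<longleftrightarrow>
    (\<forall>A :: nat \<Rightarrow> 'a set. range A \<subseteq> sets M \<longrightarrow> disjoint_family A \<longrightarrow> (\<lambda>i. \<mu> (A i)) sums \<mu> (\<Union>i. A i))"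

lemma sigma_additive_sums:
  "sigma_additive M \<mu> \<Longrightarrow> (\<And>i::nat. A i \<in> sets M) \<Longrightarrow> disjoint_family A \<Longrightarrow> (\<lambda>i. \<mu> (A i)) sums \<mu> (\<Union>i. A i)"
  by (auto simp: sigma_additive_def)

lemma sigma_additive_empty:
  assumes "sigma_additive M \<mu>" shows "\<mu> {} = 0"
proof -
  have "(\<lambda>i::nat. \<mu> {}) sums \<mu> (\<Union>i::nat. {})"
    by (rule sigma_additive_sums[OF assms]) (auto simp: disjoint_family_on_def)
  then have "(\<lambda>i::nat. \<mu> {}) \<longlonglongrightarrow> 0" by (intro summable_LIMSEQ_zero) (rule sums_summable)
  then show ?thesis by (simp add: LIMSEQ_const_iff)
qed

lemma sigma_additive_Un:
  assumes \<mu>: "sigma_additive M \<mu>" and "A \<in> sets M" "B \<in> sets M" "A \<inter> B = {}"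
  shows "\<mu> (A \<union> B) = \<mu> A + \<mu> B"
proof -
  have "(\<lambda>i. \<mu> (binaryset A B i)) sums \<mu> (\<Union>i. binaryset A B i)"
    using assms by (intro sigma_additive_sums[OF \<mu>]) (auto simp: disjoint_family_on_def binaryset_def)
  moreover have "(\<lambda>i. \<mu> (binaryset A B i)) sums (\<mu> A + \<mu> B)"
    by (rule binaryset_sums) (rule sigma_additive_empty[OF \<mu>])
  ultimately show ?thesis by (metis UN_binaryset_eq sums_unique2)
qed

lemma sigma_additive_Diff:
  assumes \<mu>: "sigma_additive M \<mu>" and "A \<in> sets M" "B \<in> sets M" "B \<subseteq> A"
  shows "\<mu> (A - B) = \<mu> A - \<mu> B"
  using sigma_additive_Un[OF \<mu>, of B "A - B"] assms by (auto simp: Un_absorb1)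

text \<open>
If the values were unbounded, some subset of the whole space would have a value so large that both it and
its complement have values of norm at least 1, and on one of the two the values are still unbounded.
Repeating this inside that part produces a disjoint sequence of sets with values bounded away from 0,
which contradicts convergence of the series.
\<close>

lemma sigma_additive_bounded:
  assumes \<mu>: "sigma_additive M \<mu>"
  obtains C where "0 \<le> C" "\<And>A. A \<in> sets M \<Longrightarrow> norm (\<mu> A) \<le> C"
proof -
  define unb where "unb E \<longleftrightarrow> (\<forall>C. \<exists>B\<in>sets M. B \<subseteq> E \<and> norm (\<mu> B) > C)" for E
  have nunb: "\<not> unb E \<longleftrightarrow> (\<exists>C. \<forall>B\<in>sets M. B \<subseteq> E \<longrightarrow> norm (\<mu> B) \<le> C)" for E
    by (simp add: unb_def not_less)
  have step: "\<exists>F. F \<in> sets M \<and> unb F \<and> F \<subseteq> E \<and> 1 \<le> norm (\<mu> (E - F))" if E: "E \<in> sets M" "unb E" for E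
  proof -
    obtain B where B: "B \<in> sets M" "B \<subseteq> E" "norm (\<mu> B) > norm (\<mu> E) + 1"
      using spec[OF E(2)[unfolded unb_def], of "norm (\<mu> E) + 1"] by blast
    have "E - (E - B) = B" using B(2) by blast
    then have diff: "\<mu> (E - B) = \<mu> E - \<mu> B" "\<mu> (E - (E - B)) = \<mu> B"
      using sigma_additive_Diff[OF \<mu> E(1) B(1,2)] by simp_all
    have n: "1 \<le> norm (\<mu> (E - B))" "1 \<le> norm (\<mu> (E - (E - B)))"
      using B(3) norm_triangle_ineq2[of "\<mu> B" "\<mu> E"] norm_ge_zero[of "\<mu> E"] norm_minus_commute[of "\<mu> B" "\<mu> E"]
      unfolding diff by linarith+
    have "unb B \<or> unb (E - B)"
    proof (rule ccontr)
      assume "\<not> ?thesis"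
      then have nb: "\<not> unb B" "\<not> unb (E - B)" by simp_all
      obtain C where C: "\<forall>A\<in>sets M. A \<subseteq> B \<longrightarrow> norm (\<mu> A) \<le> C"
        using nunb[THEN iffD1, OF nb(1)] ..
      obtain D where D: "\<forall>A\<in>sets M. A \<subseteq> E - B \<longrightarrow> norm (\<mu> A) \<le> D"
        using nunb[THEN iffD1, OF nb(2)] ..
      have bnd: "norm (\<mu> A) \<le> C + D" if A: "A \<in> sets M" "A \<subseteq> E" for A
      proof -
        have sA: "A \<inter> B \<in> sets M" "A - B \<in> sets M" using A B by simp_all
        have "\<mu> A = \<mu> (A \<inter> B \<union> (A - B))" by (simp add: Int_Diff_Un)
        also have "\<dots> = \<mu> (A \<inter> B) + \<mu> (A - B)"
          by (rule sigma_additive_Un[OF \<mu> sA]) blast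
        finally show ?thesis
          using norm_triangle_mono[OF C[rule_format, OF sA(1)] D[rule_format, OF sA(2)]] A(2)
          by (simp add: Diff_mono)
      qed
      have "\<not> unb E"
        unfolding nunb by (intro exI[of _ "C + D"] ballI impI) (rule bnd)
      with E(2) show False by simp
    qed
    then show ?thesis
    proof
      assume "unb B"
      with B n(1) show ?thesis by blast
    next
      assume "unb (E - B)"
      with B E n(2) show ?thesis by (intro exI[of _ "E - B"]) simp
    qed
  qed
  have "\<not> unb (space M)"
  proof
    assume unb_top: "unb (space M)"
    have "\<exists>E. \<forall>n::nat. (E n \<in> sets M \<and> unb (E n)) \<and>
        (E (Suc n) \<subseteq> E n \<and> 1 \<le> norm (\<mu> (E n - E (Suc n))))"
    proof (rule dependent_nat_choice[where P="\<lambda>_ E. E \<in> sets M \<and> unb E"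
        and Q="\<lambda>_ E F. F \<subseteq> E \<and> 1 \<le> norm (\<mu> (E - F))"])
      show "\<exists>E. E \<in> sets M \<and> unb E" using unb_top by blast
      show "\<exists>F. (F \<in> sets M \<and> unb F) \<and> F \<subseteq> E \<and> 1 \<le> norm (\<mu> (E - F))"
        if "E \<in> sets M \<and> unb E" for E using step[of E] that by blast
    qed
    then obtain E where E: "\<And>n::nat. (E n \<in> sets M \<and> unb (E n)) \<and>
        (E (Suc n) \<subseteq> E n \<and> 1 \<le> norm (\<mu> (E n - E (Suc n))))"
      by blast
    have Es: "E n \<in> sets M" and Esub: "E (Suc n) \<subseteq> E n" and Ege: "1 \<le> norm (\<mu> (E n - E (Suc n)))" for n
      using E[of n] by simp_all
    have dec: "E j \<subseteq> E i" if "i \<le> j" for i j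
      using lift_Suc_antimono_le[of E, OF Esub that] .
    have "disjoint_family (\<lambda>n. E n - E (Suc n))"
      unfolding disjoint_family_on_def
    proof (intro ballI impI)
      fix i j :: nat assume "i \<noteq> j"
      then show "(E i - E (Suc i)) \<inter> (E j - E (Suc j)) = {}"
        using dec[of "Suc i" j] dec[of "Suc j" i] by (cases "i < j") auto
    qed
    then have "(\<lambda>n. \<mu> (E n - E (Suc n))) sums \<mu> (\<Union>n. E n - E (Suc n))"
      using Es by (intro sigma_additive_sums[OF \<mu>]) simp_all
    then have "(\<lambda>n. \<mu> (E n - E (Suc n))) \<longlonglongrightarrow> 0" by (intro summable_LIMSEQ_zero) (rule sums_summable)
    then have "\<forall>\<^sub>F n in sequentially. norm (\<mu> (E n - E (Suc n))) < 1"
      by (auto simp: tendsto_iff dist_norm)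
    then obtain n where "norm (\<mu> (E n - E (Suc n))) < 1" by (auto simp: eventually_sequentially)
    with Ege[of n] show False by simp
  qed
  then obtain C where C: "\<forall>A\<in>sets M. A \<subseteq> space M \<longrightarrow> norm (\<mu> A) \<le> C"
    using nunb[THEN iffD1] by blast
  have "norm (\<mu> A) \<le> max 0 C" if "A \<in> sets M" for A
    using C[rule_format, OF that sets.sets_into_space[OF that]] by simp
  then show ?thesis by (intro that[of "max 0 C"]) simp_all
qed

text \<open>
The positive part in the Jordan decomposition of a signed measure.
\<close>

definition upper_variation :: "'a measure \<Rightarrow> ('a set \<Rightarrow> real) \<Rightarrow> 'a measure"
  where "upper_variation M \<mu> = measure_of (space M) (sets M) (\<lambda>A. SUP B\<in>{B\<in>sets M. B \<subseteq> A}. ennreal (\<mu> B))"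

lemma sets_upper_variation: "sets (upper_variation M \<mu>) = sets M"
  by (simp add: upper_variation_def sets.space_closed)

lemma space_upper_variation: "space (upper_variation M \<mu>) = space M"
  by (simp add: upper_variation_def space_measure_of_conv)

lemma ennreal_sum_le_sum_ennreal: "ennreal (sum f I) \<le> (\<Sum>i\<in>I. ennreal (f i))"
proof (induction I rule: infinite_finite_induct)
  case (insert i I)
  have "ennreal (f i + sum f I) \<le> ennreal (max 0 (f i) + max 0 (sum f I))" by (intro ennreal_leI) auto
  also have "\<dots> = ennreal (f i) + ennreal (sum f I)" by (subst ennreal_plus) (auto simp: max_def ennreal_neg)
  also have "\<dots> \<le> ennreal (f i) + (\<Sum>i\<in>I. ennreal (f i))" using insert by (intro add_left_mono)
  finally show ?case using insert by simp
qed auto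

text \<open>
Superadditivity holds because a subset with negative value can be replaced by the empty set, countable
subadditivity because the value of a set is the sum of the values of its pieces.
\<close>

lemma emeasure_upper_variation:
  assumes \<mu>: "sigma_additive M \<mu>" and E: "E \<in> sets M"
  shows "emeasure (upper_variation M \<mu>) E = (SUP B\<in>{B\<in>sets M. B \<subseteq> E}. ennreal (\<mu> B))"
proof (rule emeasure_measure_of[OF upper_variation_def])
  note [simp] = sigma_additive_empty[OF \<mu>] sets_upper_variation
  define P where "P A = (SUP B\<in>{B\<in>sets M. B \<subseteq> A}. ennreal (\<mu> B))" for A
  have up: "ennreal (\<mu> B) \<le> P A" if "B \<in> sets M" "B \<subseteq> A" for A B
    unfolding P_def using that by (intro SUP_upper) auto
  have mono: "P A \<le> P B" if "A \<subseteq> B" for A B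
    unfolding P_def using that by (intro SUP_subset_mono) auto
  have P0: "P {} = 0" by (auto simp: P_def bot_ennreal image_constant_conv)
  have super: "P A + P B \<le> P (A \<union> B)" if AB: "A \<in> sets M" "B \<in> sets M" "A \<inter> B = {}" for A B
  proof -
    have 1: "ennreal (\<mu> S) + ennreal (\<mu> T) \<le> P (A \<union> B)"
      if S: "S \<in> sets M" "S \<subseteq> A" and T: "T \<in> sets M" "T \<subseteq> B" for S T
    proof -
      define S' where "S' = (if 0 \<le> \<mu> S then S else {})"
      define T' where "T' = (if 0 \<le> \<mu> T then T else {})"
      have "S' \<in> sets M" "T' \<in> sets M" "S' \<inter> T' = {}" "S' \<union> T' \<subseteq> A \<union> B" "0 \<le> \<mu> S'" "0 \<le> \<mu> T'"
        using S T AB by (auto simp: S'_def T'_def)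
      moreover have "ennreal (\<mu> S) = ennreal (\<mu> S')" "ennreal (\<mu> T) = ennreal (\<mu> T')"
        by (auto simp: S'_def T'_def ennreal_neg)
      ultimately show ?thesis
        using up[of "S' \<union> T'" "A \<union> B"] sigma_additive_Un[OF \<mu>, of S' T']
        by (simp add: ennreal_plus)
    qed
    have ne: "{S\<in>sets M. S \<subseteq> X} \<noteq> {}" for X by blast
    have 2: "ennreal (\<mu> S) + P B \<le> P (A \<union> B)" if S: "S \<in> sets M" "S \<subseteq> A" for S
      unfolding P_def[of B] ennreal_SUP_add_right[OF ne] by (rule SUP_least) (use 1[OF S] in blast)
    show ?thesis
      unfolding P_def[of A] ennreal_SUP_add_left[OF ne, symmetric] by (rule SUP_least) (use 2 in blast)
  qed
  show "sets M \<subseteq> Pow (space M)" by (rule sets.space_closed)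
  show "E \<in> sets (upper_variation M \<mu>)" using E by simp
  show "positive (sets (upper_variation M \<mu>)) (\<lambda>A. SUP B\<in>{B \<in> sets M. B \<subseteq> A}. ennreal (\<mu> B))"
    using P0 by (simp add: positive_def P_def)
  show "countably_additive (sets (upper_variation M \<mu>)) (\<lambda>A. SUP B\<in>{B \<in> sets M. B \<subseteq> A}. ennreal (\<mu> B))"
    unfolding P_def[symmetric]
  proof (rule countably_additiveI)
    fix A :: "nat \<Rightarrow> 'a set"
    assume A: "range A \<subseteq> sets (upper_variation M \<mu>)" "disjoint_family A"
    then have s: "A i \<in> sets M" for i by auto
    have fin: "(\<Sum>i<n. P (A i)) \<le> P (\<Union>i<n. A i)" for n
    proof (induction n)
      case (Suc n)
      have "(\<Sum>i<Suc n. P (A i)) \<le> P (\<Union>i<n. A i) + P (A n)" using Suc by (simp add: add_right_mono)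
      also have "\<dots> \<le> P ((\<Union>i<n. A i) \<union> A n)"
      proof (rule super)
        show "(\<Union>i<n. A i) \<inter> A n = {}"
        proof -
          have "A i \<inter> A n = {}" if "i < n" for i
            using that by (intro disjoint_family_onD[OF A(2)]) auto
          then show ?thesis by blast
        qed
      qed (use s in auto)
      finally show ?case by (simp add: lessThan_Suc Un_commute)
    qed (simp add: P0)
    show "(\<Sum>i. P (A i)) = P (\<Union>i. A i)"
    proof (rule antisym)
      show "(\<Sum>i. P (A i)) \<le> P (\<Union>i. A i)"
        unfolding suminf_eq_SUP by (intro SUP_least order_trans[OF fin] mono) auto
      show "P (\<Union>i. A i) \<le> (\<Sum>i. P (A i))"
        unfolding P_def[of "\<Union>i. A i"]
      proof (rule SUP_least, safe)
        fix B assume B: "B \<in> sets M" "B \<subseteq> (\<Union>i. A i)"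
        have "(\<lambda>i. \<mu> (B \<inter> A i)) sums \<mu> (\<Union>i. B \<inter> A i)"
          using s B(1) by (intro sigma_additive_sums[OF \<mu>] disjoint_family_subset[OF A(2)]) auto
        moreover have "(\<Union>i. B \<inter> A i) = B" using B by auto
        ultimately have "(\<lambda>n. ennreal (\<Sum>i<n. \<mu> (B \<inter> A i))) \<longlonglongrightarrow> ennreal (\<mu> B)"
          by (intro tendsto_ennrealI) (simp add: sums_def)
        moreover have "ennreal (\<Sum>i<n. \<mu> (B \<inter> A i)) \<le> (\<Sum>i. P (A i))" for n
        proof -
          have "ennreal (\<Sum>i<n. \<mu> (B \<inter> A i)) \<le> (\<Sum>i<n. ennreal (\<mu> (B \<inter> A i)))" by (rule ennreal_sum_le_sum_ennreal)
          also have "\<dots> \<le> (\<Sum>i<n. P (A i))" using s B by (intro sum_mono up) auto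
          also have "\<dots> \<le> (\<Sum>i. P (A i))" by (intro sum_le_suminf) auto
          finally show ?thesis .
        qed
        ultimately show "ennreal (\<mu> B) \<le> (\<Sum>i. P (A i))"
          by (intro LIMSEQ_le_const2) auto
      qed
    qed
  qed
qed

lemma real_density_of_measure:
  assumes "finite_measure M" "finite_measure N" and s: "sets N = sets M" and ac: "absolutely_continuous M N"
  obtains h :: "'a \<Rightarrow> real" where "integrable M h" "\<And>A. A \<in> sets M \<Longrightarrow> measure N A = (LINT t:A|M. h t)"
proof -
  interpret M: finite_measure M by fact
  interpret N: finite_measure N by fact
  obtain f where f[measurable]: "f \<in> borel_measurable M" and fN: "density M f = N"
    using M.Radon_Nikodym_finite_measure[OF assms(2) s ac] by blast
  have NA: "emeasure N A = (\<integral>\<^sup>+x. f x * indicator A x \<partial>M)" if "A \<in> sets M" for A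
    using that unfolding fN[symmetric] by (simp add: emeasure_density)
  have tot: "(\<integral>\<^sup>+x. f x \<partial>M) = emeasure N (space M)"
    using NA[of "space M"] by (simp cong: nn_integral_cong)
  then have "AE x in M. f x \<noteq> \<infinity>"
    using N.emeasure_finite[of "space M"] by (intro nn_integral_PInf_AE) auto
  then have fe: "AE x in M. ennreal (enn2real (f x)) = f x"
    by eventually_elim (simp add: less_top)
  show ?thesis
  proof
    show "integrable M (\<lambda>x. enn2real (f x))"
    proof (rule integrableI_bounded)
      have "(\<integral>\<^sup>+x. ennreal (norm (enn2real (f x))) \<partial>M) = (\<integral>\<^sup>+x. f x \<partial>M)"
        using fe by (intro nn_integral_cong_AE) auto
      then show "(\<integral>\<^sup>+x. ennreal (norm (enn2real (f x))) \<partial>M) < \<infinity>"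
        by (simp add: tot N.emeasure_finite flip: less_top)
    qed simp
    fix A assume A[measurable]: "A \<in> sets M"
    have "(LINT t:A|M. enn2real (f t)) = enn2real (\<integral>\<^sup>+x. ennreal (indicator A x * enn2real (f x)) \<partial>M)"
      unfolding set_lebesgue_integral_def by (subst integral_eq_nn_integral) auto
    also have "(\<integral>\<^sup>+x. ennreal (indicator A x * enn2real (f x)) \<partial>M) = (\<integral>\<^sup>+x. f x * indicator A x \<partial>M)"
      using fe by (intro nn_integral_cong_AE) (auto split: split_indicator)
    finally show "measure N A = (LINT t:A|M. enn2real (f t))"
      by (simp add: NA[OF A] measure_def)
  qed
qed

text \<open>
The Radon-Nikodym theorem is applied to the two parts of the Jordan decomposition.
\<close>

lemma signed_density:
  fixes \<mu> :: "'a set \<Rightarrow> real"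
  assumes M: "finite_measure M" and \<mu>: "sigma_additive M \<mu>"
    and ac: "\<And>A. A \<in> sets M \<Longrightarrow> emeasure M A = 0 \<Longrightarrow> \<mu> A = 0"
  obtains h :: "'a \<Rightarrow> real" where "integrable M h" "\<And>A. A \<in> sets M \<Longrightarrow> \<mu> A = (LINT t:A|M. h t)"
proof -
  obtain C where "0 \<le> C" and "\<And>A. A \<in> sets M \<Longrightarrow> norm (\<mu> A) \<le> C"
    by (rule sigma_additive_bounded[OF \<mu>]) (rule that)
  then have C: "\<And>A. A \<in> sets M \<Longrightarrow> \<bar>\<mu> A\<bar> \<le> C" by simp
  have \<mu>': "sigma_additive M (\<lambda>A. - \<mu> A)"
    using \<mu> by (auto simp: sigma_additive_def intro: sums_minus)
  have half: "finite_measure (upper_variation M \<nu>) \<and> absolutely_continuous M (upper_variation M \<nu>)"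
    if \<nu>: "sigma_additive M \<nu>" and le: "\<And>A. A \<in> sets M \<Longrightarrow> \<bar>\<nu> A\<bar> \<le> C"
      and ac: "\<And>A. A \<in> sets M \<Longrightarrow> emeasure M A = 0 \<Longrightarrow> \<nu> A = 0" for \<nu> :: "'a set \<Rightarrow> real"
  proof
    have "emeasure (upper_variation M \<nu>) (space M) \<le> ennreal C"
      unfolding emeasure_upper_variation[OF \<nu> sets.top]
    proof (rule SUP_least)
      fix B assume "B \<in> {B \<in> sets M. B \<subseteq> space M}"
      then have "\<bar>\<nu> B\<bar> \<le> C" using le by simp
      then show "ennreal (\<nu> B) \<le> ennreal C" by (intro ennreal_leI) simp
    qed
    also have "\<dots> < top" by simp
    finally show "finite_measure (upper_variation M \<nu>)"
      by (intro finite_measureI) (auto simp: space_upper_variation less_top)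
    have "emeasure (upper_variation M \<nu>) A = 0" if A: "A \<in> sets M" "emeasure M A = 0" for A
    proof -
      have "\<nu> B = 0" if "B \<in> sets M" "B \<subseteq> A" for B
        using that A emeasure_mono[of B A M] by (intro ac) auto
      then have "emeasure (upper_variation M \<nu>) A \<le> 0"
        unfolding emeasure_upper_variation[OF \<nu> A(1)] by (intro SUP_least) auto
      then show ?thesis by simp
    qed
    then show "absolutely_continuous M (upper_variation M \<nu>)"
      by (auto simp: absolutely_continuous_def null_sets_def sets_upper_variation)
  qed
  define N1 where "N1 = upper_variation M \<mu>"
  define N2 where "N2 = upper_variation M (\<lambda>A. - \<mu> A)"
  have "finite_measure N1 \<and> absolutely_continuous M N1"
    unfolding N1_def by (rule half) (simp_all add: \<mu> C ac)
  then have N1: "finite_measure N1" "absolutely_continuous M N1" by simp_all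
  have "finite_measure N2 \<and> absolutely_continuous M N2"
    unfolding N2_def by (rule half) (simp_all add: \<mu>' C ac)
  then have N2: "finite_measure N2" "absolutely_continuous M N2" by simp_all
  \<comment> \<open>Applied to \<open>\<mu>\<close> and \<open>- \<mu>\<close>, this says that \<open>\<mu>\<close> is the difference of its two variations: for \<open>B \<subseteq> A\<close> the value on \<open>B\<close> is that on \<open>A\<close> minus that on \<open>A - B\<close>.\<close>
  have jordan_le: "measure (upper_variation M \<nu>) A \<le> measure (upper_variation M (\<lambda>A. - \<nu> A)) A + \<nu> A"
    if \<nu>: "sigma_additive M \<nu>" "sigma_additive M (\<lambda>A. - \<nu> A)" and A: "A \<in> sets M"
      and fin: "finite_measure (upper_variation M (\<lambda>A. - \<nu> A))" for \<nu> :: "'a set \<Rightarrow> real" and A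
  proof -
    interpret N: finite_measure "upper_variation M (\<lambda>A. - \<nu> A)" by (rule fin)
    define q where "q = measure (upper_variation M (\<lambda>A. - \<nu> A)) A"
    have q: "- \<nu> B \<le> q" if "B \<in> sets M" "B \<subseteq> A" for B
    proof -
      have "ennreal (- \<nu> B) \<le> emeasure (upper_variation M (\<lambda>A. - \<nu> A)) A"
        unfolding emeasure_upper_variation[OF \<nu>(2) A]
        by (rule SUP_upper2[of B]) (simp_all add: that)
      then have "ennreal (- \<nu> B) \<le> ennreal q" by (simp only: q_def N.emeasure_eq_measure)
      moreover have "0 \<le> q" by (simp only: q_def measure_nonneg)
      ultimately show ?thesis by (simp only: ennreal_le_iff)
    qed
    have "\<nu> B \<le> q + \<nu> A" if B: "B \<in> sets M" "B \<subseteq> A" for B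
    proof -
      have "- \<nu> (A - B) \<le> q" using A B by (intro q) auto
      then show ?thesis unfolding sigma_additive_Diff[OF \<nu>(1) A B] by linarith
    qed
    then have "emeasure (upper_variation M \<nu>) A \<le> ennreal (q + \<nu> A)"
      unfolding emeasure_upper_variation[OF \<nu>(1) A] by (intro SUP_least ennreal_leI) simp
    moreover have "0 \<le> q + \<nu> A" using q[OF A order_refl] by linarith
    ultimately have "measure (upper_variation M \<nu>) A \<le> q + \<nu> A"
      by (simp only: measure_def enn2real_leI)
    then show ?thesis by (simp only: q_def)
  qed
  have \<mu>eq: "\<mu> A = measure N1 A - measure N2 A" if A: "A \<in> sets M" for A
  proof -
    have "measure N1 A \<le> measure N2 A + \<mu> A"
      using jordan_le[OF \<mu> \<mu>' A] N2(1) by (simp add: N1_def N2_def)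
    moreover have "measure N2 A \<le> measure N1 A - \<mu> A"
      using jordan_le[of "\<lambda>A. - \<mu> A", unfolded minus_minus, OF \<mu>' \<mu> A] N1(1) by (simp add: N1_def N2_def)
    ultimately show ?thesis by linarith
  qed
  have sN: "sets N1 = sets M" "sets N2 = sets M" by (simp_all add: N1_def N2_def sets_upper_variation)
  obtain h1 where h1: "integrable M h1" "\<And>A. A \<in> sets M \<Longrightarrow> measure N1 A = (LINT t:A|M. h1 t)"
    by (rule real_density_of_measure[OF M N1(1) sN(1) N1(2)]) (rule that)
  obtain h2 where h2: "integrable M h2" "\<And>A. A \<in> sets M \<Longrightarrow> measure N2 A = (LINT t:A|M. h2 t)"
    by (rule real_density_of_measure[OF M N2(1) sN(2) N2(2)]) (rule that)
  show ?thesis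
  proof
    show "integrable M (\<lambda>x. h1 x - h2 x)" using h1 h2 by auto
    fix A assume A: "A \<in> sets M"
    have "set_integrable M A h1" "set_integrable M A h2"
      unfolding set_integrable_def by (intro integrable_mult_indicator A h1(1) h2(1))+
    then show "\<mu> A = (LINT t:A|M. h1 t - h2 t)"
      using \<mu>eq[OF A] h1(2)[OF A] h2(2)[OF A] by (simp add: set_integral_diff)
  qed
qed

lemma complex_density:
  fixes \<mu> :: "'a set \<Rightarrow> complex"
  assumes M: "finite_measure M" and \<mu>: "sigma_additive M \<mu>"
    and ac: "\<And>A. A \<in> sets M \<Longrightarrow> emeasure M A = 0 \<Longrightarrow> \<mu> A = 0"
  obtains h :: "'a \<Rightarrow> complex" where "integrable M h" "\<And>A. A \<in> sets M \<Longrightarrow> \<mu> A = (LINT t:A|M. h t)"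
proof -
  have "sigma_additive M (\<lambda>A. Re (\<mu> A))" "sigma_additive M (\<lambda>A. Im (\<mu> A))"
    using \<mu> by (auto simp: sigma_additive_def intro: sums_Re sums_Im)
  then obtain h1 h2 where h1: "integrable M h1" "\<And>A. A \<in> sets M \<Longrightarrow> Re (\<mu> A) = (LINT t:A|M. h1 t)"
    and h2: "integrable M h2" "\<And>A. A \<in> sets M \<Longrightarrow> Im (\<mu> A) = (LINT t:A|M. h2 t)"
    using signed_density[OF M, of "\<lambda>A. Re (\<mu> A)"] signed_density[OF M, of "\<lambda>A. Im (\<mu> A)"] ac
    by (metis zero_complex.simps)
  show ?thesis
  proof
    show i: "integrable M (\<lambda>t. complex_of_real (h1 t) + \<i> * complex_of_real (h2 t))"
      using h1 h2 by auto
    fix A assume A: "A \<in> sets M"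
    have iA: "integrable M (\<lambda>t. indicator A t *\<^sub>R (complex_of_real (h1 t) + \<i> * complex_of_real (h2 t)))"
      using A i by (intro integrable_mult_indicator)
    show "\<mu> A = (LINT t:A|M. complex_of_real (h1 t) + \<i> * complex_of_real (h2 t))"
      using h1(2)[OF A] h2(2)[OF A] iA
      by (intro complex_eqI) (simp_all add: set_lebesgue_integral_def flip: integral_Re integral_Im)
  qed
qed

lemma complex_density_unique:
  fixes h k :: "'a \<Rightarrow> complex"
  assumes h: "integrable M h" and k: "integrable M k"
    and eq: "\<And>A. A \<in> sets M \<Longrightarrow> (LINT t:A|M. h t) = (LINT t:A|M. k t)"
  shows "AE t in M. h t = k t"
proof -
  have *: "integrable M (\<lambda>t. indicator A t *\<^sub>R f t)" if "integrable M f" "A \<in> sets M" for f :: "'a \<Rightarrow> complex" and A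
    using that by (intro integrable_mult_indicator)
  have "AE t in M. Re (h t) = Re (k t)"
  proof (rule density_unique_real)
    fix A assume A: "A \<in> sets M"
    show "(LINT t:A|M. Re (h t)) = (LINT t:A|M. Re (k t))"
      using arg_cong[OF eq[OF A], of Re] *[OF h A] *[OF k A]
      by (simp add: set_lebesgue_integral_def flip: integral_Re)
  qed (use h k in auto)
  moreover have "AE t in M. Im (h t) = Im (k t)"
  proof (rule density_unique_real)
    fix A assume A: "A \<in> sets M"
    show "(LINT t:A|M. Im (h t)) = (LINT t:A|M. Im (k t))"
      using arg_cong[OF eq[OF A], of Im] *[OF h A] *[OF k A]
      by (simp add: set_lebesgue_integral_def flip: integral_Im)
  qed (use h k in auto)
  ultimately show ?thesis by eventually_elim (rule complex_eqI)
qed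

section \<open>Norming functionals\<close>

definition sublinear :: "('a::real_vector \<Rightarrow> real) \<Rightarrow> bool"
  where "sublinear p \<longleftrightarrow> (\<forall>x y. p (x + y) \<le> p x + p y) \<and> (\<forall>r\<ge>0. \<forall>x. p (r *\<^sub>R x) \<le> r * p x)"

lemma sublinearD:
  assumes "sublinear p"
  shows sublinear_add: "p (x + y) \<le> p x + p y"
    and sublinear_scale: "0 \<le> r \<Longrightarrow> p (r *\<^sub>R x) = r * p x"
    and sublinear_zero: "p 0 = 0"
    and sublinear_minus: "- p (- x) \<le> p x"
proof -
  show add: "p (x + y) \<le> p x + p y" for x y using assms by (auto simp: sublinear_def)
  have le: "p (r *\<^sub>R x) \<le> r * p x" if "0 \<le> r" for r x using assms that by (auto simp: sublinear_def)
  show z: "p 0 = 0" using le[of 0 0] add[of 0 0] by simp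
  show "- p (- x) \<le> p x" using add[of x "- x"] z by simp
  show "p (r *\<^sub>R x) = r * p x" if "0 \<le> r" for r
  proof (cases "r = 0")
    case False
    with that have "r * p x \<le> p (r *\<^sub>R x)"
      using le[of "inverse r" "r *\<^sub>R x"] by (simp add: field_simps)
    with le[OF that] show ?thesis by (rule antisym)
  qed (simp add: z)
qed

text \<open>
A pointwise minimal sublinear functional \<open>q\<close> is linear, since this lemma forces \<open>q (- y) = - q y\<close>. The same
lemma, applied to the norm, prepares a functional that attains the norm at a prescribed vector. The
functional \<open>q'\<close> is the largest sublinear one below \<open>q\<close> with slope at most \<open>- q y\<close> in direction \<open>- y\<close>.
\<close>

lemma sublinear_reduce:
  assumes q: "sublinear q"
  obtains q' where "sublinear q'" "q' \<le> q" "q' (- y) \<le> - q y"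
proof
  note add = sublinear_add[OF q] and sc = sublinear_scale[OF q] and z = sublinear_zero[OF q]
  define q' where "q' x = (INF t\<in>{0..}. q (x + t *\<^sub>R y) - t * q y)" for x
  have bdd: "bdd_below ((\<lambda>t. q (x + t *\<^sub>R y) - t * q y) ` {0..})" for x
  proof (rule bdd_belowI2)
    fix t :: real assume "t \<in> {0..}"
    then show "- q (- x) \<le> q (x + t *\<^sub>R y) - t * q y"
      using add[of "x + t *\<^sub>R y" "- x"] sc[of t y] by simp
  qed
  have le: "q' x \<le> q (x + t *\<^sub>R y) - t * q y" if "0 \<le> t" for x t
    unfolding q'_def using that by (intro cINF_lower bdd) auto
  have ge: "c \<le> q' x" if "\<And>t. 0 \<le> t \<Longrightarrow> c \<le> q (x + t *\<^sub>R y) - t * q y" for c x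
    unfolding q'_def using that by (intro cINF_greatest) auto
  show "q' \<le> q" using le[of 0] by (simp add: le_fun_def)
  show "q' (- y) \<le> - q y" using le[of 1 "- y"] z by simp
  show "sublinear q'"
    unfolding sublinear_def
  proof (intro conjI allI impI)
    fix x1 x2
    have *: "q' (x1 + x2) \<le> (q (x1 + s *\<^sub>R y) - s * q y) + (q (x2 + t *\<^sub>R y) - t * q y)"
      if "0 \<le> s" "0 \<le> t" for s t
    proof -
      have "q' (x1 + x2) \<le> q (x1 + x2 + (s + t) *\<^sub>R y) - (s + t) * q y"
        using that by (intro le) auto
      also have "x1 + x2 + (s + t) *\<^sub>R y = (x1 + s *\<^sub>R y) + (x2 + t *\<^sub>R y)"
        by (simp add: algebra_simps)
      finally show ?thesis using add[of "x1 + s *\<^sub>R y" "x2 + t *\<^sub>R y"] by (simp add: algebra_simps)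
    qed
    then have "q' (x1 + x2) - (q (x1 + s *\<^sub>R y) - s * q y) \<le> q' x2" if "0 \<le> s" for s
      using *[OF that] by (intro ge) (simp add: diff_le_eq add.commute)
    then have "q' (x1 + x2) - q' x2 \<le> q' x1"
      by (intro ge) (simp add: algebra_simps)
    then show "q' (x1 + x2) \<le> q' x1 + q' x2" by simp
  next
    fix r :: real and x assume r: "0 \<le> r"
    show "q' (r *\<^sub>R x) \<le> r * q' x"
    proof (cases "r = 0")
      case True
      then show ?thesis using le[of 0 0] z by simp
    next
      case False
      have "inverse r * q' (r *\<^sub>R x) \<le> q' x"
      proof (rule ge)
        fix t :: real assume t: "0 \<le> t"
        have "q' (r *\<^sub>R x) \<le> q (r *\<^sub>R x + (r * t) *\<^sub>R y) - r * t * q y"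
          using le[of "r * t" "r *\<^sub>R x"] r t by simp
        also have "r *\<^sub>R x + (r * t) *\<^sub>R y = r *\<^sub>R (x + t *\<^sub>R y)" by (simp add: algebra_simps)
        finally have "q' (r *\<^sub>R x) \<le> r * (q (x + t *\<^sub>R y) - t * q y)"
          unfolding sc[OF r] by (simp add: right_diff_distrib)
        then show "inverse r * q' (r *\<^sub>R x) \<le> q (x + t *\<^sub>R y) - t * q y"
          using r False by (simp add: field_simps)
      qed
      then show ?thesis using r False by (simp add: field_simps)
    qed
  qed
qed

lemma sublinear_Inf_chain:
  assumes C: "C \<noteq> {}" "\<And>q. q \<in> C \<Longrightarrow> sublinear q \<and> q \<le> p"
    and chain: "\<And>q r. q \<in> C \<Longrightarrow> r \<in> C \<Longrightarrow> q \<le> r \<or> r \<le> q"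
  obtains u where "sublinear u" "\<And>q. q \<in> C \<Longrightarrow> u \<le> q"
proof
  define u where "u x = (INF q\<in>C. q x)" for x
  have bdd: "bdd_below ((\<lambda>q. q x) ` C)" for x
  proof (rule bdd_belowI2)
    fix q assume "q \<in> C"
    then have "- q (- x) \<le> q x" "q (- x) \<le> p (- x)"
      using C sublinear_minus by (auto simp: le_fun_def)
    then show "- p (- x) \<le> q x" by linarith
  qed
  have le: "u x \<le> q x" if "q \<in> C" for x q
    unfolding u_def using that by (intro cINF_lower bdd) auto
  have ge: "c \<le> u x" if "\<And>q. q \<in> C \<Longrightarrow> c \<le> q x" for c x
    unfolding u_def using that C(1) by (intro cINF_greatest) auto
  show "u \<le> q" if "q \<in> C" for q using le[OF that] by (simp add: le_fun_def)
  show "sublinear u"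
    unfolding sublinear_def
  proof (intro conjI allI impI)
    fix x y
    have *: "u (x + y) \<le> q x + r y" if qr: "q \<in> C" "r \<in> C" for q r
    proof -
      obtain w where w: "w \<in> C" "w \<le> q" "w \<le> r" using chain[OF qr] qr by blast
      have "u (x + y) \<le> w (x + y)" using w by (intro le)
      also have "\<dots> \<le> w x + w y" using C(2)[OF w(1)] sublinear_add by blast
      also have "\<dots> \<le> q x + r y" using w by (intro add_mono) (auto simp: le_fun_def)
      finally show ?thesis .
    qed
    then have "u (x + y) - q x \<le> u y" if "q \<in> C" for q
      using *[OF that] by (intro ge) (simp add: diff_le_eq add.commute)
    then have "u (x + y) - u y \<le> u x" by (intro ge) (simp add: algebra_simps)
    then show "u (x + y) \<le> u x + u y" by simp
  next
    fix r :: real and x assume r: "0 \<le> r"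
    have *: "u (r *\<^sub>R x) \<le> r * q x" if "q \<in> C" for q
      using le[OF that, of "r *\<^sub>R x"] sublinear_scale[OF _ r] C(2)[OF that] by metis
    show "u (r *\<^sub>R x) \<le> r * u x"
    proof (cases "r = 0")
      case True
      with * C(1) show ?thesis by auto
    next
      case False
      with r * have "u (r *\<^sub>R x) / r \<le> u x" by (intro ge) (simp add: field_simps)
      with r False show ?thesis by (simp add: field_simps)
    qed
  qed
qed

text \<open>
The Hahn-Banach theorem, in the form that avoids extension from subspaces: Zorn's lemma gives a minimal
sublinear functional.
\<close>

lemma linear_below_sublinear:
  fixes p :: "'a::real_vector \<Rightarrow> real"
  assumes p: "sublinear p"
  obtains f where "linear f" "f \<le> p"
proof -
  define S where "S = {q. sublinear q \<and> q \<le> p}"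
  have "partial_order_on S (relation_of (\<lambda>q r. r \<le> q) S)"
    by (rule partial_order_on_relation_ofI) auto
  moreover have "\<exists>u\<in>S. \<forall>q\<in>C. u \<le> q" if C: "C \<in> Chains (relation_of (\<lambda>q r. r \<le> q) S)" for C
  proof (cases "C = {}")
    case True
    then show ?thesis using p by (auto simp: S_def)
  next
    case False
    have CS: "C \<subseteq> S" and ch: "\<And>q r. q \<in> C \<Longrightarrow> r \<in> C \<Longrightarrow> q \<le> r \<or> r \<le> q"
      using C by (auto simp: Chains_def relation_of_def)
    obtain u where u: "sublinear u" "\<And>q. q \<in> C \<Longrightarrow> u \<le> q"
      using sublinear_Inf_chain[OF False _ ch, of p] CS unfolding S_def by (smt (verit) mem_Collect_eq subset_iff)
    obtain q where "q \<in> C" using False by auto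
    then have "u \<le> p" using u(2)[of q] CS by (auto simp: S_def intro: order_trans)
    with u show ?thesis by (auto simp: S_def)
  qed
  ultimately have "\<exists>q\<in>S. \<forall>r\<in>S. r \<le> q \<longrightarrow> r = q" by (rule predicate_Zorn)
  then obtain q where q: "sublinear q" "q \<le> p" and min: "\<And>r. sublinear r \<Longrightarrow> r \<le> q \<Longrightarrow> r = q"
    unfolding S_def by (auto intro: order_trans)
  have neg: "q (- y) = - q y" for y
  proof -
    obtain q' where "sublinear q'" "q' \<le> q" "q' (- y) \<le> - q y"
      using sublinear_reduce[OF q(1)] .
    with min have "q (- y) \<le> - q y" by auto
    with sublinear_minus[OF q(1), of y] show ?thesis by simp
  qed
  have "linear q"
  proof (rule linearI)
    fix x y
    show "q (x + y) = q x + q y"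
      using sublinear_add[OF q(1), of x y] sublinear_add[OF q(1), of "x + y" "- y"] neg[of y] by simp
  next
    fix r x
    show "q (r *\<^sub>R x) = r *\<^sub>R q x"
      using sublinear_scale[OF q(1), of r x] sublinear_scale[OF q(1), of "- r" x] neg[of "r *\<^sub>R x"]
      by (cases "0 \<le> r") auto
  qed
  with q(2) that show ?thesis by blast
qed

lemma norming_real_functional:
  fixes v :: "'a::real_normed_vector"
  obtains f where "linear f" "\<And>x. f x \<le> norm x" "f v = norm v"
proof -
  have "sublinear (norm :: 'a \<Rightarrow> real)" by (auto simp: sublinear_def norm_triangle_ineq)
  then obtain q where q: "sublinear q" "q \<le> norm" "q (- v) \<le> - norm v"
    using sublinear_reduce by blast
  then obtain f where f: "linear f" "f \<le> q" using linear_below_sublinear by blast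
  have "f (- v) \<le> - norm v" using f(2) q(3) by (auto simp: le_fun_def intro: order_trans)
  then have "norm v \<le> f v" using linear_neg[OF f(1)] by simp
  moreover have le: "f x \<le> norm x" for x using f(2) q(2) by (auto simp: le_fun_def intro: order_trans)
  ultimately show ?thesis using that[OF f(1) le] le[of v] by linarith
qed

lemma scaleC_one: "1 *\<^sub>C x = (x :: 'x::complex_banach)"
  using scaleR_scaleC[of 1 x] by simp

text \<open>
A real-linear \<open>f\<close> is the real part of the complex-linear map \<open>x \<mapsto> f x - \<i> f (\<i> x)\<close>, which obeys the same bound:
rotate \<open>x\<close> until the value is real and nonnegative.
\<close>

lemma norming_functional:
  fixes v :: "'x::complex_banach"
  obtains x' where "x' \<in> dual_ball" "blinfun_apply x' v = of_real (norm v)"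
proof -
  obtain f where f: "linear f" "\<And>x. f x \<le> norm x" "f v = norm v"
    using norming_real_functional[of v] by blast
  define F where "F x = Complex (f x) (- f (\<i> *\<^sub>C x))" for x
  have fadd: "f (x + y) = f x + f y" and fsc: "f (of_real r *\<^sub>C x) = r * f x" for x y r
    using linear_add[OF f(1)] linear_scale[OF f(1), of r x] by (simp_all flip: scaleR_scaleC)
  have Fadd: "F (x + y) = F x + F y" for x y
    by (simp add: F_def fadd scaleC_add_right complex_eq_iff)
  have FC: "F (a *\<^sub>C x) = a * F x" for a x
  proof -
    have 1: "a *\<^sub>C x = of_real (Re a) *\<^sub>C x + of_real (Im a) *\<^sub>C \<i> *\<^sub>C x"
      by (subst (1) complex_eq[of a]) (simp add: scaleC_add_left scaleC_scaleC mult.commute)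
    have 2: "\<i> *\<^sub>C a *\<^sub>C x = of_real (Re a) *\<^sub>C \<i> *\<^sub>C x + of_real (- Im a) *\<^sub>C x"
    proof -
      have "\<i> * a = of_real (Re a) * \<i> + of_real (- Im a)" by (simp add: complex_eq_iff)
      then show ?thesis by (simp add: scaleC_scaleC flip: scaleC_add_left)
    qed
    show ?thesis unfolding F_def 2 by (subst 1) (simp only: fadd fsc, simp add: complex_eq_iff)
  qed
  have Fle: "cmod (F x) \<le> norm x" for x
  proof -
    define a where "a = cnj (sgn (F x))"
    have "of_real (cmod (F x)) = a * F x"
      using complex_norm_square[of "F x"]
      by (cases "F x = 0") (auto simp: a_def sgn_eq power2_eq_square field_simps)
    then have "cmod (F x) = Re (F (a *\<^sub>C x))" by (metis FC Re_complex_of_real)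
    also have "\<dots> = f (a *\<^sub>C x)" by (simp add: F_def)
    also have "\<dots> \<le> norm (a *\<^sub>C x)" by (rule f(2))
    also have "\<dots> \<le> 1 * norm x"
      unfolding norm_scaleC by (intro mult_right_mono) (auto simp: a_def norm_sgn)
    finally show ?thesis by simp
  qed
  have bl: "bounded_linear F"
    by (rule bounded_linear_intro[where K=1]) (auto simp: Fadd FC scaleR_scaleC Fle scaleC_complex_def)
  define x' where "x' = Blinfun F"
  have x': "blinfun_apply x' = F" by (simp add: x'_def bounded_linear_Blinfun_apply bl)
  have "norm x' \<le> 1" by (rule norm_blinfun_bound) (simp_all add: x' Fle)
  then have "x' \<in> dual_ball" by (simp add: dual_ball_def dual_def x' FC)
  moreover have "F v = of_real (norm v)"
  proof -
    have "Re (F v) = norm v" by (simp add: F_def f(3))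
    moreover have "(cmod (F v))\<^sup>2 = (Re (F v))\<^sup>2 + (Im (F v))\<^sup>2" by (simp add: cmod_power2)
    moreover have "(cmod (F v))\<^sup>2 \<le> (norm v)\<^sup>2" using Fle by (intro power_mono) auto
    ultimately have "(Im (F v))\<^sup>2 \<le> 0" by simp
    with \<open>Re (F v) = norm v\<close> show ?thesis by (simp add: complex_eq_iff)
  qed
  ultimately show ?thesis using that by (simp add: x')
qed

section \<open>Phases and total variation\<close>

lemma integrable_bounded_mult:
  fixes f g :: "'a \<Rightarrow> 'b::{real_normed_algebra, banach, second_countable_topology}"
  assumes f: "integrable M f" and g: "g \<in> borel_measurable M" and K: "\<And>x. norm (g x) \<le> K"
  shows "integrable M (\<lambda>x. g x * f x)"
proof (rule Bochner_Integration.integrable_bound)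
  show "integrable M (\<lambda>x. K * norm (f x))" using f by auto
  show "(\<lambda>x. g x * f x) \<in> borel_measurable M" using f g by (intro borel_measurable_times) auto
  have "norm (g x * f x) \<le> norm (K * norm (f x))" for x
  proof -
    have "norm (g x * f x) \<le> norm (g x) * norm (f x)" by (rule norm_mult_ineq)
    also have "\<dots> \<le> K * norm (f x)" by (intro mult_right_mono K) simp
    finally show ?thesis by simp
  qed
  then show "AE x in M. norm (g x * f x) \<le> norm (K * norm (f x))" by simp
qed

lemma integrable_simple_approx:
  fixes h :: "'a \<Rightarrow> complex"
  assumes h: "integrable M h" and e: "0 < e"
  obtains \<phi> where "simple_function M \<phi>" "integrable M \<phi>" "(LINT x|M. cmod (h x - \<phi> x)) < e"
proof -
  have hm[measurable]: "h \<in> borel_measurable M" using h by auto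
  obtain F where F: "\<And>i. simple_function M (F i)" "\<And>x. x \<in> space M \<Longrightarrow> (\<lambda>i. F i x) \<longlonglongrightarrow> h x"
    "\<And>i x. x \<in> space M \<Longrightarrow> norm (F i x) \<le> 2 * norm (h x)"
    using borel_measurable_implies_sequence_metric[OF hm, of 0] by simp metis
  have Fm[measurable]: "F i \<in> borel_measurable M" for i using F(1) by (rule borel_measurable_simple_function)
  have "(\<lambda>i. LINT x|M. cmod (h x - F i x)) \<longlonglongrightarrow> (LINT x|M. 0)"
  proof (rule integral_dominated_convergence[where w="\<lambda>x. 3 * cmod (h x)"])
    show "integrable M (\<lambda>x. 3 * cmod (h x))" using h by auto
    show "AE x in M. (\<lambda>i. cmod (h x - F i x)) \<longlonglongrightarrow> 0"
    proof (rule AE_I2)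
      fix x assume "x \<in> space M"
      from tendsto_norm[OF tendsto_diff[OF tendsto_const F(2)[OF this], of "h x"]]
      show "(\<lambda>i. cmod (h x - F i x)) \<longlonglongrightarrow> 0" by simp
    qed
    show "AE x in M. norm (cmod (h x - F i x)) \<le> 3 * cmod (h x)" for i
    proof (rule AE_I2)
      fix x assume "x \<in> space M"
      from F(3)[OF this, of i] norm_triangle_ineq4[of "h x" "F i x"]
      show "norm (cmod (h x - F i x)) \<le> 3 * cmod (h x)" by simp
    qed
  qed auto
  then have "\<forall>\<^sub>F i in sequentially. (LINT x|M. cmod (h x - F i x)) < e"
    using e by (intro order_tendstoD(2)) auto
  then obtain i where i: "(LINT x|M. cmod (h x - F i x)) < e" by (auto simp: eventually_sequentially)
  have "integrable M (F i)"
  proof (rule Bochner_Integration.integrable_bound)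
    show "integrable M (\<lambda>x. 2 * norm (h x))" using h by auto
    show "AE x in M. norm (F i x) \<le> norm (2 * norm (h x))" using F(3) by (intro AE_I2) simp
  qed (rule Fm)
  with F(1) i show ?thesis by (intro that)
qed

text \<open>
The ideal phase is \<open>cnj (sgn h)\<close>. Replacing \<open>h\<close> by a simple function close to it in \<open>L\<^sup>1\<close> makes the phase
simple and costs an arbitrarily small error. With \<open>\<psi>\<close> an indicator this computes total variations; with
\<open>\<psi>\<close> simple it relates integrals against a variation measure to integrals against the vector measure.
\<close>

lemma simple_phase:
  fixes h :: "'a \<Rightarrow> complex" and \<psi> :: "'a \<Rightarrow> real"
  assumes h: "integrable M h" and \<psi>[measurable]: "\<psi> \<in> borel_measurable M"
    and K: "\<And>t. 0 \<le> \<psi> t" "\<And>t. \<psi> t \<le> K" and e: "0 < e"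
  obtains \<theta> where "simple_function M \<theta>" "\<And>t. cmod (\<theta> t) \<le> 1"
    "(LINT t|M. \<psi> t * cmod (h t)) \<le> cmod (LINT t|M. of_real (\<psi> t) * \<theta> t * h t) + e"
proof -
  have K0: "0 \<le> K" using K[of undefined] by linarith
  obtain \<phi> where \<phi>: "simple_function M \<phi>" "integrable M \<phi>" "(LINT x|M. cmod (h x - \<phi> x)) < e / (2 * (K + 1))"
    using integrable_simple_approx[OF h, of "e / (2 * (K + 1))"] e K0 by auto
  define d where "d = (LINT x|M. cmod (h x - \<phi> x))"
  have d: "0 \<le> d" "2 * (K * d) \<le> e"
  proof -
    show d0: "0 \<le> d" by (simp add: d_def)
    have "d * (2 * (K + 1)) < e" using \<phi>(3) K0 by (simp add: d_def pos_less_divide_eq)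
    with d0 show "2 * (K * d) \<le> e" by (simp add: algebra_simps)
  qed
  define \<theta> where "\<theta> t = cnj (sgn (\<phi> t))" for t
  have \<theta>s: "simple_function M \<theta>" unfolding \<theta>_def by (rule simple_function_compose1[OF \<phi>(1)])
  have [measurable]: "\<theta> \<in> borel_measurable M" using \<theta>s by (rule borel_measurable_simple_function)
  have \<theta>1: "cmod (\<theta> t) \<le> 1" for t by (simp add: \<theta>_def norm_sgn)
  have \<theta>\<phi>: "\<theta> t * \<phi> t = of_real (cmod (\<phi> t))" for t
    using complex_norm_square[of "\<phi> t"]
    by (cases "\<phi> t = 0") (auto simp: \<theta>_def sgn_eq power2_eq_square field_simps)
  define g where "g t = of_real (\<psi> t) * \<theta> t" for t
  have gm: "g \<in> borel_measurable M" unfolding g_def by measurable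
  have gK: "cmod (g t) \<le> K" for t
    using mult_mono[OF K(2)[of t] \<theta>1[of t]] K[of t] K0 by (simp add: g_def norm_mult)
  have \<psi>K: "norm (\<psi> t) \<le> K" for t using K[of t] by simp
  have hd: "integrable M (\<lambda>t. h t - \<phi> t)" using h \<phi>(2) by auto
  note ig = integrable_bounded_mult[OF h gm gK] integrable_bounded_mult[OF \<phi>(2) gm gK] integrable_bounded_mult[OF hd gm gK]
  have ih: "integrable M (\<lambda>t. \<psi> t * cmod (h t))"
    by (rule integrable_bounded_mult[OF integrable_norm[OF h] \<psi> \<psi>K])
  have i\<phi>: "integrable M (\<lambda>t. \<psi> t * cmod (\<phi> t))"
    by (rule integrable_bounded_mult[OF integrable_norm[OF \<phi>(2)] \<psi> \<psi>K])
  have id: "integrable M (\<lambda>t. K * cmod (h t - \<phi> t))" using hd by auto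
  have "(LINT t|M. \<psi> t * cmod (h t)) \<le> (LINT t|M. \<psi> t * cmod (\<phi> t) + K * cmod (h t - \<phi> t))"
  proof (rule integral_mono)
    fix t
    have "\<psi> t * cmod (h t) \<le> \<psi> t * (cmod (\<phi> t) + cmod (h t - \<phi> t))"
      using K(1)[of t] norm_triangle_sub[of "h t" "\<phi> t"] by (intro mult_left_mono) auto
    also have "\<dots> \<le> \<psi> t * cmod (\<phi> t) + K * cmod (h t - \<phi> t)"
      using K(2)[of t] by (simp add: distrib_left mult_right_mono)
    finally show "\<psi> t * cmod (h t) \<le> \<psi> t * cmod (\<phi> t) + K * cmod (h t - \<phi> t)" .
  qed (use ih i\<phi> id in auto)
  also have "\<dots> = (LINT t|M. \<psi> t * cmod (\<phi> t)) + K * d"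
    using i\<phi> id by (simp add: d_def)
  finally have 1: "(LINT t|M. \<psi> t * cmod (h t)) \<le> (LINT t|M. \<psi> t * cmod (\<phi> t)) + K * d" .
  have "of_real (LINT t|M. \<psi> t * cmod (\<phi> t)) = (LINT t|M. g t * \<phi> t)"
    unfolding g_def by (subst integral_complex_of_real[symmetric]) (simp add: mult.assoc \<theta>\<phi>)
  also have "\<dots> = (LINT t|M. g t * h t - g t * (h t - \<phi> t))"
    by (simp add: algebra_simps)
  also have "\<dots> = (LINT t|M. g t * h t) - (LINT t|M. g t * (h t - \<phi> t))"
    using ig by (intro Bochner_Integration.integral_diff) auto
  finally have "cmod (of_real (LINT t|M. \<psi> t * cmod (\<phi> t))) \<le>
      cmod (LINT t|M. g t * h t) + cmod (LINT t|M. g t * (h t - \<phi> t))"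
    using norm_triangle_ineq4 by metis
  moreover have "cmod (LINT t|M. g t * (h t - \<phi> t)) \<le> (LINT t|M. K * cmod (h t - \<phi> t))"
  proof -
    have "cmod (LINT t|M. g t * (h t - \<phi> t)) \<le> (LINT t|M. cmod (g t * (h t - \<phi> t)))"
      by (rule integral_norm_bound)
    also have "\<dots> \<le> (LINT t|M. K * cmod (h t - \<phi> t))"
      using integrable_norm[OF ig(3)] id gK by (intro integral_mono) (auto simp: norm_mult intro!: mult_right_mono)
    finally show ?thesis .
  qed
  ultimately have "(LINT t|M. \<psi> t * cmod (\<phi> t)) \<le> cmod (LINT t|M. g t * h t) + K * d"
    by (simp add: d_def)
  with 1 d(2) have "(LINT t|M. \<psi> t * cmod (h t)) \<le> cmod (LINT t|M. g t * h t) + e" by linarith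
  then show ?thesis using that[OF \<theta>s \<theta>1] by (simp add: g_def)
qed

text \<open>
The indicator is multiplied in as a complex number to match the left-hand side of \<open>simple_phase\<close>.
\<close>

lemma integral_simple_times:
  fixes h :: "'a \<Rightarrow> complex"
  assumes h: "integrable M h" and \<theta>: "simple_function M \<theta>" and A: "A \<in> sets M" and sp: "space M = UNIV"
  shows "(LINT t|M. of_real (indicator A t) * \<theta> t * h t) = (\<Sum>a\<in>range \<theta>. a * (LINT t:A \<inter> \<theta> -` {a}|M. h t))"
proof -
  have fin: "finite (range \<theta>)" and lev: "\<theta> -` {a} \<in> sets M" for a
    using simple_functionD[OF \<theta>] sp by auto
  have *: "of_real (indicator A t) * \<theta> t * h t = (\<Sum>a\<in>range \<theta>. a * (indicator (A \<inter> \<theta> -` {a}) t *\<^sub>R h t))" for t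
  proof -
    have "(\<Sum>a\<in>range \<theta>. a * (indicator (A \<inter> \<theta> -` {a}) t *\<^sub>R h t)) =
        (\<Sum>a\<in>range \<theta>. if \<theta> t = a then a * (indicator A t *\<^sub>R h t) else 0)"
      by (intro sum.cong) (auto split: split_indicator)
    also have "\<dots> = \<theta> t * (indicator A t *\<^sub>R h t)" using fin by (subst sum.delta') auto
    finally show ?thesis by (simp add: scaleR_conv_of_real)
  qed
  have i: "integrable M (\<lambda>t. indicator (A \<inter> \<theta> -` {a}) t *\<^sub>R h t)" for a
    using A lev h by (intro integrable_mult_indicator) auto
  have "(LINT t|M. of_real (indicator A t) * \<theta> t * h t) =
      (\<Sum>a\<in>range \<theta>. LINT t|M. a * (indicator (A \<inter> \<theta> -` {a}) t *\<^sub>R h t))"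
    unfolding * by (intro Bochner_Integration.integral_sum integrable_mult_right i)
  also have "\<dots> = (\<Sum>a\<in>range \<theta>. a * (LINT t:A \<inter> \<theta> -` {a}|M. h t))"
    unfolding set_lebesgue_integral_def by (intro sum.cong refl integral_mult_right_zero)
  finally show ?thesis .
qed

text \<open>
Any partition gives a lower bound for the integral of \<open>cmod h\<close>; the level sets of a simple phase for \<open>h\<close>
give a partition that comes arbitrarily close to it.
\<close>

theorem total_variation_density:
  fixes h :: "'g::topological_space \<Rightarrow> complex"
  assumes s: "sets M = sets borel" and h: "integrable M h"
    and \<mu>: "\<And>A. A \<in> sets borel \<Longrightarrow> \<mu> A = (LINT t:A|M. h t)"
  shows "total_variation \<mu> = density M (\<lambda>t. ennreal (cmod (h t)))"
proof -
  have sp: "space M = UNIV" using sets_eq_imp_space_eq[OF s] by simp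
  have hm[measurable]: "h \<in> borel_measurable M" using h by auto
  define D where "D = density M (\<lambda>t. ennreal (cmod (h t)))"
  have sD: "sets D = sets borel" "space D = UNIV" by (simp_all add: D_def s sp)
  have DA: "emeasure D A = ennreal (LINT t|M. indicator A t * cmod (h t))" if "A \<in> sets borel" for A
  proof -
    have "emeasure D A = (\<integral>\<^sup>+t. ennreal (indicator A t * cmod (h t)) \<partial>M)"
      unfolding D_def using that s
      by (subst emeasure_density) (auto intro!: nn_integral_cong split: split_indicator)
    also have "\<dots> = ennreal (LINT t|M. indicator A t * cmod (h t))"
      using integrable_mult_indicator[OF _ integrable_norm[OF h], of A] that s
      by (intro nn_integral_eq_integral) auto
    finally show ?thesis .
  qed
  define V where "V A = (SUP P\<in>{P. finite P \<and> P \<subseteq> sets borel \<and> disjoint P \<and> \<Union>P = A}. \<Sum>B\<in>P. ennreal (cmod (\<mu> B)))" for A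
  have \<mu>0: "\<mu> {} = 0" using \<mu>[of "{}"] by (simp add: set_lebesgue_integral_def)
  have "V A = emeasure D A" if A: "A \<in> sets borel" for A
  proof (rule antisym)
    have le: "ennreal (cmod (\<mu> B)) \<le> emeasure D B" if B: "B \<in> sets borel" for B
    proof -
      have "cmod (\<mu> B) \<le> (LINT t|M. norm (indicator B t *\<^sub>R h t))"
        unfolding \<mu>[OF B] set_lebesgue_integral_def by (rule integral_norm_bound)
      then show ?thesis unfolding DA[OF B] by (intro ennreal_leI) simp
    qed
    show "V A \<le> emeasure D A"
      unfolding V_def
    proof (rule SUP_least)
      fix P assume "P \<in> {P. finite P \<and> P \<subseteq> sets borel \<and> disjoint P \<and> \<Union>P = A}"
      then have P: "finite P" "P \<subseteq> sets borel" "disjoint P" "\<Union>P = A" by simp_all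
      have "(\<Sum>B\<in>P. ennreal (cmod (\<mu> B))) \<le> (\<Sum>B\<in>P. emeasure D B)"
        using P(2) by (intro sum_mono le) auto
      also have "\<dots> = emeasure D (\<Union>B\<in>P. B)"
        using P by (intro sum_emeasure) (auto simp: sD disjoint_family_on_def disjoint_def)
      finally show "(\<Sum>B\<in>P. ennreal (cmod (\<mu> B))) \<le> emeasure D A" using P(4) by simp
    qed
    show "emeasure D A \<le> V A"
    proof (rule ennreal_le_epsilon)
      fix e :: real assume "0 < e"
      have Am: "(indicator A :: 'g \<Rightarrow> real) \<in> borel_measurable M" using A s by simp
      obtain \<theta> where \<theta>: "simple_function M \<theta>" "\<And>t. cmod (\<theta> t) \<le> 1"
        "(LINT t|M. indicator A t * cmod (h t)) \<le> cmod (LINT t|M. of_real (indicator A t) * \<theta> t * h t) + e"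
        by (rule simple_phase[OF h Am _ _ \<open>0 < e\<close>, of 1]) (auto simp: indicator_def intro: that)
      have fin: "finite (range \<theta>)" and lev: "\<theta> -` {a} \<in> sets borel" for a
        using simple_functionD[OF \<theta>(1)] sp s by auto
      define B where "B a = A \<inter> \<theta> -` {a}" for a
      have Bs: "B a \<in> sets borel" for a using A lev by (simp add: B_def)
      have "cmod (LINT t|M. of_real (indicator A t) * \<theta> t * h t) = cmod (\<Sum>a\<in>range \<theta>. a * \<mu> (B a))"
        using integral_simple_times[OF h \<theta>(1) _ sp, of A] A s Bs \<mu> by (simp add: B_def)
      also have "\<dots> \<le> (\<Sum>a\<in>range \<theta>. cmod (\<mu> (B a)))"
      proof (rule sum_norm_le)
        fix a assume "a \<in> range \<theta>"
        then show "cmod (a * \<mu> (B a)) \<le> cmod (\<mu> (B a))"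
          using \<theta>(2) mult_right_mono[of "cmod a" 1 "cmod (\<mu> (B a))"] by (auto simp: norm_mult)
      qed
      finally have "emeasure D A \<le> ennreal ((\<Sum>a\<in>range \<theta>. cmod (\<mu> (B a))) + e)"
        unfolding DA[OF A] using \<theta>(3) by (intro ennreal_leI) linarith
      also have "\<dots> = (\<Sum>a\<in>range \<theta>. ennreal (cmod (\<mu> (B a)))) + ennreal e"
        using \<open>0 < e\<close> by (simp add: ennreal_plus sum_nonneg)
      also have "(\<Sum>a\<in>range \<theta>. ennreal (cmod (\<mu> (B a)))) = (\<Sum>S\<in>B ` range \<theta>. ennreal (cmod (\<mu> S)))"
      proof (rule sum.reindex_nontrivial[symmetric, unfolded o_def])
        fix a b assume "a \<noteq> b" "B a = B b"
        then have "B a = {}" by (auto simp: B_def)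
        then show "ennreal (cmod (\<mu> (B a))) = 0" by (simp add: \<mu>0)
      qed (rule fin)
      also have "\<dots> \<le> V A"
        unfolding V_def
      proof (rule SUP_upper)
        have "disjoint (B ` range \<theta>)" by (auto simp: disjoint_def B_def)
        moreover have "\<Union>(B ` range \<theta>) = A" by (auto simp: B_def)
        ultimately show "B ` range \<theta> \<in> {P. finite P \<and> P \<subseteq> sets borel \<and> disjoint P \<and> \<Union>P = A}"
          using fin Bs by auto
      qed
      finally show "emeasure D A \<le> V A + ennreal e" by (simp add: add_right_mono)
    qed
  qed
  then have "total_variation \<mu> = measure_of UNIV (sets borel) (emeasure D)"
    unfolding total_variation_def V_def[symmetric]
    using sets.sigma_sets_eq[of "borel :: 'g measure"] by (intro measure_of_eq) auto
  also have "\<dots> = D" using measure_of_of_measure[of D] sD by simp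
  finally show ?thesis by (simp add: D_def)
qed

section \<open>Haar measure\<close>

locale haar_measure =
  fixes m :: "'g::{topological_group_add, t2_space} measure"
  assumes haar: "normalized_haar m"
begin

lemma sets_m: "sets m = sets borel" and m_UNIV: "emeasure m UNIV = 1"
  using haar by (auto simp: normalized_haar_def)

lemma space_m: "space m = UNIV"
  using sets_eq_imp_space_eq[OF sets_m] by simp

lemma measurable_m: "f \<in> borel_measurable m \<longleftrightarrow> f \<in> borel_measurable borel"
  using measurable_cong_sets[OF sets_m refl] by blast

lemma radon_m: "radon_prob m"
  using haar unfolding normalized_haar_def radon_prob_def by blast

lemma finite_m: "finite_measure m" by (rule radon_prob_finite[OF radon_m])

lemma borel_measurable_left_translation: "(\<lambda>t. s + t :: 'g) \<in> borel_measurable borel"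
  by (intro borel_measurable_continuous_onI continuous_intros)

lemma borel_measurable_inversion: "(uminus :: 'g \<Rightarrow> 'g) \<in> borel_measurable borel"
  by (intro borel_measurable_continuous_onI continuous_intros)

lemma borel_measurable_quotient: "(\<lambda>z :: 'g \<times> 'g. - fst z + snd z) \<in> borel_measurable borel"
  by (intro borel_measurable_continuous_onI continuous_intros)

lemma nn_integral_left_translation:
  assumes F: "F \<in> borel_measurable borel"
  shows "(\<integral>\<^sup>+t. F (s + t) \<partial>m) = (\<integral>\<^sup>+t. F t \<partial>m)"
proof -
  have meas: "(\<lambda>t. s + t) \<in> measurable m m"
    using borel_measurable_left_translation[of s] measurable_cong_sets[OF sets_m sets_m] by blast
  have "distr m m (\<lambda>t. s + t) = m"
  proof (rule measure_eqI)
    fix A assume "A \<in> sets (distr m m (\<lambda>t. s + t))"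
    then have A: "A \<in> sets borel" by (simp add: sets_m)
    have "(\<lambda>t. s + t) -` A = (\<lambda>t. - s + t) ` A"
    proof
      show "(\<lambda>t. s + t) -` A \<subseteq> (\<lambda>t. - s + t) ` A"
      proof
        fix t assume "t \<in> (\<lambda>t. s + t) -` A"
        then have "s + t \<in> A" by simp
        moreover have "t = - s + (s + t)" by (simp add: add.assoc[symmetric])
        ultimately show "t \<in> (\<lambda>t. - s + t) ` A" by blast
      qed
    qed (auto simp: add.assoc[symmetric])
    then show "emeasure (distr m m (\<lambda>t. s + t)) A = emeasure m A"
      using A haar by (simp add: emeasure_distr[OF meas] sets_m space_m normalized_haar_def)
  qed simp
  then have "(\<integral>\<^sup>+t. F t \<partial>m) = (\<integral>\<^sup>+t. F t \<partial>distr m m (\<lambda>t. s + t))" by simp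
  also have "\<dots> = (\<integral>\<^sup>+t. F (s + t) \<partial>m)"
    using F by (intro nn_integral_distr[OF meas]) (simp add: measurable_m)
  finally show ?thesis ..
qed

text \<open>
Unimodularity: integrate \<open>F (- s + t)\<close> over both variables. Integration over \<open>t\<close> first gives the integral
of \<open>F\<close>, and integration over \<open>s\<close> first gives that of \<open>F \<circ> uminus\<close>, both by left invariance.
\<close>

lemma nn_integral_inversion:
  assumes F: "F \<in> borel_measurable borel"
  shows "(\<integral>\<^sup>+t. F (- t) \<partial>m) = (\<integral>\<^sup>+t. F t \<partial>m)"
proof -
  have "(\<integral>\<^sup>+t. F t \<partial>m) = (\<integral>\<^sup>+s. \<integral>\<^sup>+t. F (- s + t) \<partial>m \<partial>m)"
    by (simp add: nn_integral_left_translation[OF F] m_UNIV space_m)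
  also have "\<dots> = (\<integral>\<^sup>+t. \<integral>\<^sup>+s. F (- s + t) \<partial>m \<partial>m)"
    using fubini_radon[OF radon_m radon_m measurable_compose[OF borel_measurable_quotient F]] by simp
  also have "\<dots> = (\<integral>\<^sup>+t. \<integral>\<^sup>+s. F (- (- t + s)) \<partial>m \<partial>m)"
    by (simp add: minus_add)
  also have "\<dots> = (\<integral>\<^sup>+t. \<integral>\<^sup>+s. F (- s) \<partial>m \<partial>m)"
    using nn_integral_left_translation[OF measurable_compose[OF borel_measurable_inversion F]] by simp
  finally show ?thesis by (simp add: m_UNIV space_m)
qed

lemma nn_integral_reflected_translation:
  assumes F: "F \<in> borel_measurable borel"
  shows "(\<integral>\<^sup>+s. F (- s + t) \<partial>m) = (\<integral>\<^sup>+s. F s \<partial>m)"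
proof -
  have "(\<integral>\<^sup>+s. F (- s + t) \<partial>m) = (\<integral>\<^sup>+s. F (- (- t + s)) \<partial>m)" by (simp add: minus_add)
  also have "\<dots> = (\<integral>\<^sup>+s. F (- s) \<partial>m)"
    using nn_integral_left_translation[OF measurable_compose[OF borel_measurable_inversion F]] by simp
  finally show ?thesis using nn_integral_inversion[OF F] by simp
qed

lemma borel_measurable_translate:
  fixes f :: "'g \<Rightarrow> 'b::topological_space"
  shows "f \<in> borel_measurable borel \<Longrightarrow> (\<lambda>t. f (- s + t)) \<in> borel_measurable borel"
  using measurable_compose[OF borel_measurable_left_translation[of "- s"]] by blast

lemma borel_measurable_reflect:
  fixes f :: "'g \<Rightarrow> 'b::topological_space"
  assumes "f \<in> borel_measurable borel"
  shows "(\<lambda>s. f (- s + t)) \<in> borel_measurable borel"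
proof (rule measurable_compose[OF _ assms])
  show "(\<lambda>s. - s + t) \<in> borel_measurable borel"
    by (intro borel_measurable_continuous_onI continuous_intros)
qed

lemma simple_function_m: "simple_function m f \<longleftrightarrow> simple_function borel f"
  by (simp add: simple_function_def sets_m space_m)

lemma simple_function_translate:
  assumes "simple_function borel \<phi>"
  shows "simple_function borel (\<lambda>t :: 'g. \<phi> (s + t))"
proof -
  have fin: "finite (range \<phi>)" and lev: "\<phi> -` {a} \<in> sets borel" for a
    using simple_functionD[OF assms] by auto
  show ?thesis
    unfolding simple_function_def
  proof (intro conjI ballI)
    show "finite ((\<lambda>t. \<phi> (s + t)) ` space borel)" by (rule finite_subset[OF _ fin]) auto
    fix a
    have "(\<lambda>t. \<phi> (s + t)) -` {a} = (\<lambda>t. s + t) -` (\<phi> -` {a})" by auto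
    then show "(\<lambda>t. \<phi> (s + t)) -` {a} \<inter> space borel \<in> sets borel"
      using borel_vimage[OF borel_measurable_left_translation lev] by simp
  qed
qed

end

section \<open>Vector measures and translations\<close>

locale invariant_vector_measure = haar_measure m
  for m :: "'g::{topological_group_add, t2_space} measure" +
  fixes \<nu> :: "'g set \<Rightarrow> 'x::complex_banach"
  assumes vm: "vector_measure \<nu>" and nonzero: "nonzero_measure \<nu>" and ac: "abs_cont \<nu> m"
    and inv: "norm_integral_translation_invariant \<nu>"
begin

abbreviation dens :: "('x \<Rightarrow>\<^sub>L complex) \<Rightarrow> 'g \<Rightarrow> complex"
  where "dens \<equiv> dual_density \<nu> m"

abbreviation tv :: "('x \<Rightarrow>\<^sub>L complex) \<Rightarrow> 'g measure"
  where "tv x' \<equiv> total_variation (scalar_measure \<nu> x')"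

lemma sigma_additive_nu: "sigma_additive m \<nu>"
  using vm by (auto simp: vector_measure_def sigma_additive_def sets_m)

lemma nu_eq_0:
  assumes "A \<in> sets borel" "emeasure m A = 0" shows "\<nu> A = 0"
proof (rule ccontr)
  assume "\<nu> A \<noteq> 0"
  then have "0 < norm (\<nu> A)" by simp
  then obtain d where d: "0 < d" "\<forall>B\<in>sets borel. measure m B < d \<longrightarrow> norm (\<nu> B) < norm (\<nu> A)"
    using ac[unfolded abs_cont_def, rule_format, of "norm (\<nu> A)"] by blast
  have "measure m A < d" using assms(2) d(1) by (simp add: measure_def)
  with d(2) assms(1) have "norm (\<nu> A) < norm (\<nu> A)" by blast
  then show False by simp
qed

lemma dens_is_density:
  shows integrable_dens: "integrable m (dens x')"
    and dens_integral: "\<And>A. A \<in> sets borel \<Longrightarrow> blinfun_apply x' (\<nu> A) = (LINT t:A|m. dens x' t)"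
proof -
  have sa: "sigma_additive m (\<lambda>A. blinfun_apply x' (\<nu> A))"
    unfolding sigma_additive_def
  proof (intro allI impI)
    fix A :: "nat \<Rightarrow> 'g set" assume "range A \<subseteq> sets m" "disjoint_family A"
    then have "(\<lambda>i. \<nu> (A i)) sums \<nu> (\<Union>i. A i)"
      using sigma_additive_nu by (simp add: sigma_additive_def)
    then show "(\<lambda>i. blinfun_apply x' (\<nu> (A i))) sums blinfun_apply x' (\<nu> (\<Union>i. A i))"
      by (rule bounded_linear.sums[OF blinfun.bounded_linear_right])
  qed
  obtain h where h: "integrable m h" "\<And>A. A \<in> sets m \<Longrightarrow> blinfun_apply x' (\<nu> A) = (LINT t:A|m. h t)"
  proof (rule complex_density[OF finite_m sa])
    show "blinfun_apply x' (\<nu> A) = 0" if "A \<in> sets m" "emeasure m A = 0" for A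
      using nu_eq_0[of A] that by (simp add: sets_m blinfun.zero_right)
  qed (rule that)
  have ex: "\<exists>h. integrable m h \<and> (\<forall>A\<in>sets borel. scalar_measure \<nu> x' A = (LINT t:A|m. h t))"
  proof (intro exI[of _ h] conjI ballI)
    show "integrable m h" by (rule h(1))
    show "scalar_measure \<nu> x' A = (LINT t:A|m. h t)" if "A \<in> sets borel" for A
      unfolding scalar_measure_def by (rule h(2)) (simp only: sets_m that)
  qed
  have D: "integrable m (dens x') \<and> (\<forall>A\<in>sets borel. scalar_measure \<nu> x' A = (LINT t:A|m. dens x' t))"
    unfolding dual_density_def by (rule someI_ex[OF ex])
  then show "integrable m (dens x')" ..
  show "blinfun_apply x' (\<nu> A) = (LINT t:A|m. dens x' t)" if "A \<in> sets borel" for A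
    using bspec[OF conjunct2[OF D] that] by (simp only: scalar_measure_def)
qed

lemma borel_measurable_dens: "dens x' \<in> borel_measurable borel"
  using borel_measurable_integrable[OF integrable_dens[of x']] by (simp only: measurable_m)

lemma AE_dens_eqI:
  assumes h: "integrable m h" and eq: "\<And>A. A \<in> sets borel \<Longrightarrow> blinfun_apply x' (\<nu> A) = (LINT t:A|m. h t)"
  shows "AE t in m. dens x' t = h t"
  using dens_integral[of _ x'] eq by (intro complex_density_unique integrable_dens h) (auto simp: sets_m)

lemma AE_dens_add: "AE t in m. dens (x' + y') t = dens x' t + dens y' t"
proof (rule AE_dens_eqI)
  fix A :: "'g set" assume A: "A \<in> sets borel"
  have "set_integrable m A (dens x')" "set_integrable m A (dens y')"
    unfolding set_integrable_def using A by (intro integrable_mult_indicator integrable_dens; simp add: sets_m)+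
  then show "blinfun_apply (x' + y') (\<nu> A) = (LINT t:A|m. dens x' t + dens y' t)"
    unfolding blinfun.add_left dens_integral[OF A, of x'] dens_integral[OF A, of y'] by (simp add: set_integral_add)
qed (intro Bochner_Integration.integrable_add integrable_dens)

lemma AE_dens_scale: "AE t in m. dens (a *\<^sub>C x') t = a * dens x' t"
proof (rule AE_dens_eqI)
  fix A :: "'g set" assume A: "A \<in> sets borel"
  show "blinfun_apply (a *\<^sub>C x') (\<nu> A) = (LINT t:A|m. a * dens x' t)"
    using dens_integral[OF A] by (simp add: scaleC_blinfun.rep_eq scaleC_complex_def)
qed (intro integrable_mult_right integrable_dens)

lemma tv_eq: "tv x' = density m (\<lambda>t. ennreal (cmod (dens x' t)))"
  using dens_integral by (intro total_variation_density sets_m integrable_dens) (simp add: scalar_measure_def)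

lemma sets_tv: "sets (tv x') = sets borel"
  by (simp add: tv_eq sets_m)

lemma nn_integral_tv:
  assumes "F \<in> borel_measurable borel"
  shows "(\<integral>\<^sup>+t. F t \<partial>tv x') = (\<integral>\<^sup>+t. ennreal (cmod (dens x' t)) * F t \<partial>m)"
  unfolding tv_eq using assms borel_measurable_dens[of x']
  by (intro nn_integral_density) (simp_all add: measurable_m)

lemma AE_tv: "AE t in m. P t \<Longrightarrow> AE t in tv x'. P t"
  unfolding tv_eq using borel_measurable_dens[of x'] by (subst AE_density) (auto simp: measurable_m)

lemma AE_imp_nu_null:
  assumes "AE t in m. P t"
  obtains N where "nu_null \<nu> N" "\<And>t. t \<notin> N \<Longrightarrow> P t"
proof -
  obtain N where N: "{t\<in>space m. \<not> P t} \<subseteq> N" "emeasure m N = 0" "N \<in> sets m"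
    using AE_E[OF assms] by blast
  have "\<nu> B = 0" if "B \<in> sets borel" "B \<subseteq> N" for B
    using that N emeasure_mono[of B N m] by (intro nu_eq_0) (auto simp: sets_m)
  then have "nu_null \<nu> N" using N by (auto simp: nu_null_def sets_m)
  then show ?thesis by (rule that) (use N(1) space_m in auto)
qed

lemma blinfun_apply_simple_integral_nu:
  assumes x': "x' \<in> dual" and \<phi>: "simple_function borel \<phi>"
  shows "blinfun_apply x' (simple_integral_nu \<nu> \<phi>) = (LINT t|m. \<phi> t * dens x' t)"
proof -
  have lev: "\<phi> -` {a} \<in> sets borel" for a using simple_functionD[OF \<phi>] by auto
  have "blinfun_apply x' (simple_integral_nu \<nu> \<phi>) = (\<Sum>a\<in>range \<phi>. a * blinfun_apply x' (\<nu> (\<phi> -` {a})))"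
    using x' by (simp add: simple_integral_nu_def blinfun.sum_right dual_def)
  also have "\<dots> = (LINT t|m. of_real (indicator UNIV t) * \<phi> t * dens x' t)"
    using \<phi> lev by (subst integral_simple_times[OF integrable_dens]) (simp_all add: simple_function_m sets_m space_m dens_integral)
  finally show ?thesis by simp
qed

text \<open>
Choose a simple phase for \<open>y'\<close> and the translated function. The resulting integral is the value of \<open>y'\<close> at
the \<open>\<nu>\<close>-integral of a translate of a simple function \<open>\<sigma>\<close>; its norm equals that of the \<open>\<nu>\<close>-integral of \<open>\<sigma>\<close>,
which is attained by a functional \<open>x'\<close> in the dual ball, and \<open>cmod \<sigma> \<le> \<psi>\<close>. The functional changes from
\<open>y'\<close> to \<open>x'\<close>, which is why only suprema over the ball can be compared.
\<close>

lemma tv_translation_le_SUP_simple: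
  fixes \<psi> :: "'g \<Rightarrow> real"
  assumes y': "y' \<in> dual_ball" and \<psi>: "simple_function borel \<psi>" "\<And>t. 0 \<le> \<psi> t"
  shows "(\<integral>\<^sup>+t. ennreal (cmod (dens y' t)) * ennreal (\<psi> (- s + t)) \<partial>m) \<le>
    (SUP x'\<in>dual_ball. \<integral>\<^sup>+t. ennreal (cmod (dens x' t)) * ennreal (\<psi> t) \<partial>m)" (is "?L \<le> ?R")
proof (rule ennreal_le_epsilon)
  fix e :: real assume e: "0 < e"
  have fin: "finite (range \<psi>)" using simple_functionD(1)[OF \<psi>(1)] by simp
  define K where "K = Max (range \<psi>)"
  have K: "\<psi> t \<le> K" for t unfolding K_def using fin by (intro Max_ge) auto
  have \<psi>m: "\<psi> \<in> borel_measurable borel" using \<psi>(1) by (rule borel_measurable_simple_function)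
  have \<psi>sm: "(\<lambda>t. \<psi> (- s + t)) \<in> borel_measurable m"
    using borel_measurable_translate[OF \<psi>m] by (simp add: measurable_m)
  have eqn: "(\<integral>\<^sup>+t. ennreal (cmod (dens x' t)) * ennreal (f t) \<partial>m) = ennreal (LINT t|m. f t * cmod (dens x' t))"
    if f: "f \<in> borel_measurable borel" "\<And>t. 0 \<le> f t" "\<And>t. f t \<le> K" for x' f
  proof -
    have "integrable m (\<lambda>t. f t * cmod (dens x' t))"
      using f by (intro integrable_bounded_mult[where K=K] integrable_norm integrable_dens) (simp_all add: measurable_m)
    then show ?thesis
      using f by (subst nn_integral_eq_integral[symmetric]) (simp_all add: ennreal_mult mult.commute)
  qed
  obtain \<theta> where \<theta>: "simple_function m \<theta>" "\<And>t. cmod (\<theta> t) \<le> 1"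
    "(LINT t|m. \<psi> (- s + t) * cmod (dens y' t)) \<le> cmod (LINT t|m. of_real (\<psi> (- s + t)) * \<theta> t * dens y' t) + e"
    by (rule simple_phase[OF integrable_dens[of y'] \<psi>sm \<psi>(2) K e]) (rule that)
  define \<sigma> where "\<sigma> t = of_real (\<psi> t) * \<theta> (s + t)" for t
  have \<sigma>s: "simple_function borel \<sigma>"
    unfolding \<sigma>_def using simple_function_translate[of \<theta> s] \<theta>(1) \<psi>(1)
    by (intro simple_function_mult simple_function_compose1[of _ \<psi> of_real]) (simp_all add: simple_function_m)
  have \<sigma>ts: "simple_function borel (translate s \<sigma>)"
    unfolding translate_def by (rule simple_function_translate[OF \<sigma>s])
  have tr: "translate s \<sigma> t = of_real (\<psi> (- s + t)) * \<theta> t" for t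
    by (simp add: translate_def \<sigma>_def add.assoc[symmetric])
  obtain x' where x': "x' \<in> dual_ball" "blinfun_apply x' (simple_integral_nu \<nu> \<sigma>) = of_real (norm (simple_integral_nu \<nu> \<sigma>))"
    by (rule norming_functional) (rule that)
  have d: "x' \<in> dual" "y' \<in> dual" "norm y' \<le> 1" using x' y' by (auto simp: dual_ball_def)
  have "cmod (LINT t|m. of_real (\<psi> (- s + t)) * \<theta> t * dens y' t) = cmod (blinfun_apply y' (simple_integral_nu \<nu> (translate s \<sigma>)))"
    by (simp add: blinfun_apply_simple_integral_nu[OF d(2) \<sigma>ts] tr)
  also have "\<dots> \<le> norm y' * norm (simple_integral_nu \<nu> (translate s \<sigma>))" by (rule norm_blinfun)
  also have "\<dots> \<le> 1 * norm (simple_integral_nu \<nu> (translate s \<sigma>))" by (intro mult_right_mono d(3)) simp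
  also have "\<dots> = norm (simple_integral_nu \<nu> \<sigma>)"
    using inv \<sigma>s by (simp add: norm_integral_translation_invariant_def)
  also have "\<dots> = cmod (blinfun_apply x' (simple_integral_nu \<nu> \<sigma>))" by (simp add: x'(2))
  also have "\<dots> = cmod (LINT t|m. \<sigma> t * dens x' t)" by (simp add: blinfun_apply_simple_integral_nu[OF d(1) \<sigma>s])
  also have "\<dots> \<le> (LINT t|m. cmod (\<sigma> t * dens x' t))" by (rule integral_norm_bound)
  also have "\<dots> \<le> (LINT t|m. \<psi> t * cmod (dens x' t))"
  proof (rule integral_mono)
    have \<sigma>b: "cmod (\<sigma> t) \<le> \<psi> t" for t
      using mult_left_mono[OF \<theta>(2)[of "s + t"] \<psi>(2)[of t]] \<psi>(2)[of t] by (simp add: \<sigma>_def norm_mult)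
    have "\<sigma> \<in> borel_measurable m" using \<sigma>s by (simp add: measurable_m borel_measurable_simple_function)
    moreover have "cmod (\<sigma> t) \<le> K" for t using \<sigma>b[of t] K[of t] by linarith
    ultimately show "integrable m (\<lambda>t. cmod (\<sigma> t * dens x' t))"
      by (intro integrable_norm integrable_bounded_mult integrable_dens)
    show "integrable m (\<lambda>t. \<psi> t * cmod (dens x' t))"
      using \<psi> K \<psi>m by (intro integrable_bounded_mult[where K=K] integrable_norm integrable_dens) (simp_all add: measurable_m)
    show "cmod (\<sigma> t * dens x' t) \<le> \<psi> t * cmod (dens x' t)" for t
      using \<sigma>b by (simp add: norm_mult mult_right_mono)
  qed
  finally have "(LINT t|m. \<psi> (- s + t) * cmod (dens y' t)) \<le> (LINT t|m. \<psi> t * cmod (dens x' t)) + e"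
    using \<theta>(3) by linarith
  then have "?L \<le> ennreal ((LINT t|m. \<psi> t * cmod (dens x' t)) + e)"
    using eqn[of "\<lambda>t. \<psi> (- s + t)" y'] \<psi>(2) K borel_measurable_translate[OF \<psi>m] by (simp add: ennreal_leI)
  also have "\<dots> = (\<integral>\<^sup>+t. ennreal (cmod (dens x' t)) * ennreal (\<psi> t) \<partial>m) + ennreal e"
    using eqn[of \<psi> x'] \<psi> K \<psi>m e by (subst ennreal_plus) (auto intro!: integral_nonneg_AE)
  also have "\<dots> \<le> ?R + ennreal e"
    by (intro add_right_mono SUP_upper2[OF x'(1)] order_refl)
  finally show "?L \<le> ?R + ennreal e" .
qed

text \<open>
Monotone approximation by simple functions.
\<close>

theorem tv_translation_le_SUP:
  assumes y': "y' \<in> dual_ball" and F: "F \<in> borel_measurable borel"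
  shows "(\<integral>\<^sup>+t. F (- s + t) \<partial>tv y') \<le> (SUP x'\<in>dual_ball. \<integral>\<^sup>+t. F t \<partial>tv x')"
proof -
  obtain f where f: "\<And>i. simple_function borel (f i)" "incseq f" "\<And>i x. f i x < top" "\<And>x. (SUP i. f i x) = F x"
    by (rule borel_measurable_implies_simple_function_sequence'[OF F]) (rule that)
  have fm: "f i \<in> borel_measurable borel" for i using f(1) by (rule borel_measurable_simple_function)
  have "(\<integral>\<^sup>+t. F (- s + t) \<partial>tv y') = (\<integral>\<^sup>+t. (SUP i. f i (- s + t)) \<partial>tv y')" by (simp add: f(4))
  also have "\<dots> = (SUP i. \<integral>\<^sup>+t. f i (- s + t) \<partial>tv y')"
  proof (rule nn_integral_monotone_convergence_SUP)
    show "incseq (\<lambda>i t. f i (- s + t))" using f(2) by (auto simp: incseq_def le_fun_def)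
    show "(\<lambda>t. f i (- s + t)) \<in> borel_measurable (tv y')" for i
      using borel_measurable_translate[OF fm] measurable_cong_sets[OF sets_tv refl] by blast
  qed
  also have "\<dots> \<le> (SUP x'\<in>dual_ball. \<integral>\<^sup>+t. F t \<partial>tv x')"
  proof (rule SUP_least)
    fix i
    define \<psi> where "\<psi> t = enn2real (f i t)" for t
    have \<psi>: "f i t = ennreal (\<psi> t)" for t using f(3) by (simp add: \<psi>_def)
    have \<psi>s: "simple_function borel \<psi>" unfolding \<psi>_def by (rule simple_function_compose1[OF f(1)])
    have "(\<integral>\<^sup>+t. f i (- s + t) \<partial>tv y') = (\<integral>\<^sup>+t. ennreal (cmod (dens y' t)) * ennreal (\<psi> (- s + t)) \<partial>m)"
      unfolding nn_integral_tv[OF borel_measurable_translate[OF fm]] by (simp add: \<psi>)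
    also have "\<dots> \<le> (SUP x'\<in>dual_ball. \<integral>\<^sup>+t. ennreal (cmod (dens x' t)) * ennreal (\<psi> t) \<partial>m)"
      by (intro tv_translation_le_SUP_simple y' \<psi>s) (simp add: \<psi>_def)
    also have "\<dots> = (SUP x'\<in>dual_ball. \<integral>\<^sup>+t. f i t \<partial>tv x')"
      by (intro SUP_cong refl) (simp add: nn_integral_tv fm \<psi>[symmetric])
    also have "\<dots> \<le> (SUP x'\<in>dual_ball. \<integral>\<^sup>+t. F t \<partial>tv x')"
    proof (intro SUP_mono' nn_integral_mono)
      show "f i t \<le> F t" for t unfolding f(4)[symmetric] by (rule SUP_upper) simp
    qed
    finally show "(\<integral>\<^sup>+t. f i (- s + t) \<partial>tv y') \<le> (SUP x'\<in>dual_ball. \<integral>\<^sup>+t. F t \<partial>tv x')" .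
  qed
  finally show ?thesis .
qed

end

section \<open>Young functions and the Luxemburg norm\<close>

lemma young_functionD:
  assumes "young_function \<Phi>"
  shows young_0: "\<Phi> 0 = 0"
    and young_nonneg: "0 \<le> t \<Longrightarrow> 0 \<le> \<Phi> t"
    and young_mono: "0 \<le> s \<Longrightarrow> s \<le> t \<Longrightarrow> \<Phi> s \<le> \<Phi> t"
    and young_pos: "0 < t \<Longrightarrow> 0 < \<Phi> t"
    and young_convex: "convex_on {0..} \<Phi>"
proof -
  have nn: "\<forall>t\<ge>0. 0 \<le> \<Phi> t" and sm: "strict_mono_on {0..} \<Phi>" and cv: "convex_on {0..} \<Phi>"
    and z: "\<forall>t\<ge>0. \<Phi> t = 0 \<longleftrightarrow> t = 0"
    using assms unfolding young_function_def by blast+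
  show "\<Phi> 0 = 0" using z by simp
  show "0 \<le> \<Phi> t" if "0 \<le> t" using nn that by simp
  show "0 < \<Phi> t" if "0 < t" using nn z that by (metis less_eq_real_def)
  show "convex_on {0..} \<Phi>" by (rule cv)
  show "\<Phi> s \<le> \<Phi> t" if "0 \<le> s" "s \<le> t"
    using strict_mono_onD[OF sm, of s t] that by (cases "s = t") auto
qed

lemma borel_measurable_young:
  assumes \<Phi>: "young_function \<Phi>" and f: "f \<in> borel_measurable M" "\<And>t. 0 \<le> f t"
  shows "(\<lambda>t. \<Phi> (f t)) \<in> borel_measurable M"
proof -
  have "continuous_on {0..} \<Phi>" using \<Phi> by (simp only: young_function_def)
  then have "continuous_on UNIV (\<lambda>x. \<Phi> (max 0 x))"
    by (rule continuous_on_compose2) (auto intro!: continuous_intros)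
  then have "(\<lambda>x. \<Phi> (max 0 x)) \<in> borel_measurable borel" by (rule borel_measurable_continuous_onI)
  from measurable_compose[OF f(1) this] show ?thesis using f(2) by (simp add: max_absorb2)
qed

lemma young_scale_le:
  assumes \<Phi>: "young_function \<Phi>" and "0 \<le> r" "r \<le> 1" "0 \<le> t"
  shows "\<Phi> (r * t) \<le> r * \<Phi> t"
  using convex_onD[OF young_convex[OF \<Phi>], of r 0 t] assms young_0[OF \<Phi>] by simp

lemma young_support_line:
  assumes \<Phi>: "young_function \<Phi>" and c: "0 < c"
  obtains a where "0 \<le> a" "\<And>y. 0 \<le> y \<Longrightarrow> \<Phi> c + a * y \<le> \<Phi> y + a * c"
proof -
  define a where "a = Inf ((\<lambda>t. (\<Phi> c - \<Phi> t) / (c - t)) ` ({c<..} \<inter> {0..}))"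
  have "c \<in> interior {0::real..}" using c by (simp add: interior_real_atLeast)
  then have line: "\<Phi> y \<ge> \<Phi> c + a * (y - c)" if "0 \<le> y" for y
    unfolding a_def by (intro convex_le_Inf_differential young_convex[OF \<Phi>]) (use that in auto)
  have "\<Phi> c \<le> a * c" using line[of 0] young_0[OF \<Phi>] by (simp add: algebra_simps)
  then have "0 \<le> a * c" using young_nonneg[OF \<Phi>, of c] c by linarith
  then have "0 \<le> a" using c by (simp add: zero_le_mult_iff)
  moreover have "\<Phi> c + a * y \<le> \<Phi> y + a * c" if "0 \<le> y" for y
    using line[OF that] by (simp add: right_diff_distrib)
  ultimately show ?thesis by (rule that)
qed

text \<open>
Integrate the support line of \<open>\<Phi>\<close> at the mean \<open>c\<close>. The term \<open>a * c\<close> is kept on both sides and cancelled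
at the end, which keeps all integrands nonnegative and allows the right-hand side to be infinite.
\<close>

lemma young_jensen:
  fixes w q :: "'a \<Rightarrow> real"
  assumes \<Phi>: "young_function \<Phi>" and w: "w \<in> borel_measurable M" "\<And>x. 0 \<le> w x" "(\<integral>\<^sup>+x. ennreal (w x) \<partial>M) = 1"
    and q: "q \<in> borel_measurable M" "\<And>x. 0 \<le> q x" and i: "integrable M (\<lambda>x. w x * q x)"
  shows "ennreal (\<Phi> (LINT x|M. w x * q x)) \<le> (\<integral>\<^sup>+x. ennreal (w x) * ennreal (\<Phi> (q x)) \<partial>M)"
proof -
  define c where "c = (LINT x|M. w x * q x)"
  have c0: "0 \<le> c" unfolding c_def using w q by (intro integral_nonneg_AE) auto
  note [measurable] = w(1) q(1) borel_measurable_young[OF \<Phi> q]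
  show ?thesis
  proof (cases "c = 0")
    case True
    then show ?thesis by (simp add: c_def young_0[OF \<Phi>])
  next
    case False
    with c0 have "0 < c" by simp
    from young_support_line[OF \<Phi> this] obtain a where a: "0 \<le> a" "\<And>y. 0 \<le> y \<Longrightarrow> \<Phi> c + a * y \<le> \<Phi> y + a * c"
      by blast
    have \<Phi>q: "0 \<le> \<Phi> (q x)" for x using young_nonneg[OF \<Phi> q(2)] .
    have \<Phi>c: "0 \<le> \<Phi> c" using young_nonneg[OF \<Phi> c0] .
    have wq: "(\<integral>\<^sup>+x. ennreal (w x * q x) \<partial>M) = ennreal c"
      unfolding c_def using w q by (intro nn_integral_eq_integral i) auto
    have "ennreal (a * c) + ennreal (\<Phi> c) = (\<integral>\<^sup>+x. ennreal a * ennreal (w x * q x) + ennreal (\<Phi> c) * ennreal (w x) \<partial>M)"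
      using a(1) c0 by (simp add: nn_integral_add nn_integral_cmult wq w(3) ennreal_mult)
    also have "\<dots> \<le> (\<integral>\<^sup>+x. ennreal (a * c) * ennreal (w x) + ennreal (w x) * ennreal (\<Phi> (q x)) \<partial>M)"
    proof (rule nn_integral_mono)
      fix x
      have "a * (w x * q x) + \<Phi> c * w x \<le> a * c * w x + w x * \<Phi> (q x)"
        using mult_left_mono[OF a(2)[OF q(2)[of x]] w(2)[of x]] by (simp add: algebra_simps)
      then have "ennreal (a * (w x * q x) + \<Phi> c * w x) \<le> ennreal (a * c * w x + w x * \<Phi> (q x))" by (rule ennreal_leI)
      then show "ennreal a * ennreal (w x * q x) + ennreal (\<Phi> c) * ennreal (w x)
          \<le> ennreal (a * c) * ennreal (w x) + ennreal (w x) * ennreal (\<Phi> (q x))"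
        using a(1) c0 w(2)[of x] q(2)[of x] \<Phi>q[of x] \<Phi>c by (simp add: ennreal_plus ennreal_mult)
    qed
    also have "\<dots> = ennreal (a * c) + (\<integral>\<^sup>+x. ennreal (w x) * ennreal (\<Phi> (q x)) \<partial>M)"
      by (simp add: nn_integral_add nn_integral_cmult w(3))
    finally show ?thesis by (simp add: c_def ennreal_add_left_cancel_le)
  qed
qed

lemma luxemburg_norm_le:
  "0 < k \<Longrightarrow> (\<integral>\<^sup>+t. ennreal (\<Phi> (cmod (f t) / k)) \<partial>\<mu>) \<le> 1 \<Longrightarrow> luxemburg_norm \<Phi> \<mu> f \<le> ennreal k"
  unfolding luxemburg_norm_def by (rule INF_lower) simp

lemma luxemburg_norm_lessD:
  assumes \<Phi>: "young_function \<Phi>" and less: "luxemburg_norm \<Phi> \<mu> f < ennreal k"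
  shows "0 < k" "(\<integral>\<^sup>+t. ennreal (\<Phi> (cmod (f t) / k)) \<partial>\<mu>) \<le> 1"
proof -
  from less obtain j where j: "0 < j" "(\<integral>\<^sup>+t. ennreal (\<Phi> (cmod (f t) / j)) \<partial>\<mu>) \<le> 1" "ennreal j < ennreal k"
    unfolding luxemburg_norm_def INF_less_iff by blast
  then have jk: "j < k" by (simp add: ennreal_less_iff)
  with j show "0 < k" by simp
  have "(\<integral>\<^sup>+t. ennreal (\<Phi> (cmod (f t) / k)) \<partial>\<mu>) \<le> (\<integral>\<^sup>+t. ennreal (\<Phi> (cmod (f t) / j)) \<partial>\<mu>)"
    using j jk by (intro nn_integral_mono ennreal_leI young_mono[OF \<Phi>] divide_left_mono) auto
  with j(2) show "(\<integral>\<^sup>+t. ennreal (\<Phi> (cmod (f t) / k)) \<partial>\<mu>) \<le> 1" by simp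
qed

text \<open>
Strict bounds avoid the question whether the infimum in the norm is attained.
\<close>

lemma luxemburg_norm_triangle:
  assumes \<Phi>: "young_function \<Phi>" and f: "f \<in> borel_measurable \<mu>" and g: "g \<in> borel_measurable \<mu>"
    and "luxemburg_norm \<Phi> \<mu> f < ennreal a" "luxemburg_norm \<Phi> \<mu> g < ennreal b"
  shows "luxemburg_norm \<Phi> \<mu> (\<lambda>t. f t + g t) \<le> ennreal (a + b)"
proof -
  note a = luxemburg_norm_lessD[OF \<Phi> assms(4)] and b = luxemburg_norm_lessD[OF \<Phi> assms(5)]
  define r where "r = a / (a + b)"
  have r: "0 \<le> r" "r \<le> 1" "1 - r = b / (a + b)" using a(1) b(1) by (auto simp: r_def field_simps)
  have pt: "\<Phi> (cmod (f t + g t) / (a + b)) \<le> r * \<Phi> (cmod (f t) / a) + (1 - r) * \<Phi> (cmod (g t) / b)" for t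
  proof -
    have "r * (cmod (f t) / a) = cmod (f t) / (a + b)" using a(1) by (simp add: r_def)
    moreover have "(1 - r) * (cmod (g t) / b) = cmod (g t) / (a + b)" unfolding r(3) using b(1) by simp
    ultimately have "cmod (f t + g t) / (a + b) \<le> r * (cmod (f t) / a) + (1 - r) * (cmod (g t) / b)"
      using a(1) b(1) norm_triangle_ineq[of "f t" "g t"] by (simp add: divide_right_mono flip: add_divide_distrib)
    then have "\<Phi> (cmod (f t + g t) / (a + b)) \<le> \<Phi> (r * (cmod (f t) / a) + (1 - r) * (cmod (g t) / b))"
      using a(1) b(1) by (intro young_mono[OF \<Phi>]) auto
    also have "\<dots> \<le> r * \<Phi> (cmod (f t) / a) + (1 - r) * \<Phi> (cmod (g t) / b)"
      using convex_onD[OF young_convex[OF \<Phi>], of "1 - r" "cmod (f t) / a" "cmod (g t) / b"] r(1,2) a(1) b(1) by simp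
    finally show ?thesis .
  qed
  have fm: "(\<lambda>t. \<Phi> (cmod (f t) / a)) \<in> borel_measurable \<mu>" using a(1) f by (intro borel_measurable_young[OF \<Phi>]) auto
  have gm: "(\<lambda>t. \<Phi> (cmod (g t) / b)) \<in> borel_measurable \<mu>" using b(1) g by (intro borel_measurable_young[OF \<Phi>]) auto
  have nn: "0 \<le> \<Phi> (cmod (f t) / a)" "0 \<le> \<Phi> (cmod (g t) / b)" for t
    using a(1) b(1) by (auto intro!: young_nonneg[OF \<Phi>])
  have "(\<integral>\<^sup>+t. ennreal (\<Phi> (cmod (f t + g t) / (a + b))) \<partial>\<mu>) \<le>
      (\<integral>\<^sup>+t. ennreal r * ennreal (\<Phi> (cmod (f t) / a)) + ennreal (1 - r) * ennreal (\<Phi> (cmod (g t) / b)) \<partial>\<mu>)"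
  proof (rule nn_integral_mono)
    fix t
    show "ennreal (\<Phi> (cmod (f t + g t) / (a + b))) \<le>
        ennreal r * ennreal (\<Phi> (cmod (f t) / a)) + ennreal (1 - r) * ennreal (\<Phi> (cmod (g t) / b))"
      using ennreal_leI[OF pt[of t]] r(1,2) nn[of t] by (simp add: ennreal_plus ennreal_mult)
  qed
  also have "\<dots> = ennreal r * (\<integral>\<^sup>+t. ennreal (\<Phi> (cmod (f t) / a)) \<partial>\<mu>) + ennreal (1 - r) * (\<integral>\<^sup>+t. ennreal (\<Phi> (cmod (g t) / b)) \<partial>\<mu>)"
    using fm gm by (subst nn_integral_add) (auto simp: nn_integral_cmult)
  also have "\<dots> \<le> ennreal r * 1 + ennreal (1 - r) * 1"
    using a(2) b(2) by (intro add_mono mult_left_mono) auto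
  also have "\<dots> = 1" using r by (simp flip: ennreal_plus)
  finally show ?thesis using a(1) b(1) by (intro luxemburg_norm_le) auto
qed

section \<open>Convolution of functions\<close>

context haar_measure
begin

lemma borel_measurable_section_integral:
  fixes F :: "'g \<times> 'g \<Rightarrow> ennreal"
  assumes F: "F \<in> borel_measurable borel"
  shows "(\<lambda>t. \<integral>\<^sup>+s. F (s, t) \<partial>m) \<in> borel_measurable borel"
  using nn_integral_iterated[OF radon_m radon_m measurable_compose[OF borel_measurable_swap F]] by simp

lemma borel_measurable_convolution_integrand:
  assumes u: "u \<in> borel_measurable borel" and v: "v \<in> borel_measurable borel"
  shows "(\<lambda>z :: 'g \<times> 'g. u (fst z) * v (- fst z + snd z) :: complex) \<in> borel_measurable borel"
  by (intro borel_measurable_times measurable_compose[OF borel_measurable_fst u] measurable_compose[OF borel_measurable_quotient v])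

text \<open>
The Bochner integral is 0 where the integrand is not integrable, so the convolution is the combination of four
nonnegative section integrals on the Borel set where the integral converges absolutely, and 0 elsewhere.
\<close>

lemma borel_measurable_convolution:
  assumes u: "u \<in> borel_measurable borel" and v: "v \<in> borel_measurable borel"
  shows "convolution m u v \<in> borel_measurable borel"
proof -
  define F where "F z = u (fst z) * v (- fst z + snd z)" for z :: "'g \<times> 'g"
  have F[measurable]: "F \<in> borel_measurable borel"
    unfolding F_def by (rule borel_measurable_convolution_integrand[OF u v])
  have Fm: "(\<lambda>s. F (s, t)) \<in> borel_measurable m" for t
    using measurable_compose[OF borel_measurable_Pair_right F] by (simp add: measurable_m)
  define J where "J G t = enn2real (\<integral>\<^sup>+s. ennreal (G (F (s, t))) \<partial>m)" for G :: "complex \<Rightarrow> real" and t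
  have J: "J G \<in> borel_measurable borel" if "G \<in> borel_measurable borel" for G
  proof -
    have "(\<lambda>z. ennreal (G (F z))) \<in> borel_measurable borel"
      using measurable_compose[OF F that] by simp
    then show ?thesis unfolding J_def by (intro borel_measurable_enn2real borel_measurable_section_integral)
  qed
  have [measurable]: "J Re \<in> borel_measurable borel" "J (\<lambda>z. - Re z) \<in> borel_measurable borel"
    "J Im \<in> borel_measurable borel" "J (\<lambda>z. - Im z) \<in> borel_measurable borel"
    by (intro J; measurable)+
  define I where "I = {t. (\<integral>\<^sup>+s. ennreal (cmod (F (s, t))) \<partial>m) < \<infinity>}"
  have Im[measurable]: "(\<lambda>t. \<integral>\<^sup>+s. ennreal (cmod (F (s, t))) \<partial>m) \<in> borel_measurable borel"
    by (rule borel_measurable_section_integral) measurable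
  have "{t \<in> space borel. (\<integral>\<^sup>+s. ennreal (cmod (F (s, t))) \<partial>m) < \<infinity>} \<in> sets borel" by measurable
  then have I: "I \<in> sets borel" by (simp add: I_def)
  have "convolution m u v t = indicator I t *\<^sub>R
      (of_real (J Re t - J (\<lambda>z. - Re z) t) + \<i> * of_real (J Im t - J (\<lambda>z. - Im z) t))" for t
  proof (cases "t \<in> I")
    case True
    then have i: "integrable m (\<lambda>s. F (s, t))"
      using Fm by (intro integrableI_bounded) (simp_all add: I_def)
    then have "integrable m (\<lambda>s. Re (F (s, t)))" "integrable m (\<lambda>s. Im (F (s, t)))" by auto
    then have "(LINT s|m. Re (F (s, t))) = J Re t - J (\<lambda>z. - Re z) t"
      "(LINT s|m. Im (F (s, t))) = J Im t - J (\<lambda>z. - Im z) t"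
      by (simp_all add: J_def real_lebesgue_integral_def)
    moreover have "convolution m u v t = (LINT s|m. F (s, t))" by (simp add: convolution_def F_def)
    ultimately show ?thesis using True i by (simp add: complex_eq_iff flip: integral_Re integral_Im)
  next
    case False
    then have "\<not> integrable m (\<lambda>s. F (s, t))" by (auto simp: I_def integrable_iff_bounded)
    then have "convolution m u v t = 0" by (simp add: convolution_def F_def not_integrable_integral_eq)
    with False show ?thesis by simp
  qed
  then have "convolution m u v = (\<lambda>t. indicator I t *\<^sub>R
      (of_real (J Re t - J (\<lambda>z. - Re z) t) + \<i> * of_real (J Im t - J (\<lambda>z. - Im z) t)))" by blast
  moreover have "\<dots> \<in> borel_measurable borel"
    using I by measurable
  ultimately show ?thesis by simp
qed

text \<open>
By Fubini's theorem the double integral of the modulus is the product of the two \<open>L\<^sup>1\<close> norms.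
\<close>

lemma AE_convolution_integrable:
  assumes u: "integrable m u" and v: "integrable m v"
  shows "AE t in m. integrable m (\<lambda>s. u s * v (- s + t) :: complex)"
proof -
  have um: "u \<in> borel_measurable borel" and vm: "v \<in> borel_measurable borel"
    using borel_measurable_integrable[OF u] borel_measurable_integrable[OF v] by (simp_all only: measurable_m)
  define F where "F z = ennreal (cmod (u (fst z) * v (- fst z + snd z)))" for z :: "'g \<times> 'g"
  have F: "F \<in> borel_measurable borel"
    unfolding F_def using borel_measurable_convolution_integrand[OF um vm] by measurable
  have "(\<integral>\<^sup>+t. \<integral>\<^sup>+s. F (s, t) \<partial>m \<partial>m) = (\<integral>\<^sup>+s. \<integral>\<^sup>+t. F (s, t) \<partial>m \<partial>m)"
    by (rule fubini_radon[OF radon_m radon_m F, symmetric])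
  also have "\<dots> = (\<integral>\<^sup>+s. ennreal (cmod (u s)) * (\<integral>\<^sup>+t. ennreal (cmod (v t)) \<partial>m) \<partial>m)"
  proof (rule nn_integral_cong)
    fix s
    have "(\<integral>\<^sup>+t. F (s, t) \<partial>m) = (\<integral>\<^sup>+t. ennreal (cmod (u s)) * ennreal (cmod (v (- s + t))) \<partial>m)"
      by (simp add: F_def norm_mult ennreal_mult)
    also have "\<dots> = ennreal (cmod (u s)) * (\<integral>\<^sup>+t. ennreal (cmod (v (- s + t))) \<partial>m)"
      using borel_measurable_translate[OF vm] by (intro nn_integral_cmult) (simp add: measurable_m)
    also have "(\<integral>\<^sup>+t. ennreal (cmod (v (- s + t))) \<partial>m) = (\<integral>\<^sup>+t. ennreal (cmod (v t)) \<partial>m)"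
      using vm by (intro nn_integral_left_translation[of "\<lambda>t. ennreal (cmod (v t))"]) simp
    finally show "(\<integral>\<^sup>+t. F (s, t) \<partial>m) = ennreal (cmod (u s)) * (\<integral>\<^sup>+t. ennreal (cmod (v t)) \<partial>m)" .
  qed
  also have "\<dots> = (\<integral>\<^sup>+s. ennreal (cmod (u s)) \<partial>m) * (\<integral>\<^sup>+t. ennreal (cmod (v t)) \<partial>m)"
    using um by (intro nn_integral_multc) (simp add: measurable_m)
  also have "\<dots> < \<infinity>"
    using u v by (simp add: integrable_iff_bounded ennreal_mult_less_top)
  finally have "(\<integral>\<^sup>+t. \<integral>\<^sup>+s. F (s, t) \<partial>m \<partial>m) \<noteq> \<infinity>" by simp
  then have "AE t in m. (\<integral>\<^sup>+s. F (s, t) \<partial>m) \<noteq> \<infinity>"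
    using borel_measurable_section_integral[OF F] by (intro nn_integral_PInf_AE) (simp_all add: measurable_m)
  then show ?thesis
  proof eventually_elim
    fix t assume t: "(\<integral>\<^sup>+s. F (s, t) \<partial>m) \<noteq> \<infinity>"
    have "(\<lambda>s. u s * v (- s + t)) \<in> borel_measurable m"
      using um borel_measurable_reflect[OF vm] by (simp add: measurable_m)
    with t show "integrable m (\<lambda>s. u s * v (- s + t))"
      by (intro integrableI_bounded) (simp_all add: F_def less_top)
  qed
qed

end

section \<open>Orlicz spaces of an invariant vector measure\<close>

lemma integral_abs_le_twice_set_integrals:
  fixes r :: "'a \<Rightarrow> real"
  assumes r: "integrable M r" and le: "\<And>A. A \<in> sets M \<Longrightarrow> \<bar>LINT t:A|M. r t\<bar> \<le> C"
  shows "(LINT t|M. \<bar>r t\<bar>) \<le> 2 * C"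
proof -
  have [measurable]: "r \<in> borel_measurable M" using r by auto
  define P where "P = {t\<in>space M. 0 \<le> r t}"
  define N where "N = {t\<in>space M. r t < 0}"
  have PN: "P \<in> sets M" "N \<in> sets M" unfolding P_def N_def by measurable
  have i: "integrable M (\<lambda>t. indicator P t *\<^sub>R r t)" "integrable M (\<lambda>t. indicator N t *\<^sub>R r t)"
    by (intro integrable_mult_indicator PN r)+
  have "(LINT t|M. \<bar>r t\<bar>) = (LINT t|M. indicator P t *\<^sub>R r t - indicator N t *\<^sub>R r t)"
    by (intro Bochner_Integration.integral_cong) (auto simp: P_def N_def indicator_def)
  also have "\<dots> = (LINT t:P|M. r t) - (LINT t:N|M. r t)"
    using i by (simp add: set_lebesgue_integral_def)
  also have "\<dots> \<le> 2 * C" using le[OF PN(1)] le[OF PN(2)] by linarith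
  finally show ?thesis .
qed

text \<open>
Round real and imaginary parts down to a grid.
\<close>

lemma uniform_simple_approx:
  fixes F :: "'a::topological_space \<Rightarrow> complex"
  assumes F[measurable]: "F \<in> borel_measurable borel" and K: "\<And>t. cmod (F t) \<le> K" and \<eta>: "0 < \<eta>"
  obtains \<psi> where "simple_function borel \<psi>" "\<And>t. cmod (F t - \<psi> t) \<le> \<eta>"
proof -
  define d where "d = \<eta> / 2"
  have d: "0 < d" using \<eta> by (simp add: d_def)
  define R where "R x = d * of_int \<lfloor>x / d\<rfloor>" for x :: real
  have R: "\<bar>x - R x\<bar> \<le> d" for x
  proof -
    have "of_int \<lfloor>x / d\<rfloor> \<le> x / d" "x / d < of_int \<lfloor>x / d\<rfloor> + 1" by linarith+
    then have "d * of_int \<lfloor>x / d\<rfloor> \<le> d * (x / d)" "d * (x / d) \<le> d * (of_int \<lfloor>x / d\<rfloor> + 1)"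
      using d by (intro mult_left_mono; simp)+
    then have "R x \<le> x" "x \<le> R x + d" using d by (simp_all add: R_def distrib_left)
    then show ?thesis by linarith
  qed
  have Rm[measurable]: "R \<in> borel_measurable borel" unfolding R_def by measurable
  define \<psi> where "\<psi> t = of_real (R (Re (F t))) + \<i> * of_real (R (Im (F t)))" for t
  have "\<psi> \<in> borel_measurable borel" unfolding \<psi>_def by measurable
  moreover have "finite (range \<psi>)"
  proof -
    define Z where "Z = (\<lambda>i::int. d * of_int i) ` {\<lfloor>- K / d\<rfloor>..\<lfloor>K / d\<rfloor>}"
    have Z: "R x \<in> Z" if "\<bar>x\<bar> \<le> K" for x
      unfolding R_def Z_def using that d
      using divide_right_mono[of "- K" x d] divide_right_mono[of x K d] by (intro imageI) (auto intro!: floor_mono)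
    have "range \<psi> \<subseteq> (\<lambda>(x, y). of_real x + \<i> * of_real y) ` (Z \<times> Z)"
      using Z order_trans[OF abs_Re_le_cmod K] order_trans[OF abs_Im_le_cmod K] by (auto simp: \<psi>_def)
    moreover have "finite ((\<lambda>(x, y). complex_of_real x + \<i> * of_real y) ` (Z \<times> Z))" by (auto simp: Z_def)
    ultimately show ?thesis by (rule finite_subset)
  qed
  ultimately have "simple_function borel \<psi>"
    by (intro simple_function_borel_measurable) auto
  moreover have "cmod (F t - \<psi> t) \<le> \<eta>" for t
  proof -
    have "cmod (F t - \<psi> t) \<le> \<bar>Re (F t - \<psi> t)\<bar> + \<bar>Im (F t - \<psi> t)\<bar>" by (rule cmod_le)
    also have "\<dots> \<le> d + d" using R[of "Re (F t)"] R[of "Im (F t)"] by (intro add_mono) (simp_all add: \<psi>_def)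
    finally show ?thesis by (simp add: d_def)
  qed
  ultimately show ?thesis by (rule that)
qed

context invariant_vector_measure
begin

lemma measurable_tv: "f \<in> borel_measurable (tv x') \<longleftrightarrow> f \<in> borel_measurable borel"
  using measurable_cong_sets[OF sets_tv refl] by blast

text \<open>
The values of \<open>\<nu>\<close> are bounded by some \<open>C\<close>; splitting a density into the positive and negative parts of its
real and imaginary parts bounds the variation of each functional in the ball by \<open>4 * C\<close>.
\<close>

lemma semivariation_bounded:
  obtains V where "0 \<le> V" "\<And>x'. x' \<in> dual_ball \<Longrightarrow> emeasure (tv x') UNIV \<le> ennreal V"
proof -
  obtain C where C: "0 \<le> C" "\<And>A. A \<in> sets m \<Longrightarrow> norm (\<nu> A) \<le> C"
    by (rule sigma_additive_bounded[OF sigma_additive_nu]) (rule that)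
  have "emeasure (tv x') UNIV \<le> ennreal (4 * C)" if x': "x' \<in> dual_ball" for x'
  proof -
    have i: "integrable m (dens x')" by (rule integrable_dens)
    have le: "cmod (LINT t:A|m. dens x' t) \<le> C" if A: "A \<in> sets m" for A
    proof -
      have "cmod (LINT t:A|m. dens x' t) = cmod (blinfun_apply x' (\<nu> A))"
        using A by (simp add: dens_integral sets_m)
      also have "\<dots> \<le> norm x' * norm (\<nu> A)" by (rule norm_blinfun)
      also have "\<dots> \<le> 1 * C" using x' C(2)[OF A] by (intro mult_mono) (auto simp: dual_ball_def)
      finally show ?thesis by simp
    qed
    have iA: "integrable m (\<lambda>t. indicator A t *\<^sub>R dens x' t)" if "A \<in> sets m" for A
      by (rule integrable_mult_indicator[OF that i])
    have "(LINT t|m. \<bar>Re (dens x' t)\<bar>) \<le> 2 * C"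
    proof (rule integral_abs_le_twice_set_integrals)
      fix A assume A: "A \<in> sets m"
      have "(LINT t:A|m. Re (dens x' t)) = Re (LINT t:A|m. dens x' t)"
        using iA[OF A] by (simp add: set_lebesgue_integral_def flip: integral_Re)
      then show "\<bar>LINT t:A|m. Re (dens x' t)\<bar> \<le> C"
        using abs_Re_le_cmod[of "LINT t:A|m. dens x' t"] le[OF A] by simp
    qed (use i in auto)
    moreover have "(LINT t|m. \<bar>Im (dens x' t)\<bar>) \<le> 2 * C"
    proof (rule integral_abs_le_twice_set_integrals)
      fix A assume A: "A \<in> sets m"
      have "(LINT t:A|m. Im (dens x' t)) = Im (LINT t:A|m. dens x' t)"
        using iA[OF A] by (simp add: set_lebesgue_integral_def flip: integral_Im)
      then show "\<bar>LINT t:A|m. Im (dens x' t)\<bar> \<le> C"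
        using abs_Im_le_cmod[of "LINT t:A|m. dens x' t"] le[OF A] by simp
    qed (use i in auto)
    moreover have "(LINT t|m. cmod (dens x' t)) \<le> (LINT t|m. \<bar>Re (dens x' t)\<bar> + \<bar>Im (dens x' t)\<bar>)"
      using i by (intro integral_mono) (auto intro: cmod_le)
    moreover have "(LINT t|m. \<bar>Re (dens x' t)\<bar> + \<bar>Im (dens x' t)\<bar>) = (LINT t|m. \<bar>Re (dens x' t)\<bar>) + (LINT t|m. \<bar>Im (dens x' t)\<bar>)"
      using i by (intro Bochner_Integration.integral_add) auto
    ultimately have "(LINT t|m. cmod (dens x' t)) \<le> 4 * C" by linarith
    moreover have "emeasure (tv x') UNIV = ennreal (LINT t|m. cmod (dens x' t))"
      unfolding tv_eq using borel_measurable_dens[of x'] i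
      by (subst emeasure_density) (auto simp: sets_m measurable_m intro!: nn_integral_eq_integral)
    ultimately show ?thesis by (simp add: ennreal_leI)
  qed
  with C(1) show ?thesis by (intro that[of "4 * C"]) simp_all
qed

lemma orlicz_norm_le:
  assumes "0 < k" "\<And>x'. x' \<in> dual_ball \<Longrightarrow> (\<integral>\<^sup>+t. ennreal (\<Phi> (cmod (f t) / k)) \<partial>tv x') \<le> 1"
  shows "orlicz_norm \<nu> \<Phi> f \<le> ennreal k"
  unfolding orlicz_norm_def using assms by (intro SUP_least luxemburg_norm_le)

lemma orlicz_norm_lessD:
  assumes \<Phi>: "young_function \<Phi>" and less: "orlicz_norm \<nu> \<Phi> f < ennreal k" and x': "x' \<in> dual_ball"
  shows "0 < k" "(\<integral>\<^sup>+t. ennreal (\<Phi> (cmod (f t) / k)) \<partial>tv x') \<le> 1"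
proof -
  have "luxemburg_norm \<Phi> (tv x') f \<le> orlicz_norm \<nu> \<Phi> f"
    unfolding orlicz_norm_def by (rule SUP_upper[OF x'])
  from this less have "luxemburg_norm \<Phi> (tv x') f < ennreal k" by (rule order_le_less_trans)
  from luxemburg_norm_lessD[OF \<Phi> this]
  show "0 < k" "(\<integral>\<^sup>+t. ennreal (\<Phi> (cmod (f t) / k)) \<partial>tv x') \<le> 1" by simp_all
qed

lemma orlicz_norm_triangle:
  assumes \<Phi>: "young_function \<Phi>" and f: "f \<in> borel_measurable borel" and g: "g \<in> borel_measurable borel"
    and "orlicz_norm \<nu> \<Phi> f < ennreal a" "orlicz_norm \<nu> \<Phi> g < ennreal b"
  shows "orlicz_norm \<nu> \<Phi> (\<lambda>t. f t + g t) \<le> ennreal (a + b)"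
  unfolding orlicz_norm_def
proof (rule SUP_least)
  fix x' :: "'x \<Rightarrow>\<^sub>L complex" assume x': "x' \<in> dual_ball"
  have le: "luxemburg_norm \<Phi> (tv x') h \<le> orlicz_norm \<nu> \<Phi> h" for h
    unfolding orlicz_norm_def by (rule SUP_upper[OF x'])
  show "luxemburg_norm \<Phi> (tv x') (\<lambda>t. f t + g t) \<le> ennreal (a + b)"
    using f g by (intro luxemburg_norm_triangle \<Phi> order_le_less_trans[OF le assms(4)] order_le_less_trans[OF le assms(5)])
      (simp_all only: measurable_tv)
qed

lemma orlicz_norm_cong:
  assumes "AE t in m. f t = g t"
  shows "orlicz_norm \<nu> \<Phi> f = orlicz_norm \<nu> \<Phi> g"
proof -
  have "(\<integral>\<^sup>+t. ennreal (\<Phi> (cmod (f t) / k)) \<partial>tv x') = (\<integral>\<^sup>+t. ennreal (\<Phi> (cmod (g t) / k)) \<partial>tv x')" for k and x' :: "'x \<Rightarrow>\<^sub>L complex"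
  proof (rule nn_integral_cong_AE)
    from AE_tv[OF assms, of x'] show "AE t in tv x'. ennreal (\<Phi> (cmod (f t) / k)) = ennreal (\<Phi> (cmod (g t) / k))"
      by eventually_elim simp
  qed
  then show ?thesis by (simp add: orlicz_norm_def luxemburg_norm_def)
qed

lemma orlicz_norm_translate:
  assumes \<Phi>: "young_function \<Phi>" and g: "g \<in> borel_measurable borel"
    and less: "orlicz_norm \<nu> \<Phi> g < ennreal k" and x': "x' \<in> dual_ball"
  shows "(\<integral>\<^sup>+t. ennreal (\<Phi> (cmod (g (- s + t)) / k)) \<partial>tv x') \<le> 1"
proof -
  have k: "0 < k" by (rule orlicz_norm_lessD(1)[OF \<Phi> less x'])
  have "(\<lambda>t. \<Phi> (cmod (g t) / k)) \<in> borel_measurable borel"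
    using k g by (intro borel_measurable_young[OF \<Phi>]) auto
  then have "(\<integral>\<^sup>+t. ennreal (\<Phi> (cmod (g (- s + t)) / k)) \<partial>tv x') \<le>
      (SUP x'\<in>dual_ball. \<integral>\<^sup>+t. ennreal (\<Phi> (cmod (g t) / k)) \<partial>tv x')"
    by (intro tv_translation_le_SUP[OF x', of "\<lambda>t. ennreal (\<Phi> (cmod (g t) / k))"]) simp
  also have "\<dots> \<le> 1" by (intro SUP_least orlicz_norm_lessD(2)[OF \<Phi> less])
  finally show ?thesis .
qed

lemma orlicz_norm_zero:
  assumes \<Phi>: "young_function \<Phi>" shows "orlicz_norm \<nu> \<Phi> (\<lambda>t. 0) = 0"
proof -
  have "orlicz_norm \<nu> \<Phi> (\<lambda>t. 0) \<le> 0"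
  proof (rule ennreal_le_epsilon)
    fix e :: real assume "0 < e"
    then show "orlicz_norm \<nu> \<Phi> (\<lambda>t. 0) \<le> 0 + ennreal e"
      using orlicz_norm_le[of e \<Phi> "\<lambda>t. 0"] by (simp add: young_0[OF \<Phi>])
  qed
  then show ?thesis by simp
qed

text \<open>
Uniform convergence is stronger than convergence in \<open>orlicz_norm\<close>, as the variations have bounded mass.
\<close>

lemma orlicz_norm_uniformly_small:
  assumes \<Phi>: "young_function \<Phi>" and e: "0 < e"
  obtains \<eta> where "0 < \<eta>" "\<forall>F. (\<forall>t. cmod (F t) \<le> \<eta>) \<longrightarrow> orlicz_norm \<nu> \<Phi> F \<le> ennreal e"
proof -
  obtain V where V: "0 \<le> V" "\<And>x'. x' \<in> dual_ball \<Longrightarrow> emeasure (tv x') UNIV \<le> ennreal V"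
    by (rule semivariation_bounded) (rule that)
  have \<Phi>1: "0 < \<Phi> 1" by (rule young_pos[OF \<Phi>]) simp
  \<comment> \<open>By convexity \<open>\<Phi> d \<le> d * \<Phi> 1\<close>, so this \<open>d\<close> satisfies \<open>\<Phi> d * V \<le> 1\<close>.\<close>
  define d where "d = 1 / (V * \<Phi> 1 + 1)"
  have pos: "1 \<le> V * \<Phi> 1 + 1" using V(1) \<Phi>1 by simp
  then have d: "0 < d" "d \<le> 1" by (simp_all add: d_def)
  have "\<Phi> (d * 1) \<le> d * \<Phi> 1" using d by (intro young_scale_le[OF \<Phi>]) auto
  then have "\<Phi> d * V \<le> d * \<Phi> 1 * V" using V(1) by (intro mult_right_mono) auto
  also have "\<dots> \<le> 1" using pos by (simp add: d_def mult.commute)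
  finally have dV: "\<Phi> d * V \<le> 1" .
  have "orlicz_norm \<nu> \<Phi> F \<le> ennreal e" if F: "\<And>t. cmod (F t) \<le> d * e" for F
  proof (rule orlicz_norm_le[OF e])
    fix x' :: "'x \<Rightarrow>\<^sub>L complex" assume x': "x' \<in> dual_ball"
    have "(\<integral>\<^sup>+t. ennreal (\<Phi> (cmod (F t) / e)) \<partial>tv x') \<le> (\<integral>\<^sup>+t. ennreal (\<Phi> d) \<partial>tv x')"
      using F e by (intro nn_integral_mono ennreal_leI young_mono[OF \<Phi>]) (auto simp: pos_divide_le_eq)
    also have "\<dots> = ennreal (\<Phi> d) * emeasure (tv x') UNIV"
      using sets_eq_imp_space_eq[OF sets_tv[of x']] by simp
    also have "\<dots> \<le> ennreal (\<Phi> d) * ennreal V" by (intro mult_left_mono V(2) x') simp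
    also have "\<dots> = ennreal (\<Phi> d * V)" using V(1) young_nonneg[OF \<Phi>, of d] d by (simp add: ennreal_mult)
    also have "\<dots> \<le> 1" using dV by (simp add: ennreal_le_1)
    finally show "(\<integral>\<^sup>+t. ennreal (\<Phi> (cmod (F t) / e)) \<partial>tv x') \<le> 1" .
  qed
  with d(1) e show ?thesis by (intro that[of "d * e"]) simp_all
qed

lemma exists_nonzero_dens:
  obtains x' where "x' \<in> dual_ball" "(\<integral>\<^sup>+t. ennreal (cmod (dens x' t)) \<partial>m) \<noteq> 0"
proof -
  obtain A where A: "A \<in> sets borel" "\<nu> A \<noteq> 0" using nonzero by (auto simp: nonzero_measure_def)
  obtain x' where x': "x' \<in> dual_ball" "blinfun_apply x' (\<nu> A) = of_real (norm (\<nu> A))"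
    by (rule norming_functional) (rule that)
  have "(\<integral>\<^sup>+t. ennreal (cmod (dens x' t)) \<partial>m) \<noteq> 0"
  proof
    assume "(\<integral>\<^sup>+t. ennreal (cmod (dens x' t)) \<partial>m) = 0"
    then have "AE t in m. dens x' t = 0"
      using borel_measurable_dens[of x'] by (subst (asm) nn_integral_0_iff_AE) (simp_all add: measurable_m)
    then have "AE t in m. indicator A t *\<^sub>R dens x' t = 0" by eventually_elim simp
    then have "(LINT t:A|m. dens x' t) = 0"
      unfolding set_lebesgue_integral_def by (rule integral_eq_zero_AE)
    with dens_integral[OF A(1), of x'] x'(2) A(2) show False by simp
  qed
  with x'(1) show ?thesis by (rule that)
qed

text \<open>
Take \<open>x'\<close> with nonzero density. Translation invariance bounds the integral of each translate of
\<open>\<Phi> (cmod g / k)\<close> against \<open>tv x'\<close> by 1. Averaging over all translations replaces \<open>tv x'\<close> by a nonzero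
multiple of Haar measure, and \<open>\<Phi>\<close> grows at least linearly.
\<close>

lemma integrable_weak_orlicz:
  assumes \<Phi>: "young_function \<Phi>" and g: "g \<in> weak_orlicz \<nu> \<Phi>"
  shows "integrable m g"
proof -
  have gm: "g \<in> borel_measurable borel" and fin: "orlicz_norm \<nu> \<Phi> g < \<infinity>"
    using g by (auto simp: weak_orlicz_def)
  obtain r where r: "orlicz_norm \<nu> \<Phi> g = ennreal r" "0 \<le> r" using fin by (cases "orlicz_norm \<nu> \<Phi> g") auto
  define k where "k = r + 1"
  have k: "orlicz_norm \<nu> \<Phi> g < ennreal k" "0 < k" using r by (simp_all add: k_def ennreal_less_iff)
  obtain x' where x': "x' \<in> dual_ball" "(\<integral>\<^sup>+t. ennreal (cmod (dens x' t)) \<partial>m) \<noteq> 0"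
    by (rule exists_nonzero_dens) (rule that)
  define G where "G t = ennreal (\<Phi> (cmod (g t) / k))" for t
  have G: "G \<in> borel_measurable borel"
    unfolding G_def using k gm by (intro measurable_compose[OF _ measurable_ennreal] borel_measurable_young[OF \<Phi>]) auto
  have hm: "(\<lambda>t. ennreal (cmod (dens x' t))) \<in> borel_measurable borel" using borel_measurable_dens[of x'] by simp
  define F where "F z = ennreal (cmod (dens x' (snd z))) * G (- fst z + snd z)" for z :: "'g \<times> 'g"
  have F: "F \<in> borel_measurable borel"
    unfolding F_def
    by (rule borel_measurable_times_ennreal[OF measurable_compose[OF borel_measurable_snd hm] measurable_compose[OF borel_measurable_quotient G]])
  have "(\<integral>\<^sup>+t. ennreal (cmod (dens x' t)) \<partial>m) * (\<integral>\<^sup>+t. G t \<partial>m) = (\<integral>\<^sup>+t. ennreal (cmod (dens x' t)) * (\<integral>\<^sup>+t. G t \<partial>m) \<partial>m)"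
    using hm by (intro nn_integral_multc[symmetric]) (simp add: measurable_m)
  also have "\<dots> = (\<integral>\<^sup>+t. \<integral>\<^sup>+s. F (s, t) \<partial>m \<partial>m)"
  proof (rule nn_integral_cong)
    fix t
    have "(\<integral>\<^sup>+s. F (s, t) \<partial>m) = (\<integral>\<^sup>+s. ennreal (cmod (dens x' t)) * G (- s + t) \<partial>m)" by (simp add: F_def)
    also have "\<dots> = ennreal (cmod (dens x' t)) * (\<integral>\<^sup>+s. G (- s + t) \<partial>m)"
      using borel_measurable_reflect[OF G, of t] by (intro nn_integral_cmult) (simp add: measurable_m)
    finally show "ennreal (cmod (dens x' t)) * (\<integral>\<^sup>+t. G t \<partial>m) = (\<integral>\<^sup>+s. F (s, t) \<partial>m)"
      by (simp add: nn_integral_reflected_translation[OF G])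
  qed
  also have "\<dots> = (\<integral>\<^sup>+s. \<integral>\<^sup>+t. F (s, t) \<partial>m \<partial>m)" by (rule fubini_radon[OF radon_m radon_m F, symmetric])
  also have "\<dots> \<le> (\<integral>\<^sup>+s. 1 \<partial>m)"
  proof (rule nn_integral_mono)
    fix s
    have "(\<integral>\<^sup>+t. F (s, t) \<partial>m) = (\<integral>\<^sup>+t. G (- s + t) \<partial>tv x')"
      unfolding nn_integral_tv[OF borel_measurable_translate[OF G]] by (simp add: F_def)
    also have "\<dots> \<le> 1" unfolding G_def by (rule orlicz_norm_translate[OF \<Phi> gm k(1) x'(1)])
    finally show "(\<integral>\<^sup>+t. F (s, t) \<partial>m) \<le> 1" .
  qed
  also have "\<dots> = 1" by (simp add: space_m m_UNIV)
  finally have "(\<integral>\<^sup>+t. ennreal (cmod (dens x' t)) \<partial>m) * (\<integral>\<^sup>+t. G t \<partial>m) < \<infinity>"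
    by (rule order_le_less_trans) simp
  then have Gfin: "(\<integral>\<^sup>+t. G t \<partial>m) < \<infinity>" using x'(2) by (auto simp: ennreal_mult_less_top)
  have \<Phi>1: "0 < \<Phi> 1" by (rule young_pos[OF \<Phi>]) simp
  \<comment> \<open>Convexity makes \<open>\<Phi> x / x\<close> increasing, so \<open>\<Phi>\<close> dominates a linear function beyond \<open>1\<close>.\<close>
  have lin: "x \<le> 1 + \<Phi> x / \<Phi> 1" if "0 \<le> x" for x
  proof (cases "x \<le> 1")
    case True
    then show ?thesis using young_nonneg[OF \<Phi> that] \<Phi>1 by (simp add: add_increasing2)
  next
    case False
    have "\<Phi> (1 / x * x) \<le> 1 / x * \<Phi> x" using False by (intro young_scale_le[OF \<Phi>]) auto
    then have "x \<le> \<Phi> x / \<Phi> 1" using False \<Phi>1 by (simp add: field_simps)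
    then show ?thesis by simp
  qed
  have "(\<integral>\<^sup>+t. ennreal (cmod (g t)) \<partial>m) \<le> (\<integral>\<^sup>+t. ennreal k + ennreal (k / \<Phi> 1) * G t \<partial>m)"
  proof (rule nn_integral_mono)
    fix t
    have "cmod (g t) = k * (cmod (g t) / k)" using k by simp
    also have "\<dots> \<le> k * (1 + \<Phi> (cmod (g t) / k) / \<Phi> 1)"
      using k by (intro mult_left_mono lin) auto
    finally have "ennreal (cmod (g t)) \<le> ennreal (k + k / \<Phi> 1 * \<Phi> (cmod (g t) / k))"
      by (intro ennreal_leI) (simp add: algebra_simps)
    then show "ennreal (cmod (g t)) \<le> ennreal k + ennreal (k / \<Phi> 1) * G t"
      using k \<Phi>1 young_nonneg[OF \<Phi>, of "cmod (g t) / k"] by (simp add: G_def ennreal_plus flip: ennreal_mult)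
  qed
  also have "\<dots> = ennreal k + ennreal (k / \<Phi> 1) * (\<integral>\<^sup>+t. G t \<partial>m)"
    using G by (simp add: nn_integral_add nn_integral_cmult measurable_m space_m m_UNIV)
  also have "\<dots> < \<infinity>" using Gfin by (simp add: ennreal_mult_less_top)
  finally show ?thesis using gm by (intro integrableI_bounded) (simp_all add: measurable_m)
qed

text \<open>
The case of the dual ball is the definition of \<open>L1_norm\<close>; the general case follows by scaling \<open>x'\<close>.
\<close>

lemma nn_integral_dens_le:
  assumes x': "x' \<in> dual" and f: "f \<in> borel_measurable borel"
  shows "(\<integral>\<^sup>+t. ennreal (cmod (f t * dens x' t)) \<partial>m) \<le> ennreal (norm x') * L1_norm \<nu> f"
proof -
  have ball: "(\<integral>\<^sup>+t. ennreal (cmod (f t * dens y' t)) \<partial>m) \<le> L1_norm \<nu> f" if "y' \<in> dual_ball" for y'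
  proof -
    have "(\<integral>\<^sup>+t. ennreal (cmod (f t * dens y' t)) \<partial>m) = (\<integral>\<^sup>+t. ennreal (cmod (f t)) \<partial>tv y')"
      using f by (subst nn_integral_tv) (auto simp: norm_mult ennreal_mult mult.commute)
    also have "\<dots> \<le> L1_norm \<nu> f" unfolding L1_norm_def by (rule SUP_upper[OF that])
    finally show ?thesis .
  qed
  \<comment> \<open>For \<open>x' = 0\<close> this is \<open>0\<close>, which lies in the ball as well.\<close>
  define a where "a = of_real (inverse (norm x')) *\<^sub>C x'"
  have a: "a \<in> dual_ball"
  proof -
    have "norm a \<le> 1" by (cases "x' = 0") (simp_all add: a_def norm_scaleC norm_inverse norm_divide)
    moreover have "a \<in> dual"
      using x' by (simp add: a_def dual_def scaleC_blinfun.rep_eq scaleC_complex_def)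
    ultimately show ?thesis by (simp add: dual_ball_def)
  qed
  have zero: "0 *\<^sub>C y = 0" for y :: "'x \<Rightarrow>\<^sub>L complex" using norm_scaleC[of 0 y] by simp
  have x'a: "x' = of_real (norm x') *\<^sub>C a"
    by (cases "x' = 0") (simp_all add: a_def scaleC_scaleC scaleC_one zero)
  have "AE t in m. dens x' t = of_real (norm x') * dens a t"
    using AE_dens_scale[of "of_real (norm x')" a] unfolding x'a[symmetric] .
  then have "(\<integral>\<^sup>+t. ennreal (cmod (f t * dens x' t)) \<partial>m) = (\<integral>\<^sup>+t. ennreal (norm x') * ennreal (cmod (f t * dens a t)) \<partial>m)"
    by (intro nn_integral_cong_AE) (auto simp: norm_mult ennreal_mult mult_ac)
  also have "\<dots> = ennreal (norm x') * (\<integral>\<^sup>+t. ennreal (cmod (f t * dens a t)) \<partial>m)"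
    using f borel_measurable_dens[of a] by (intro nn_integral_cmult) (simp add: measurable_m)
  also have "\<dots> \<le> ennreal (norm x') * L1_norm \<nu> f" by (intro mult_left_mono ball a) simp
  finally show ?thesis .
qed

text \<open>
Minkowski's integral inequality in modular form. With the probability weight \<open>w = cmod u / N\<close>, Jensen's
inequality bounds \<open>\<Phi> (cmod (u * g) / (N * k))\<close> by the \<open>w\<close>-average of the translates of \<open>\<Phi> (cmod g / k)\<close>.
After exchanging the integrals, each translate contributes at most 1.
\<close>

lemma orlicz_norm_convolution_le_of_bound:
  assumes \<Phi>: "young_function \<Phi>" and u: "integrable m u" and g: "g \<in> borel_measurable borel"
    and less: "orlicz_norm \<nu> \<Phi> g < ennreal k" and k: "0 < k"
  shows "orlicz_norm \<nu> \<Phi> (convolution m u g) \<le> ennreal ((LINT s|m. cmod (u s)) * k)"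
proof -
  define N where "N = (LINT s|m. cmod (u s))"
  have N0: "0 \<le> N" by (simp add: N_def)
  have um: "u \<in> borel_measurable borel" using borel_measurable_integrable[OF u] by (simp only: measurable_m)
  have nnu: "(\<integral>\<^sup>+s. ennreal (cmod (u s)) \<partial>m) = ennreal N"
    unfolding N_def using u by (intro nn_integral_eq_integral) auto
  show ?thesis
  proof (cases "N = 0")
    case True
    then have "(\<integral>\<^sup>+s. ennreal (cmod (u s)) \<partial>m) = 0" using nnu by simp
    then have "AE s in m. u s = 0"
      using um by (subst (asm) nn_integral_0_iff_AE) (simp_all add: measurable_m)
    then have "AE s in m. u s * g (- s + t) = 0" for t by eventually_elim simp
    then have "convolution m u g = (\<lambda>t. 0)"
      unfolding convolution_def by (intro ext integral_eq_zero_AE)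
    then show ?thesis by (simp add: orlicz_norm_zero[OF \<Phi>])
  next
    case False
    with N0 have N: "0 < N" by simp
    have "orlicz_norm \<nu> \<Phi> (convolution m u g) \<le> ennreal (N * k)"
    proof (rule orlicz_norm_le)
      show "0 < N * k" using N k by simp
      fix y' :: "'x \<Rightarrow>\<^sub>L complex" assume y': "y' \<in> dual_ball"
      define w where "w s = cmod (u s) / N" for s
      have w0: "0 \<le> w s" for s using N by (simp add: w_def)
      have wm: "w \<in> borel_measurable borel" unfolding w_def using um by measurable
      have w1: "(\<integral>\<^sup>+s. ennreal (w s) \<partial>m) = 1"
      proof -
        have "(\<integral>\<^sup>+s. ennreal (w s) \<partial>m) = (\<integral>\<^sup>+s. ennreal (cmod (u s)) / ennreal N \<partial>m)"
          using N by (simp add: w_def divide_ennreal)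
        also have "\<dots> = ennreal N / ennreal N"
          using um nnu by (subst nn_integral_divide) (simp_all add: measurable_m)
        finally show ?thesis using N by (simp add: divide_ennreal)
      qed
      define q where "q t = cmod (g t) / k" for t
      have q0: "0 \<le> q t" for t using k by (simp add: q_def)
      have qm: "q \<in> borel_measurable borel" unfolding q_def using g by measurable
      have \<Phi>qm: "(\<lambda>t. ennreal (\<Phi> (q t))) \<in> borel_measurable borel"
        by (intro measurable_compose[OF _ measurable_ennreal] borel_measurable_young[OF \<Phi> qm q0])
      have pt: "ennreal (\<Phi> (cmod (convolution m u g t) / (N * k))) \<le>
          (\<integral>\<^sup>+s. ennreal (w s) * ennreal (\<Phi> (q (- s + t))) \<partial>m)" for t
      proof (cases "integrable m (\<lambda>s. u s * g (- s + t))")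
        case True
        have wq: "w s * q (- s + t) = cmod (u s * g (- s + t)) / (N * k)" for s
          by (simp add: w_def q_def norm_mult)
        have "cmod (convolution m u g t) / (N * k) \<le> (LINT s|m. cmod (u s * g (- s + t))) / (N * k)"
          unfolding convolution_def using N k by (intro divide_right_mono integral_norm_bound) simp
        also have "\<dots> = (LINT s|m. w s * q (- s + t))" unfolding wq by simp
        finally have "ennreal (\<Phi> (cmod (convolution m u g t) / (N * k))) \<le> ennreal (\<Phi> (LINT s|m. w s * q (- s + t)))"
          using N k by (intro ennreal_leI young_mono[OF \<Phi>]) simp_all
        also have "\<dots> \<le> (\<integral>\<^sup>+s. ennreal (w s) * ennreal (\<Phi> (q (- s + t))) \<partial>m)"
        proof (rule young_jensen[OF \<Phi> _ w0 w1 _ q0])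
          show "w \<in> borel_measurable m" "(\<lambda>s. q (- s + t)) \<in> borel_measurable m"
            using wm borel_measurable_reflect[OF qm] by (simp_all only: measurable_m)
          show "integrable m (\<lambda>s. w s * q (- s + t))" unfolding wq using True by simp
        qed
        finally show ?thesis .
      next
        case False
        then have "convolution m u g t = 0" by (simp add: convolution_def not_integrable_integral_eq)
        then show ?thesis by (simp add: young_0[OF \<Phi>])
      qed
      define h where "h t = ennreal (cmod (dens y' t))" for t
      have hm: "h \<in> borel_measurable borel" unfolding h_def using borel_measurable_dens[of y'] by simp
      define F where "F z = h (snd z) * (ennreal (w (fst z)) * ennreal (\<Phi> (q (- fst z + snd z))))" for z :: "'g \<times> 'g"
      have F: "F \<in> borel_measurable borel"
        unfolding F_def
        by (rule borel_measurable_times_ennreal[OF measurable_compose[OF borel_measurable_snd hm]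
            borel_measurable_times_ennreal[OF measurable_compose[OF measurable_compose[OF borel_measurable_fst wm] measurable_ennreal]
              measurable_compose[OF borel_measurable_quotient \<Phi>qm]]])
      have Wm: "(\<lambda>t. ennreal (\<Phi> (cmod (convolution m u g t) / (N * k)))) \<in> borel_measurable borel"
        using borel_measurable_convolution[OF um g] N k
        by (intro measurable_compose[OF _ measurable_ennreal] borel_measurable_young[OF \<Phi>]) auto
      have "(\<integral>\<^sup>+t. ennreal (\<Phi> (cmod (convolution m u g t) / (N * k))) \<partial>tv y') =
          (\<integral>\<^sup>+t. h t * ennreal (\<Phi> (cmod (convolution m u g t) / (N * k))) \<partial>m)"
        unfolding nn_integral_tv[OF Wm] h_def ..
      also have "\<dots> \<le> (\<integral>\<^sup>+t. h t * (\<integral>\<^sup>+s. ennreal (w s) * ennreal (\<Phi> (q (- s + t))) \<partial>m) \<partial>m)"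
        by (intro nn_integral_mono mult_left_mono pt) simp
      also have "\<dots> = (\<integral>\<^sup>+t. \<integral>\<^sup>+s. F (s, t) \<partial>m \<partial>m)"
      proof (rule nn_integral_cong)
        fix t
        have "(\<lambda>s. ennreal (w s) * ennreal (\<Phi> (q (- s + t)))) \<in> borel_measurable m"
          using wm borel_measurable_reflect[OF \<Phi>qm, of t] by (simp add: measurable_m)
        then show "h t * (\<integral>\<^sup>+s. ennreal (w s) * ennreal (\<Phi> (q (- s + t))) \<partial>m) = (\<integral>\<^sup>+s. F (s, t) \<partial>m)"
          unfolding F_def by (simp add: nn_integral_cmult)
      qed
      also have "\<dots> = (\<integral>\<^sup>+s. \<integral>\<^sup>+t. F (s, t) \<partial>m \<partial>m)" by (rule fubini_radon[OF radon_m radon_m F, symmetric])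
      also have "\<dots> \<le> (\<integral>\<^sup>+s. ennreal (w s) \<partial>m)"
      proof (rule nn_integral_mono)
        fix s
        have tm: "(\<lambda>t. ennreal (\<Phi> (q (- s + t)))) \<in> borel_measurable borel" by (rule borel_measurable_translate[OF \<Phi>qm])
        have "(\<integral>\<^sup>+t. F (s, t) \<partial>m) = (\<integral>\<^sup>+t. ennreal (w s) * (h t * ennreal (\<Phi> (q (- s + t)))) \<partial>m)"
          by (simp add: F_def mult_ac)
        also have "\<dots> = ennreal (w s) * (\<integral>\<^sup>+t. h t * ennreal (\<Phi> (q (- s + t))) \<partial>m)"
          using hm tm by (intro nn_integral_cmult) (simp add: measurable_m)
        also have "(\<integral>\<^sup>+t. h t * ennreal (\<Phi> (q (- s + t))) \<partial>m) = (\<integral>\<^sup>+t. ennreal (\<Phi> (q (- s + t))) \<partial>tv y')"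
          unfolding nn_integral_tv[OF tm] h_def ..
        also have "ennreal (w s) * \<dots> \<le> ennreal (w s) * 1"
          unfolding q_def by (intro mult_left_mono orlicz_norm_translate[OF \<Phi> g less y']) simp
        finally show "(\<integral>\<^sup>+t. F (s, t) \<partial>m) \<le> ennreal (w s)" by simp
      qed
      finally show "(\<integral>\<^sup>+t. ennreal (\<Phi> (cmod (convolution m u g t) / (N * k))) \<partial>tv y') \<le> 1"
        by (simp add: w1)
    qed
    then show ?thesis by (simp add: N_def)
  qed
qed

text \<open>
The bound is applied with \<open>k\<close> slightly above the norm of \<open>g\<close>, as the infimum in the norm need not be
attained and the norm of \<open>g\<close> may be 0.
\<close>

theorem orlicz_norm_convolution:
  assumes \<Phi>: "young_function \<Phi>" and u: "integrable m u" and g: "g \<in> weak_orlicz \<nu> \<Phi>"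
  shows "orlicz_norm \<nu> \<Phi> (convolution m u g) \<le> (\<integral>\<^sup>+s. ennreal (cmod (u s)) \<partial>m) * orlicz_norm \<nu> \<Phi> g"
proof -
  define N where "N = (LINT s|m. cmod (u s))"
  have N0: "0 \<le> N" by (simp add: N_def)
  have nnu: "(\<integral>\<^sup>+s. ennreal (cmod (u s)) \<partial>m) = ennreal N"
    unfolding N_def using u by (intro nn_integral_eq_integral) auto
  have gm: "g \<in> borel_measurable borel" and fin: "orlicz_norm \<nu> \<Phi> g < \<infinity>"
    using g by (auto simp: weak_orlicz_def)
  obtain r where r: "orlicz_norm \<nu> \<Phi> g = ennreal r" "0 \<le> r" using fin by (cases "orlicz_norm \<nu> \<Phi> g") auto
  show ?thesis
  proof (rule ennreal_le_epsilon)
    fix e :: real assume e: "0 < e"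
    define d where "d = e / (N + 1)"
    have d: "0 < d" "N * d \<le> e" using e N0 by (simp_all add: d_def field_simps)
    have "orlicz_norm \<nu> \<Phi> (convolution m u g) \<le> ennreal (N * (r + d))"
      unfolding N_def using r d by (intro orlicz_norm_convolution_le_of_bound[OF \<Phi> u gm]) (simp_all add: ennreal_less_iff)
    also have "\<dots> \<le> ennreal (N * r + e)" using d by (intro ennreal_leI) (simp add: algebra_simps)
    also have "\<dots> = ennreal N * ennreal r + ennreal e"
      using N0 r e by (simp add: ennreal_plus ennreal_mult)
    finally show "orlicz_norm \<nu> \<Phi> (convolution m u g) \<le> (\<integral>\<^sup>+s. ennreal (cmod (u s)) \<partial>m) * orlicz_norm \<nu> \<Phi> g + ennreal e"
      by (simp add: nnu r)
  qed
qed

section \<open>The convolution operator\<close>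

lemma weak_L1D:
  assumes "f \<in> weak_L1 \<nu>"
  shows "f \<in> borel_measurable borel" "L1_norm \<nu> f < \<infinity>"
  using assms orlicz_norm_id[of f \<nu>] by (auto simp: weak_orlicz_def)

lemma integrable_times_dens:
  assumes f: "f \<in> weak_L1 \<nu>" and x': "x' \<in> dual"
  shows "integrable m (\<lambda>s. f s * dens x' s)"
proof (rule integrableI_bounded)
  show "(\<lambda>s. f s * dens x' s) \<in> borel_measurable m"
    using weak_L1D(1)[OF f] borel_measurable_dens[of x'] by (simp add: measurable_m)
  have "(\<integral>\<^sup>+s. ennreal (cmod (f s * dens x' s)) \<partial>m) \<le> ennreal (norm x') * L1_norm \<nu> f"
    by (rule nn_integral_dens_le[OF x' weak_L1D(1)[OF f]])
  also have "\<dots> < \<infinity>" using weak_L1D(2)[OF f] by (simp add: ennreal_mult_less_top)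
  finally show "(\<integral>\<^sup>+s. ennreal (norm (f s * dens x' s)) \<partial>m) < \<infinity>" .
qed

lemma orlicz_norm_nu_convolution:
  assumes \<Phi>: "young_function \<Phi>" and f: "f \<in> weak_L1 \<nu>" and g: "g \<in> weak_orlicz \<nu> \<Phi>" and x': "x' \<in> dual"
  shows "orlicz_norm \<nu> \<Phi> (nu_convolution m \<nu> f g x') \<le> ennreal (norm x') * L1_norm \<nu> f * orlicz_norm \<nu> \<Phi> g"
proof -
  have "orlicz_norm \<nu> \<Phi> (nu_convolution m \<nu> f g x') \<le>
      (\<integral>\<^sup>+s. ennreal (cmod (f s * dens x' s)) \<partial>m) * orlicz_norm \<nu> \<Phi> g"
    unfolding nu_convolution_def by (rule orlicz_norm_convolution[OF \<Phi> integrable_times_dens[OF f x'] g])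
  also have "\<dots> \<le> ennreal (norm x') * L1_norm \<nu> f * orlicz_norm \<nu> \<Phi> g"
    by (intro mult_right_mono nn_integral_dens_le[OF x' weak_L1D(1)[OF f]]) simp
  finally show ?thesis .
qed

text \<open>
The densities are additive only almost everywhere, which does not affect the integral over \<open>s\<close>. The
exceptional set comes from the points \<open>t\<close> where one of the two convolution integrals diverges.
\<close>

lemma nu_convolution_add:
  assumes \<Phi>: "young_function \<Phi>" and f: "f \<in> weak_L1 \<nu>" and g: "g \<in> weak_orlicz \<nu> \<Phi>"
    and x': "x' \<in> dual" and y': "y' \<in> dual"
  shows "nu_eq \<nu> (nu_convolution m \<nu> f g (x' + y'))
    (\<lambda>t. nu_convolution m \<nu> f g x' t + nu_convolution m \<nu> f g y' t)"
proof -
  have gi: "integrable m g" by (rule integrable_weak_orlicz[OF \<Phi> g])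
  have um: "(\<lambda>s. f s * dens z' s * g (- s + t)) \<in> borel_measurable m" for z' t
    using weak_L1D(1)[OF f] borel_measurable_dens[of z'] borel_measurable_reflect[OF borel_measurable_integrable[OF gi, unfolded measurable_m], of t]
    by (simp add: measurable_m)
  have "AE t in m. nu_convolution m \<nu> f g (x' + y') t = nu_convolution m \<nu> f g x' t + nu_convolution m \<nu> f g y' t"
    using AE_convolution_integrable[OF integrable_times_dens[OF f x'] gi] AE_convolution_integrable[OF integrable_times_dens[OF f y'] gi]
  proof eventually_elim
    fix t
    assume i: "integrable m (\<lambda>s. f s * dens x' s * g (- s + t))" "integrable m (\<lambda>s. f s * dens y' s * g (- s + t))"
    have "AE s in m. f s * dens (x' + y') s * g (- s + t) = f s * dens x' s * g (- s + t) + f s * dens y' s * g (- s + t)"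
      using AE_dens_add[of x' y'] by eventually_elim (simp add: algebra_simps)
    then have "nu_convolution m \<nu> f g (x' + y') t = (LINT s|m. f s * dens x' s * g (- s + t) + f s * dens y' s * g (- s + t))"
      unfolding nu_convolution_def convolution_def by (intro integral_cong_AE um borel_measurable_add)
    also have "\<dots> = nu_convolution m \<nu> f g x' t + nu_convolution m \<nu> f g y' t"
      unfolding nu_convolution_def convolution_def by (rule Bochner_Integration.integral_add[OF i])
    finally show "nu_convolution m \<nu> f g (x' + y') t = nu_convolution m \<nu> f g x' t + nu_convolution m \<nu> f g y' t" .
  qed
  then obtain N where "nu_null \<nu> N" "\<And>t. t \<notin> N \<Longrightarrow>
      nu_convolution m \<nu> f g (x' + y') t = nu_convolution m \<nu> f g x' t + nu_convolution m \<nu> f g y' t"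
    by (rule AE_imp_nu_null) (rule that)
  then show ?thesis unfolding nu_eq_def by (intro exI[of _ N]) simp
qed

lemma nu_convolution_scale:
  assumes f: "f \<in> borel_measurable borel" and g: "g \<in> borel_measurable borel"
  shows "nu_convolution m \<nu> f g (a *\<^sub>C x') t = a * nu_convolution m \<nu> f g x' t"
proof -
  have um: "(\<lambda>s. f s * dens z' s * g (- s + t)) \<in> borel_measurable m" for z'
    using f borel_measurable_dens[of z'] borel_measurable_reflect[OF g, of t] by (simp add: measurable_m)
  have "AE s in m. f s * dens (a *\<^sub>C x') s * g (- s + t) = a * (f s * dens x' s * g (- s + t))"
    using AE_dens_scale[of a x'] by eventually_elim (simp add: algebra_simps)
  then have "nu_convolution m \<nu> f g (a *\<^sub>C x') t = (LINT s|m. a * (f s * dens x' s * g (- s + t)))"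
    unfolding nu_convolution_def convolution_def by (intro integral_cong_AE um borel_measurable_times borel_measurable_const)
  then show ?thesis by (simp add: nu_convolution_def convolution_def)
qed

lemma nu_eq_refl: "nu_eq \<nu> h h"
  unfolding nu_eq_def nu_null_def
  by (intro exI[of _ "{}"]) (auto simp: sigma_additive_empty[OF sigma_additive_nu])

lemma nu_convolution_weak_orlicz:
  assumes \<Phi>: "young_function \<Phi>" and f: "f \<in> weak_L1 \<nu>" and g: "g \<in> weak_orlicz \<nu> \<Phi>" and x': "x' \<in> dual"
  shows "nu_convolution m \<nu> f g x' \<in> weak_orlicz \<nu> \<Phi>"
proof -
  have gm: "g \<in> borel_measurable borel" and fin: "orlicz_norm \<nu> \<Phi> g < \<infinity>"
    using g by (auto simp: weak_orlicz_def)
  have "nu_convolution m \<nu> f g x' \<in> borel_measurable borel"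
    unfolding nu_convolution_def
    using weak_L1D(1)[OF f] borel_measurable_dens[of x'] by (intro borel_measurable_convolution gm) simp
  moreover have "orlicz_norm \<nu> \<Phi> (nu_convolution m \<nu> f g x') < \<infinity>"
    using weak_L1D(2)[OF f] fin
    by (intro order_le_less_trans[OF orlicz_norm_nu_convolution[OF \<Phi> f g x']]) (simp add: ennreal_mult_less_top)
  ultimately show ?thesis by (simp add: weak_orlicz_def)
qed

lemma nu_convolution_operator:
  assumes \<Phi>: "young_function \<Phi>" and f: "f \<in> weak_L1 \<nu>" and g: "g \<in> weak_orlicz \<nu> \<Phi>"
    and Z: "\<And>x'. x' \<in> dual \<Longrightarrow> nu_convolution m \<nu> f g x' \<in> Z"
  shows "nu_convolution m \<nu> f g \<in> operators \<nu> \<Phi> Z"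
proof -
  have gm: "g \<in> borel_measurable borel" and fin: "orlicz_norm \<nu> \<Phi> g < \<infinity>"
    using g by (auto simp: weak_orlicz_def)
  obtain a where a: "L1_norm \<nu> f = ennreal a" "0 \<le> a"
    using weak_L1D(2)[OF f] by (cases "L1_norm \<nu> f") auto
  obtain b where b: "orlicz_norm \<nu> \<Phi> g = ennreal b" "0 \<le> b" using fin by (cases "orlicz_norm \<nu> \<Phi> g") auto
  have "orlicz_norm \<nu> \<Phi> (nu_convolution m \<nu> f g x') \<le> ennreal (a * b * norm x')" if "x' \<in> dual" for x'
    using orlicz_norm_nu_convolution[OF \<Phi> f g that] a b by (simp add: mult_ac flip: ennreal_mult)
  then have "\<exists>C::real. \<forall>x'\<in>dual. orlicz_norm \<nu> \<Phi> (nu_convolution m \<nu> f g x') \<le> ennreal (C * norm x')"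
    by blast
  moreover have "nu_eq \<nu> (nu_convolution m \<nu> f g (c *\<^sub>C x')) (\<lambda>t. c * nu_convolution m \<nu> f g x' t)" for c x'
    using nu_eq_refl by (simp add: nu_convolution_scale[OF weak_L1D(1)[OF f] gm, abs_def])
  ultimately show ?thesis
    unfolding operators_def using Z nu_convolution_add[OF \<Phi> f g] by simp
qed

lemma operator_norm_nu_convolution:
  assumes \<Phi>: "young_function \<Phi>" and f: "f \<in> weak_L1 \<nu>" and g: "g \<in> weak_orlicz \<nu> \<Phi>"
  shows "operator_norm \<nu> \<Phi> (nu_convolution m \<nu> f g) \<le> L1_norm \<nu> f * orlicz_norm \<nu> \<Phi> g"
  unfolding operator_norm_def
proof (rule SUP_least)
  fix x' :: "'x \<Rightarrow>\<^sub>L complex" assume x': "x' \<in> dual_ball"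
  have "orlicz_norm \<nu> \<Phi> (nu_convolution m \<nu> f g x') \<le> ennreal (norm x') * L1_norm \<nu> f * orlicz_norm \<nu> \<Phi> g"
    using x' by (intro orlicz_norm_nu_convolution \<Phi> f g) (simp add: dual_ball_def)
  also have "\<dots> \<le> 1 * L1_norm \<nu> f * orlicz_norm \<nu> \<Phi> g"
    using x' by (intro mult_right_mono) (auto simp: dual_ball_def ennreal_le_1)
  finally show "orlicz_norm \<nu> \<Phi> (nu_convolution m \<nu> f g x') \<le> L1_norm \<nu> f * orlicz_norm \<nu> \<Phi> g" by simp
qed

lemma convolution_bounded:
  assumes u: "integrable m u" and v: "v \<in> borel_measurable borel" "\<And>t. cmod (v t) \<le> K"
  shows "cmod (convolution m u v t) \<le> K * (LINT s|m. cmod (u s))"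
proof -
  have vm: "(\<lambda>s. v (- s + t)) \<in> borel_measurable m"
    using borel_measurable_reflect[OF v(1), of t] by (simp only: measurable_m)
  have "integrable m (\<lambda>s. v (- s + t) * u s)" by (rule integrable_bounded_mult[OF u vm v(2)])
  then have i: "integrable m (\<lambda>s. cmod (u s * v (- s + t)))" by (intro integrable_norm) (simp add: mult.commute)
  have "cmod (convolution m u v t) \<le> (LINT s|m. cmod (u s * v (- s + t)))"
    unfolding convolution_def by (rule integral_norm_bound)
  also have "\<dots> \<le> (LINT s|m. K * cmod (u s))"
  proof (rule integral_mono[OF i])
    show "integrable m (\<lambda>s. K * cmod (u s))" using u by simp
    show "cmod (u s * v (- s + t)) \<le> K * cmod (u s)" for s
      using mult_right_mono[OF v(2)[of "- s + t"] norm_ge_zero[of "u s"]] by (simp add: norm_mult mult.commute)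
  qed
  finally show ?thesis by simp
qed

text \<open>
Replace \<open>g\<close> by a simple \<open>\<phi>\<close>, then the bounded function \<open>convolution m u \<phi>\<close> by a rounded version of it.
\<close>

theorem convolution_simple_approx:
  assumes \<Phi>: "young_function \<Phi>" and u: "integrable m u" and g: "g \<in> orlicz \<nu> \<Phi>" and e: "0 < e"
  obtains \<psi> where "simple_function borel \<psi>" "orlicz_norm \<nu> \<Phi> (\<lambda>t. convolution m u g t - \<psi> t) \<le> ennreal e"
proof -
  have gw: "g \<in> weak_orlicz \<nu> \<Phi>" using g by (simp add: orlicz_def)
  have gm: "g \<in> borel_measurable borel" using gw by (simp add: weak_orlicz_def)
  have um: "u \<in> borel_measurable borel" using borel_measurable_integrable[OF u] by (simp only: measurable_m)
  define N where "N = (LINT s|m. cmod (u s))"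
  have N0: "0 \<le> N" by (simp add: N_def)
  have nnu: "(\<integral>\<^sup>+s. ennreal (cmod (u s)) \<partial>m) = ennreal N"
    unfolding N_def using u by (intro nn_integral_eq_integral) auto
  define d where "d = e / 4 / (N + 1)"
  have d: "0 < d" "N * d < e / 2" using e N0 by (simp_all add: d_def field_simps add_pos_nonneg)
  have "\<exists>\<phi>. simple_function borel \<phi> \<and> orlicz_norm \<nu> \<Phi> (\<lambda>t. g t - \<phi> t) < ennreal d"
    using g d(1) by (simp add: orlicz_def)
  then obtain \<phi> where \<phi>: "simple_function borel \<phi>" "orlicz_norm \<nu> \<Phi> (\<lambda>t. g t - \<phi> t) < ennreal d"
    by blast
  have \<phi>m: "\<phi> \<in> borel_measurable borel" using \<phi>(1) by (rule borel_measurable_simple_function)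
  have "finite (range (\<lambda>t. cmod (\<phi> t)))"
    using simple_functionD(1)[OF simple_function_compose1[OF \<phi>(1), of cmod]] by simp
  then have K_Max: "cmod (\<phi> t) \<le> Max (range (\<lambda>t. cmod (\<phi> t)))" for t by (intro Max_ge) auto
  define K where "K = Max (range (\<lambda>t. cmod (\<phi> t)))"
  have K: "cmod (\<phi> t) \<le> K" for t unfolding K_def by (rule K_Max)
  have \<phi>i: "integrable m \<phi>"
    using \<phi>m K finite_m by (intro finite_measure.integrable_const_bound[where B=K]) (simp_all add: measurable_m)
  have gi: "integrable m g" by (rule integrable_weak_orlicz[OF \<Phi> gw])
  have dm: "(\<lambda>t. g t - \<phi> t) \<in> borel_measurable borel" using gm \<phi>m by simp
  have dw: "(\<lambda>t. g t - \<phi> t) \<in> weak_orlicz \<nu> \<Phi>"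
    using dm order.strict_trans[OF \<phi>(2), of \<infinity>] by (simp add: weak_orlicz_def)
  have cm: "convolution m u \<phi> \<in> borel_measurable borel" by (rule borel_measurable_convolution[OF um \<phi>m])
  have e4: "0 < e / 4" using e by simp
  obtain \<eta> where \<eta>: "0 < \<eta>" "\<forall>F. (\<forall>t. cmod (F t) \<le> \<eta>) \<longrightarrow> orlicz_norm \<nu> \<Phi> F \<le> ennreal (e / 4)"
    by (rule orlicz_norm_uniformly_small[OF \<Phi> e4]) (rule that)
  obtain \<psi> where \<psi>: "simple_function borel \<psi>" "\<And>t. cmod (convolution m u \<phi> t - \<psi> t) \<le> \<eta>"
    by (rule uniform_simple_approx[OF cm convolution_bounded[OF u \<phi>m K] \<eta>(1)]) (rule that)
  have \<psi>m: "\<psi> \<in> borel_measurable borel" using \<psi>(1) by (rule borel_measurable_simple_function)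
  have "AE t in m. convolution m u g t - \<psi> t = convolution m u (\<lambda>t. g t - \<phi> t) t + (convolution m u \<phi> t - \<psi> t)"
    using AE_convolution_integrable[OF u gi] AE_convolution_integrable[OF u \<phi>i]
  proof eventually_elim
    fix t assume "integrable m (\<lambda>s. u s * g (- s + t))" "integrable m (\<lambda>s. u s * \<phi> (- s + t))"
    then have "convolution m u (\<lambda>t. g t - \<phi> t) t = convolution m u g t - convolution m u \<phi> t"
      by (simp add: convolution_def right_diff_distrib)
    then show "convolution m u g t - \<psi> t = convolution m u (\<lambda>t. g t - \<phi> t) t + (convolution m u \<phi> t - \<psi> t)" by simp
  qed
  then have "orlicz_norm \<nu> \<Phi> (\<lambda>t. convolution m u g t - \<psi> t) =
      orlicz_norm \<nu> \<Phi> (\<lambda>t. convolution m u (\<lambda>t. g t - \<phi> t) t + (convolution m u \<phi> t - \<psi> t))"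
    by (rule orlicz_norm_cong)
  also have "\<dots> \<le> ennreal (e / 2 + e / 2)"
  proof (rule orlicz_norm_triangle[OF \<Phi>])
    show "convolution m u (\<lambda>t. g t - \<phi> t) \<in> borel_measurable borel" by (rule borel_measurable_convolution[OF um dm])
    show "(\<lambda>t. convolution m u \<phi> t - \<psi> t) \<in> borel_measurable borel" using cm \<psi>m by simp
    have "orlicz_norm \<nu> \<Phi> (convolution m u (\<lambda>t. g t - \<phi> t)) \<le> ennreal N * orlicz_norm \<nu> \<Phi> (\<lambda>t. g t - \<phi> t)"
      using orlicz_norm_convolution[OF \<Phi> u dw] by (simp only: nnu)
    also have "\<dots> \<le> ennreal N * ennreal d" using \<phi>(2) by (intro mult_left_mono) auto
    also have "\<dots> = ennreal (N * d)" using N0 d by (simp add: ennreal_mult)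
    also have "\<dots> < ennreal (e / 2)" using d e N0 by (simp add: ennreal_less_iff)
    finally show "orlicz_norm \<nu> \<Phi> (convolution m u (\<lambda>t. g t - \<phi> t)) < ennreal (e / 2)" .
    have "orlicz_norm \<nu> \<Phi> (\<lambda>t. convolution m u \<phi> t - \<psi> t) \<le> ennreal (e / 4)" using \<eta>(2)[rule_format, OF \<psi>(2)] .
    also have "\<dots> < ennreal (e / 2)" using e by (simp add: ennreal_less_iff)
    finally show "orlicz_norm \<nu> \<Phi> (\<lambda>t. convolution m u \<phi> t - \<psi> t) < ennreal (e / 2)" .
  qed
  finally show ?thesis using \<psi>(1) by (intro that) simp_all
qed

lemma nu_convolution_orlicz:
  assumes \<Phi>: "young_function \<Phi>" and f: "f \<in> weak_L1 \<nu>" and g: "g \<in> orlicz \<nu> \<Phi>" and x': "x' \<in> dual"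
  shows "nu_convolution m \<nu> f g x' \<in> orlicz \<nu> \<Phi>"
proof -
  have gw: "g \<in> weak_orlicz \<nu> \<Phi>" using g by (simp add: orlicz_def)
  have "\<exists>\<psi>. simple_function borel \<psi> \<and> orlicz_norm \<nu> \<Phi> (\<lambda>t. nu_convolution m \<nu> f g x' t - \<psi> t) < e"
    if "0 < e" for e :: ennreal
  proof -
    obtain c where c: "0 < c" "c < e" using dense[OF \<open>0 < e\<close>] by blast
    then obtain r where r: "c = ennreal r" "0 \<le> r" by (cases c) auto
    with c have "0 < r" by simp
    obtain \<psi> where "simple_function borel \<psi>"
      "orlicz_norm \<nu> \<Phi> (\<lambda>t. convolution m (\<lambda>s. f s * dens x' s) g t - \<psi> t) \<le> ennreal r"
      by (rule convolution_simple_approx[OF \<Phi> integrable_times_dens[OF f x'] g \<open>0 < r\<close>]) (rule that)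
    with c(2) show ?thesis unfolding nu_convolution_def r(1) by (blast intro: order_le_less_trans)
  qed
  then show ?thesis
    using nu_convolution_weak_orlicz[OF \<Phi> f gw x'] by (simp add: orlicz_def)
qed

end

theorem theorem5p2:
  fixes m :: "'g::{topological_group_add, t2_space} measure"
    and \<nu> :: "'g set \<Rightarrow> 'x::complex_banach"
    and \<Phi> :: "real \<Rightarrow> real"
  assumes "compact (UNIV :: 'g set)"
    and "normalized_haar m"
    and "young_function \<Phi>"
    and "vector_measure \<nu>"
    and "nonzero_measure \<nu>"
    and "abs_cont \<nu> m"
    and "norm_integral_translation_invariant \<nu>"
  shows "(\<forall>f\<in>weak_L1 \<nu>. \<forall>g\<in>weak_orlicz \<nu> \<Phi>.
            nu_convolution m \<nu> f g \<in> operators \<nu> \<Phi> (weak_orlicz \<nu> \<Phi>) \<and>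
            operator_norm \<nu> \<Phi> (nu_convolution m \<nu> f g) \<le> L1_norm \<nu> f * orlicz_norm \<nu> \<Phi> g)
       \<and> (\<forall>f\<in>L1 \<nu>. \<forall>g\<in>orlicz \<nu> \<Phi>.
            nu_convolution m \<nu> f g \<in> operators \<nu> \<Phi> (orlicz \<nu> \<Phi>))"
proof -
  interpret invariant_vector_measure m \<nu>
    using assms by unfold_locales
  note \<Phi> = \<open>young_function \<Phi>\<close>
  show ?thesis
  proof (intro conjI ballI)
    fix f g assume fg: "f \<in> weak_L1 \<nu>" "g \<in> weak_orlicz \<nu> \<Phi>"
    show "nu_convolution m \<nu> f g \<in> operators \<nu> \<Phi> (weak_orlicz \<nu> \<Phi>)"
      by (intro nu_convolution_operator nu_convolution_weak_orlicz \<Phi> fg)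
    show "operator_norm \<nu> \<Phi> (nu_convolution m \<nu> f g) \<le> L1_norm \<nu> f * orlicz_norm \<nu> \<Phi> g"
      by (rule operator_norm_nu_convolution[OF \<Phi> fg])
  next
    fix f g assume fg: "f \<in> L1 \<nu>" "g \<in> orlicz \<nu> \<Phi>"
    then have w: "f \<in> weak_L1 \<nu>" "g \<in> weak_orlicz \<nu> \<Phi>" by (simp_all add: orlicz_def)
    show "nu_convolution m \<nu> f g \<in> operators \<nu> \<Phi> (orlicz \<nu> \<Phi>)"
      by (intro nu_convolution_operator nu_convolution_orlicz \<Phi> w fg(2))
  qed
qed

end
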